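(* Let $n\ge0$, let $\rho:G\to\mathrm{Isom}(M)$ be an isometric action of a group $G$ on a proper non-compact $CAT(0)$ space $M$, and let $A$ be a $\mathbb{Z}G$-module of type $FP_n$. Assume that the action $\rho$ is cocompact and that its orbits are discrete subsets of $M$. Then, for any point $b\in M$ with stabilizer $G_b\le G$, $\Sigma^n(M;A)=\partial M$ if and only if $A$ has type $FP_n$ as a $G_b$-module.
   Context: Setting. $\partial M$ is the set of asymptoty classes of geodesic rays in $(M,d)$, with the cone topology; $G$ acts on it. For a geodesic ray $\gamma$ with endpoint $\gamma(\infty)=e\in\partial M$, the Busemann function is $\beta_\gamma(x)=\lim_{t\to\infty}(t-d(x,\gamma(t)))$ (so it tends to $+\infty$ towards $e$). Resolutions and control. $fS$ is the set of finite subsets of a set $S$. A based free resolution $\mathbf F\twoheadrightarrow A$ is a resolution by free (left) $\mathbb{Z}G$-modules $F_k$, $k\ge0$, with chosen $\mathbb{Z}G$-bases $X_k$ and augmentation $\epsilon:F_0\to A$; $Y_k=GX_k$ is the induced $\mathbb{Z}$-basis, $X=\bigcup X_k$, $Y=\bigcup Y_k$. It is always assumed admissible: $\partial x\ne0$ for $x\in X_k$, $k\ge1$, and $\epsilon(x)\neq0$ for $x\in X_0$. $\mathbf F^{(n)}$ is the $n$-skeleton ($F_k$ replaced by $0$ for $k>n$). $A$ has type $FP_n$ if such a resolution exists with $\mathbf F^{(n)}$ finitely generated. For $c\in\mathbf F$, $\mathrm{supp}(c)\subseteq Y$ is the set of $y$ occurring in the expansion of $c$. A control map is a $G$-map $h:\mathbf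 F\to fM$ with $h(c)=\bigcup_{y\in\mathrm{supp}(c)}h(y)$ (so $h(0)=\emptyset$) and $h(x)\neq\emptyset$ for $x\in X$. Put $v_\gamma(c)=\min\beta_\gamma(h(c))$ for $c\ne0$, $v_\gamma(0)=\infty$, and $v_\gamma(a)=\infty$ for $a\in A$. Invariant. Choose $\mathbf F\twoheadrightarrow A$ with $\mathbf F^{(n)}$ finitely generated and a control map $h$ (the invariant does not depend on these choices). $\mathbf F\twoheadrightarrow A$ is $CA^{m-1}$ over $e=\gamma(\infty)$ if for every real $s$ there is $\lambda(s)\ge0$, with $s-\lambda(s)\to+\infty$ as $s\to+\infty$, such that for $-1\le i\le m-1$ every $i$-cycle $z$ of the augmented complex $\mathbf F\to A$ with $v_\gamma(z)\ge s$ is the boundary of an $(i+1)$-chain $c$ with $v_\gamma(c)\ge s-\lambda(s)$ (degree $-1$ being $A$, with boundary $\epsilon:F_0\to A$). $\Sigma^n(M;A)$ is the set of $e\in\partial M$ such that $\mathbf F\twoheadrightarrow A$ is $CA^{k}$ over $e$ for all $k$ with $-1\le k<n$. *)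

theory Defs
  imports
    "HOL-Analysis.Analysis"
    "HOL-Algebra.Module"
    "HOL-Algebra.Group_Action"
    "HOL-Library.Poly_Mapping"
begin

section \<open>CAT(0) geometry\<close>

text \<open>The space \<open>M\<close> is the universe of a type of class \<^class>\<open>metric_space\<close>.\<close>

definition geodesic_between :: "(real \<Rightarrow> 'm::metric_space) \<Rightarrow> 'm \<Rightarrow> 'm \<Rightarrow> bool" where
  "geodesic_between c x y \<longleftrightarrow> c 0 = x \<and> c (dist x y) = y \<and>
     (\<forall>s\<in>{0..dist x y}. \<forall>t\<in>{0..dist x y}. dist (c s) (c t) = \<bar>s - t\<bar>)"

text \<open>The point of a side of the comparison triangle that corresponds to \<open>c s\<close> is the value at \<open>s\<close> of
  the Euclidean geodesic parametrising that side. Two points on distinct sides lie, after naming the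
  vertices suitably, on two sides issuing from a common vertex \<open>p\<close>; for two points on the same side
  the comparison inequality is an equality.\<close>

definition CAT0 :: "'m::metric_space itself \<Rightarrow> bool" where
  "CAT0 _ \<longleftrightarrow>
     (\<forall>x y::'m. \<exists>c. geodesic_between c x y) \<and>
     (\<forall>(p::'m) q r c c' (p'::real^2) q' r' e e'.
        geodesic_between c p q \<and> geodesic_between c' p r \<and>
        dist p' q' = dist p q \<and> dist p' r' = dist p r \<and> dist q' r' = dist q r \<and>
        geodesic_between e p' q' \<and> geodesic_between e' p' r' \<longrightarrow>
        (\<forall>s\<in>{0..dist p q}. \<forall>t\<in>{0..dist p r}. dist (c s) (c' t) \<le> dist (e s) (e' t)))"

definition proper_space :: "'m::metric_space itself \<Rightarrow> bool" where
  "proper_space _ \<longleftrightarrow> (\<forall>(x::'m) r. compact (cball x r))"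

text \<open>Rays are functions on \<open>[0,\<infinity>)\<close>; their values at negative arguments are irrelevant.\<close>

definition geodesic_ray :: "(real \<Rightarrow> 'm::metric_space) \<Rightarrow> bool" where
  "geodesic_ray \<gamma> \<longleftrightarrow> (\<forall>s\<ge>0. \<forall>t\<ge>0. dist (\<gamma> s) (\<gamma> t) = \<bar>s - t\<bar>)"

definition asymptotic :: "((real \<Rightarrow> 'm::metric_space) \<times> (real \<Rightarrow> 'm)) set" where
  "asymptotic = {(\<gamma>, \<gamma>'). geodesic_ray \<gamma> \<and> geodesic_ray \<gamma>' \<and> (\<exists>K. \<forall>t\<ge>0. dist (\<gamma> t) (\<gamma>' t) \<le> K)}"

definition bdry_at_infinity :: "(real \<Rightarrow> 'm::metric_space) set set" where
  "bdry_at_infinity = {\<gamma>. geodesic_ray \<gamma>} // asymptotic"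

definition ray_end :: "(real \<Rightarrow> 'm::metric_space) \<Rightarrow> (real \<Rightarrow> 'm) set" where
  "ray_end \<gamma> = asymptotic `` {\<gamma>}"

definition busemann :: "(real \<Rightarrow> 'm::metric_space) \<Rightarrow> 'm \<Rightarrow> real" where
  "busemann \<gamma> x = Lim at_top (\<lambda>t. t - dist x (\<gamma> t))"

definition isometric_action ::
    "('g, 'b) monoid_scheme \<Rightarrow> ('g \<Rightarrow> 'm::metric_space \<Rightarrow> 'm) \<Rightarrow> bool" where
  "isometric_action G \<rho> \<longleftrightarrow> group_action G UNIV \<rho> \<and>
     (\<forall>g\<in>carrier G. \<forall>x y. dist (\<rho> g x) (\<rho> g y) = dist x y)"

definition cocompact_action ::
    "('g, 'b) monoid_scheme \<Rightarrow> ('g \<Rightarrow> 'm::metric_space \<Rightarrow> 'm) \<Rightarrow> bool" where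
  "cocompact_action G \<rho> \<longleftrightarrow> (\<exists>K. compact K \<and> (\<Union>g\<in>carrier G. \<rho> g ` K) = UNIV)"


section \<open>Modules over the integral group ring\<close>

text \<open>The multiplication is the bilinear extension of the multiplication of \<open>G\<close>. Passing to a
  subgroup \<open>H\<close> only shrinks the carrier, so a module over \<open>group_ring G\<close> is, as the same record, a
  module over \<open>group_ring (G\<lparr>carrier := H\<rparr>)\<close>.\<close>

definition group_ring :: "('g, 'b) monoid_scheme \<Rightarrow> ('g \<Rightarrow>\<^sub>0 int) ring" where
  "group_ring G =
    \<lparr>carrier = {a. Poly_Mapping.keys a \<subseteq> carrier G},
     mult = (\<lambda>a b. frag_extend (\<lambda>g. frag_extend (\<lambda>h. frag_of (g \<otimes>\<^bsub>G\<^esub> h)) b) a),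
     one = frag_of \<one>\<^bsub>G\<^esub>,
     zero = 0,
     add = (+)\<rparr>"

lemma ring_group_ring:
  assumes "group G"
  shows "ring (group_ring G)"
proof -
  interpret group G by fact
  let ?m = "\<lambda>a b. frag_extend (\<lambda>g. frag_extend (\<lambda>h. frag_of (g \<otimes>\<^bsub>G\<^esub> h)) b) a"
  have add_l: "?m (a + b) c = ?m a c + ?m b c" for a b c
    by (simp add: frag_extend_add)
  have pt_add: "frag_extend (\<lambda>g. u g + v g) a = frag_extend u a + frag_extend v a"
    for u v :: "'a \<Rightarrow> 'a \<Rightarrow>\<^sub>0 int" and a
    by (simp add: frag_extend_def frag_cmul_distrib2 sum.distrib)
  have add_r: "?m c (a + b) = ?m c a + ?m c b" for a b c
    by (simp add: frag_extend_add pt_add)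
  have diff_l: "?m (a - b) c = ?m a c - ?m b c" for a b c
    by (simp add: frag_extend_diff)
  have diff_r: "?m c (a - b) = ?m c a - ?m c b" for a b c
    using add_r[of "a - b" b c] by simp
  have zero_r: "?m c 0 = 0" for c
    by (simp add: frag_extend_eq_0)
  have keys_m: "Poly_Mapping.keys (?m a b) \<subseteq> carrier G"
    if "Poly_Mapping.keys a \<subseteq> carrier G" "Poly_Mapping.keys b \<subseteq> carrier G" for a b
  proof -
    have "Poly_Mapping.keys (frag_extend (\<lambda>h. frag_of (g \<otimes>\<^bsub>G\<^esub> h)) b) \<subseteq> carrier G"
      if "g \<in> Poly_Mapping.keys a" for g
      using keys_frag_extend[of "\<lambda>h. frag_of (g \<otimes>\<^bsub>G\<^esub> h)" b] that
        \<open>Poly_Mapping.keys a \<subseteq> carrier G\<close> \<open>Poly_Mapping.keys b \<subseteq> carrier G\<close>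
      by fastforce
    then show ?thesis
      using keys_frag_extend[of "\<lambda>g. frag_extend (\<lambda>h. frag_of (g \<otimes>\<^bsub>G\<^esub> h)) b" a] by blast
  qed
  have assoc: "?m (?m a b) c = ?m a (?m b c)"
    if a: "Poly_Mapping.keys a \<subseteq> carrier G" and b: "Poly_Mapping.keys b \<subseteq> carrier G"
      and c: "Poly_Mapping.keys c \<subseteq> carrier G" for a b c
    using a
  proof (induction a rule: frag_induction)
    case (one x)
    show ?case
      using b
    proof (induction b rule: frag_induction)
      case (one y)
      show ?case
        using c
        by (induction c rule: frag_induction)
          (use \<open>x \<in> _\<close> \<open>y \<in> _\<close> in \<open>simp_all add: m_assoc frag_extend_diff\<close>)
    qed (simp_all add: frag_extend_diff diff_r)
  qed (simp_all add: frag_extend_diff)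
  have one_l: "?m (frag_of \<one>\<^bsub>G\<^esub>) a = a" if a: "Poly_Mapping.keys a \<subseteq> carrier G" for a
    using a by (induction a rule: frag_induction) (simp_all add: frag_extend_diff)
  have one_r: "?m a (frag_of \<one>\<^bsub>G\<^esub>) = a" if a: "Poly_Mapping.keys a \<subseteq> carrier G" for a
    using a by (induction a rule: frag_induction) (simp_all add: frag_extend_diff)
  have keys_add': "Poly_Mapping.keys (a + b) \<subseteq> carrier G"
    if "Poly_Mapping.keys a \<subseteq> carrier G" "Poly_Mapping.keys b \<subseteq> carrier G"
    for a b :: "'a \<Rightarrow>\<^sub>0 int"
    using Poly_Mapping.keys_add[of a b] that by blast
  show ?thesis
  proof (rule ringI)
    show "abelian_group (group_ring G)"
    proof (rule abelian_groupI)
      fix x assume "x \<in> carrier (group_ring G)"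
      then show "\<exists>y\<in>carrier (group_ring G). y \<oplus>\<^bsub>group_ring G\<^esub> x = \<zero>\<^bsub>group_ring G\<^esub>"
        by (intro bexI[of _ "- x"]) (simp_all add: group_ring_def)
    qed (simp_all add: group_ring_def keys_add' add.assoc add.commute)
    show "monoid (group_ring G)"
      by (rule monoidI) (simp_all add: group_ring_def keys_m assoc one_l[simplified] one_r[simplified])
  qed (simp_all add: group_ring_def add_l add_r)
qed

text \<open>The library's locale \<^locale>\<open>Module.module\<close> without commutativity of the ring.\<close>

locale left_module = R?: ring R + M?: abelian_group M for R (structure) and M (structure) +
  assumes smult_closed [simp, intro]:
      "\<lbrakk>a \<in> carrier R; x \<in> carrier M\<rbrakk> \<Longrightarrow> a \<odot>\<^bsub>M\<^esub> x \<in> carrier M"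
    and smult_l_distr:
      "\<lbrakk>a \<in> carrier R; b \<in> carrier R; x \<in> carrier M\<rbrakk> \<Longrightarrow>
       (a \<oplus>\<^bsub>R\<^esub> b) \<odot>\<^bsub>M\<^esub> x = a \<odot>\<^bsub>M\<^esub> x \<oplus>\<^bsub>M\<^esub> b \<odot>\<^bsub>M\<^esub> x"
    and smult_r_distr:
      "\<lbrakk>a \<in> carrier R; x \<in> carrier M; y \<in> carrier M\<rbrakk> \<Longrightarrow>
       a \<odot>\<^bsub>M\<^esub> (x \<oplus>\<^bsub>M\<^esub> y) = a \<odot>\<^bsub>M\<^esub> x \<oplus>\<^bsub>M\<^esub> a \<odot>\<^bsub>M\<^esub> y"
    and smult_assoc:
      "\<lbrakk>a \<in> carrier R; b \<in> carrier R; x \<in> carrier M\<rbrakk> \<Longrightarrow>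
       (a \<otimes>\<^bsub>R\<^esub> b) \<odot>\<^bsub>M\<^esub> x = a \<odot>\<^bsub>M\<^esub> (b \<odot>\<^bsub>M\<^esub> x)"
    and smult_one [simp]:
      "x \<in> carrier M \<Longrightarrow> \<one>\<^bsub>R\<^esub> \<odot>\<^bsub>M\<^esub> x = x"

lemma left_module_group_ring_subgroup:
  assumes "group G" "left_module (group_ring G) A" "subgroup H G"
  shows "left_module (group_ring (G\<lparr>carrier := H\<rparr>)) A"
proof -
  interpret A: left_module "group_ring G" A by fact
  interpret group G by fact
  have sub: "carrier (group_ring (G\<lparr>carrier := H\<rparr>)) \<subseteq> carrier (group_ring G)"
    using subgroup.subset[OF assms(3)] by (auto simp: group_ring_def)
  have ops: "mult (group_ring (G\<lparr>carrier := H\<rparr>)) = mult (group_ring G)"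
    "one (group_ring (G\<lparr>carrier := H\<rparr>)) = one (group_ring G)"
    "add (group_ring (G\<lparr>carrier := H\<rparr>)) = add (group_ring G)"
    by (simp_all add: group_ring_def)
  show ?thesis
  proof (intro left_module.intro left_module_axioms.intro)
    show "ring (group_ring (G\<lparr>carrier := H\<rparr>))"
      by (intro ring_group_ring subgroup_imp_group assms)
    show "abelian_group A"
      by (rule A.M.abelian_group_axioms)
  qed (use sub in \<open>auto simp: ops A.smult_l_distr A.smult_r_distr A.smult_assoc subsetD\<close>)
qed

definition module_homs ::
    "('r, 'b) ring_scheme \<Rightarrow> ('r, 'u) module \<Rightarrow> ('r, 'v) module \<Rightarrow> ('u \<Rightarrow> 'v) set" where
  "module_homs R M N = {f \<in> carrier M \<rightarrow> carrier N.
     (\<forall>x\<in>carrier M. \<forall>y\<in>carrier M. f (x \<oplus>\<^bsub>M\<^esub> y) = f x \<oplus>\<^bsub>N\<^esub> f y) \<and>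
     (\<forall>a\<in>carrier R. \<forall>x\<in>carrier M. f (a \<odot>\<^bsub>M\<^esub> x) = a \<odot>\<^bsub>N\<^esub> f x)}"

definition module_basis :: "('r, 'b) ring_scheme \<Rightarrow> ('r, 'u) module \<Rightarrow> 'u set \<Rightarrow> bool" where
  "module_basis R M X \<longleftrightarrow> X \<subseteq> carrier M \<and>
     (\<forall>m\<in>carrier M. \<exists>!a. a \<in> X \<rightarrow>\<^sub>E carrier R \<and> finite {x\<in>X. a x \<noteq> \<zero>\<^bsub>R\<^esub>} \<and>
        m = (\<Oplus>\<^bsub>M\<^esub>x\<in>{x\<in>X. a x \<noteq> \<zero>\<^bsub>R\<^esub>}. a x \<odot>\<^bsub>M\<^esub> x))"

definition finitely_generated :: "('r, 'b) ring_scheme \<Rightarrow> ('r, 'u) module \<Rightarrow> bool" where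
  "finitely_generated R M \<longleftrightarrow> (\<exists>S\<subseteq>carrier M. finite S \<and>
     (\<forall>m\<in>carrier M. \<exists>a\<in>S \<rightarrow> carrier R. m = (\<Oplus>\<^bsub>M\<^esub>x\<in>S. a x \<odot>\<^bsub>M\<^esub> x)))"


section \<open>Based free resolutions and finiteness type\<close>

text \<open>\<open>bdr k\<close> is the boundary map from degree \<open>Suc k\<close> to degree \<open>k\<close>. The chain modules of all
  degrees have carriers in one type \<open>'f\<close>, but these carriers are unrelated to each other.\<close>

record ('g, 'f, 'a) based_complex =
  chain :: "nat \<Rightarrow> ('g \<Rightarrow>\<^sub>0 int, 'f) module"
  gens :: "nat \<Rightarrow> 'f set"
  bdr :: "nat \<Rightarrow> 'f \<Rightarrow> 'f"
  aug :: "'f \<Rightarrow> 'a"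

definition cycles ::
    "('g \<Rightarrow>\<^sub>0 int, 'a) module \<Rightarrow> ('g, 'f, 'a) based_complex \<Rightarrow> nat \<Rightarrow> 'f set" where
  "cycles A F k = (case k of
      0 \<Rightarrow> {z \<in> carrier (chain F 0). aug F z = \<zero>\<^bsub>A\<^esub>}
    | Suc j \<Rightarrow> {z \<in> carrier (chain F (Suc j)). bdr F j z = \<zero>\<^bsub>chain F j\<^esub>})"

definition based_free_resolution ::
    "('g, 'b) monoid_scheme \<Rightarrow> ('g \<Rightarrow>\<^sub>0 int, 'a) module \<Rightarrow> ('g, 'f, 'a) based_complex \<Rightarrow> bool" where
  "based_free_resolution G A F \<longleftrightarrow>
     left_module (group_ring G) A \<and>
     (\<forall>k. left_module (group_ring G) (chain F k) \<and>
          module_basis (group_ring G) (chain F k) (gens F k) \<and>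
          bdr F k \<in> module_homs (group_ring G) (chain F (Suc k)) (chain F k)) \<and>
     aug F \<in> module_homs (group_ring G) (chain F 0) A \<and>
     aug F ` carrier (chain F 0) = carrier A \<and>
     (\<forall>k. bdr F k ` carrier (chain F (Suc k)) = cycles A F k)"

definition admissible ::
    "('g \<Rightarrow>\<^sub>0 int, 'a) module \<Rightarrow> ('g, 'f, 'a) based_complex \<Rightarrow> bool" where
  "admissible A F \<longleftrightarrow> (\<forall>x\<in>gens F 0. aug F x \<noteq> \<zero>\<^bsub>A\<^esub>) \<and>
     (\<forall>k. \<forall>x\<in>gens F (Suc k). bdr F k x \<noteq> \<zero>\<^bsub>chain F k\<^esub>)"

definition fg_skeleton ::
    "('g, 'b) monoid_scheme \<Rightarrow> nat \<Rightarrow> ('g, 'f, 'a) based_complex \<Rightarrow> bool" where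
  "fg_skeleton G n F \<longleftrightarrow> (\<forall>k\<le>n. finitely_generated (group_ring G) (chain F k))"

text \<open>The elements of the resolution are taken from the type of finitely supported functions from
  \<open>G \<times> \<nat>\<close> to \<open>\<int>G\<close>. This is no restriction: if \<open>F\<^sub>0, \<dots>, F\<^sub>n\<close> are finitely generated, then they have
  cardinality at most \<open>max(|G|, \<aleph>\<^sub>0)\<close>, and beyond degree \<open>n\<close> the successive kernels can be
  resolved by free modules of at most that cardinality; the result can be transported to this type.\<close>

definition FP_type ::
    "nat \<Rightarrow> ('g, 'b) monoid_scheme \<Rightarrow> ('g \<Rightarrow>\<^sub>0 int, 'a) module \<Rightarrow> bool" where
  "FP_type n G A \<longleftrightarrow>
     (\<exists>F :: ('g, ('g \<times> nat) \<Rightarrow>\<^sub>0 ('g \<Rightarrow>\<^sub>0 int), 'a) based_complex.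
        based_free_resolution G A F \<and> admissible A F \<and> fg_skeleton G n F)"


section \<open>Control maps and the invariant\<close>

definition Z_basis ::
    "('g, 'b) monoid_scheme \<Rightarrow> ('g, 'f, 'a) based_complex \<Rightarrow> nat \<Rightarrow> 'f set" where
  "Z_basis G F k = {frag_of g \<odot>\<^bsub>chain F k\<^esub> x | g x. g \<in> carrier G \<and> x \<in> gens F k}"

definition supp ::
    "('g, 'b) monoid_scheme \<Rightarrow> ('g, 'f, 'a) based_complex \<Rightarrow> nat \<Rightarrow> 'f \<Rightarrow> 'f set" where
  "supp G F k c = Poly_Mapping.keys (THE a :: 'f \<Rightarrow>\<^sub>0 int.
     Poly_Mapping.keys a \<subseteq> Z_basis G F k \<and>
     c = (\<Oplus>\<^bsub>chain F k\<^esub>y\<in>Poly_Mapping.keys a.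
            [Poly_Mapping.lookup a y] \<cdot>\<^bsub>chain F k\<^esub> y))"

text \<open>Since \<open>h(c)\<close> is the union of the \<open>h(y)\<close> over the support, a control map is determined by its
  restrictions \<open>h k\<close> to the homogeneous parts \<open>F\<^sub>k\<close> of \<open>\<^bold>F\<close>.\<close>

definition control_map ::
    "('g, 'b) monoid_scheme \<Rightarrow> ('g \<Rightarrow> 'm \<Rightarrow> 'm) \<Rightarrow> ('g, 'f, 'a) based_complex \<Rightarrow>
     (nat \<Rightarrow> 'f \<Rightarrow> 'm set) \<Rightarrow> bool" where
  "control_map G \<rho> F h \<longleftrightarrow> (\<forall>k.
     (\<forall>c\<in>carrier (chain F k). finite (h k c) \<and>
        (\<forall>g\<in>carrier G. h k (frag_of g \<odot>\<^bsub>chain F k\<^esub> c) = \<rho> g ` h k c) \<and>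
        h k c = (\<Union>y\<in>supp G F k c. h k y)) \<and>
     (\<forall>x\<in>gens F k. h k x \<noteq> {}))"

definition valuation ::
    "('g, 'f, 'a) based_complex \<Rightarrow> (nat \<Rightarrow> 'f \<Rightarrow> 'm::metric_space set) \<Rightarrow> (real \<Rightarrow> 'm) \<Rightarrow>
     nat \<Rightarrow> 'f \<Rightarrow> ereal" where
  "valuation F h \<gamma> k c =
     (if c = \<zero>\<^bsub>chain F k\<^esub> then \<infinity> else ereal (Min (busemann \<gamma> ` h k c)))"

text \<open>The index \<open>k\<close> is the one of \<open>CA\<^sup>k\<close>. In degree \<open>-1\<close> the cycles are all elements of \<open>A\<close>, and the
  condition on their valuation is void because it is \<open>\<infinity>\<close>.\<close>

definition CA_along ::
    "int \<Rightarrow> ('g \<Rightarrow>\<^sub>0 int, 'a) module \<Rightarrow> ('g, 'f, 'a) based_complex \<Rightarrow>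
     (nat \<Rightarrow> 'f \<Rightarrow> 'm::metric_space set) \<Rightarrow> (real \<Rightarrow> 'm) \<Rightarrow> bool" where
  "CA_along k A F h \<gamma> \<longleftrightarrow> (\<exists>lag :: real \<Rightarrow> real.
     (\<forall>s. lag s \<ge> 0) \<and> filterlim (\<lambda>s. s - lag s) at_top at_top \<and>
     (\<forall>s.
        (-1 \<le> k \<longrightarrow> (\<forall>z\<in>carrier A. \<exists>c\<in>carrier (chain F 0).
           aug F c = z \<and> valuation F h \<gamma> 0 c \<ge> ereal (s - lag s))) \<and>
        (\<forall>i. int i \<le> k \<longrightarrow> (\<forall>z\<in>cycles A F i. valuation F h \<gamma> i z \<ge> ereal s \<longrightarrow>
           (\<exists>c\<in>carrier (chain F (Suc i)).
              bdr F i c = z \<and> valuation F h \<gamma> (Suc i) c \<ge> ereal (s - lag s))))))"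

text \<open>Busemann functions of asymptotic rays differ by a constant, so whether \<open>CA\<^sup>k\<close> holds depends
  only on the end point of the ray.\<close>

definition Sigma_inv ::
    "nat \<Rightarrow> ('g \<Rightarrow>\<^sub>0 int, 'a) module \<Rightarrow> ('g, 'f, 'a) based_complex \<Rightarrow>
     (nat \<Rightarrow> 'f \<Rightarrow> 'm::metric_space set) \<Rightarrow> (real \<Rightarrow> 'm) set set" where
  "Sigma_inv n A F h = {ray_end \<gamma> | \<gamma>. geodesic_ray \<gamma> \<and>
     (\<forall>k. -1 \<le> k \<and> k < int n \<longrightarrow> CA_along k A F h \<gamma>)}"

end

theory Submission
  imports Defs
begin

text \<open>Write \<open>H\<close> for the stabilizer of \<open>b\<close>. A \<open>G\<close>-map from the \<open>\<int>\<close>-basis of the resolution to \<open>M\<close> filters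
  it by the balls around \<open>b\<close>, and discreteness of the orbits makes the pieces of this filtration
  finitely generated over \<open>H\<close>. As in Brown's criterion, \<open>A\<close> has type \<open>FP\<^sub>n\<close> over \<open>H\<close> if and only if
  every cycle of degree less than \<open>n\<close> in a ball around \<open>b\<close> bounds in a larger ball whose radius
  depends only on the first one.

  If this holds, then by cocompactness it holds uniformly for balls around all points. Following the
  1-Lipschitz retraction of \<open>M\<close> to a ball of arbitrary radius, one builds a chain map homotopic to
  the identity that moves a filling of a cycle in that ball to within a fixed distance of it. Horoballs
  are increasing unions of balls, so the condition \<open>CA\<close> follows with a constant lag.

  Conversely, suppose that \<open>CA\<close> holds at all boundary points. The geodesic from a basis element to a
  far away point \<open>q\<close> is close to a ray on a long initial segment, and the rays from a point form a
  compact space. Degree by degree this gives a chain map homotopic to the identity that moves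
  everything far from \<open>q\<close> closer to \<open>q\<close>, with bounded displacement. Iterating the map for \<open>q = b\<close>
  moves any filling of a cycle in a ball into a ball of controlled radius. No extension of geodesics
  to rays through \<open>b\<close> is needed.

  Degree \<open>-1\<close> is avoided throughout: a filling of the boundary of \<open>w\<close> is written as \<open>w + d \<tau>\<close>, and in
  degree \<open>0\<close>, where \<open>d\<close> is zero, this is another lift of the augmentation of \<open>w\<close>.\<close>

section \<open>Geometry of rays and balls\<close>

text \<open>What shapes the converse direction is that the lag in \<open>CA\<close> is arbitrary and
  depends on the ray: a filling is available only for cycles that already lie deep in a horoball. So
  the boundary of a basis element is pushed by many iterates of the map of lower degree until its
  depth exceeds the lag, and compactness makes the number of iterates uniform. The target
  \<open>q\<close> ranges over all of \<open>M\<close>, so finiteness modulo \<open>G\<close> alone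
  gives no uniform displacement. For this reason the homotopy at a basis element is restricted to
  finitely many values as \<open>q\<close> varies, and equivariance is imposed on pairs of a target
  and a basis element.

  In the other direction the errors do not grow with the radius, because the retraction is
  1-Lipschitz: a basis element and its boundary, at distance at most \<open>D\<close>, stay within
  \<open>D\<close> after it.

  Chains are finitely supported integer functions on a free \<open>G\<close>-set with a map to
  \<open>M\<close>. The same set is a free \<open>H\<close>-set, so the resolution over
  \<open>G\<close> is used over \<open>H\<close> without change, and bounds on chains are statements
  about supports.\<close>

lemma comparison_triangle:
  fixes a b D :: real
  assumes "a > 0" "b \<ge> 0" "D \<ge> 0" "D \<le> a + b" "a \<le> b + D" "b \<le> a + D"
  obtains q r :: "real^2" where "norm q = a" "norm r = b" "norm (q - r) = D"
    "2 * inner q r = a\<^sup>2 + b\<^sup>2 - D\<^sup>2"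
proof -
  \<comment> \<open>By the law of cosines, \<alpha> is the coordinate of \<open>r\<close> along
    \<open>q\<close>. The triangle inequalities say exactly that \<bar>\<alpha>\<bar> \<le> b, so
    the other coordinate is real.\<close>
  define \<alpha> where "\<alpha> = (a\<^sup>2 + b\<^sup>2 - D\<^sup>2) / (2 * a)"
  have \<alpha>: "2 * a * \<alpha> = a\<^sup>2 + b\<^sup>2 - D\<^sup>2" using assms(1) by (simp add: \<alpha>_def)
  have "(a - b)\<^sup>2 \<le> D\<^sup>2" using assms by (intro power2_le_iff_abs_le[THEN iffD2]) auto
  moreover have "D\<^sup>2 \<le> (a + b)\<^sup>2" using assms by (intro power_mono) auto
  ultimately have "2 * a * \<alpha> \<le> 2 * a * b" "2 * a * (- b) \<le> 2 * a * \<alpha>"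
    unfolding \<alpha> by (auto simp: power2_eq_square algebra_simps)
  then have "\<alpha> \<le> b" "- b \<le> \<alpha>"
    using assms(1) mult_le_cancel_left_pos[of "2 * a" \<alpha> b] mult_le_cancel_left_pos[of "2 * a" "- b" \<alpha>] by auto
  then have sq: "\<alpha>\<^sup>2 \<le> b\<^sup>2" using assms by (intro power2_le_iff_abs_le[THEN iffD2]) auto
  define q where "q = (vector [a, 0] :: real^2)"
  define r where "r = (vector [\<alpha>, sqrt (b\<^sup>2 - \<alpha>\<^sup>2)] :: real^2)"
  have i: "inner q q = a\<^sup>2" "inner r r = b\<^sup>2" "inner q r = a * \<alpha>"
    using sq by (auto simp: q_def r_def inner_vec_def sum_2 power2_eq_square real_sqrt_mult_self)
  have "inner (q - r) (q - r) = a\<^sup>2 + b\<^sup>2 - 2 * (a * \<alpha>)"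
    by (simp add: inner_diff_left inner_diff_right inner_commute[of r q] i)
  also have "\<dots> = D\<^sup>2" using \<alpha> by simp
  finally have "norm (q - r) = D" using assms by (simp add: norm_eq_sqrt_inner)
  moreover have "norm q = a" "norm r = b" using assms i by (simp_all add: norm_eq_sqrt_inner)
  ultimately show ?thesis using that[of q r] i \<alpha> by simp
qed

text \<open>The right-hand side is the squared Euclidean distance of the comparison points, arranged
  so that \<open>dist x y\<close> enters only through the nonnegative defect
  \<open>(dist x y)\<^sup>2 - (dist p x - dist p y)\<^sup>2\<close>. In this form both the
  contraction onto balls and the convergence to Busemann functions can be read off.\<close>

lemma CAT0_dist_geodesics_le:
  fixes p :: "'m::metric_space"
  assumes "CAT0 TYPE('m)" and c: "geodesic_between c p x" "geodesic_between c' p y"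
    and s: "0 \<le> s" "s \<le> dist p x" and t: "0 \<le> t" "t \<le> dist p y"
    and pos: "dist p x > 0" "dist p y > 0"
  shows "(dist (c s) (c' t))\<^sup>2 \<le>
    (s - t)\<^sup>2 + (s * t / (dist p x * dist p y)) * ((dist x y)\<^sup>2 - (dist p x - dist p y)\<^sup>2)"
proof -
  define a b D where abD: "a = dist p x" "b = dist p y" "D = dist x y"
  have tri: "D \<le> a + b" "a \<le> b + D" "b \<le> a + D"
    unfolding abD by (metis dist_commute dist_triangle)+
  obtain q r :: "real^2" where qr: "norm q = a" "norm r = b" "norm (q - r) = D"
    "2 * inner q r = a\<^sup>2 + b\<^sup>2 - D\<^sup>2"
    using comparison_triangle[OF _ _ _ tri] pos abD by auto
  define e where "e u = (u / a) *\<^sub>R q" for u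
  define e' where "e' u = (u / b) *\<^sub>R r" for u
  have pos': "a > 0" "b > 0" using pos abD by auto
  have d: "dist (0::real^2) q = a" "dist (0::real^2) r = b" "dist q r = D"
    using qr by (simp_all add: dist_norm)
  have ge: "geodesic_between e 0 q" "geodesic_between e' 0 r"
    using pos' qr by (auto simp: geodesic_between_def d e_def e'_def dist_norm
        simp flip: scaleR_left_diff_distrib diff_divide_distrib)
  have "dist (c s) (c' t) \<le> dist (e s) (e' t)"
    using assms(1) c ge d s t unfolding CAT0_def abD by (smt (verit) atLeastAtMost_iff)
  then have "(dist (c s) (c' t))\<^sup>2 \<le> (dist (e s) (e' t))\<^sup>2" by (simp add: power_mono)
  also have "\<dots> = inner (e s - e' t) (e s - e' t)" by (simp add: dist_norm power2_norm_eq_inner)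
  also have "\<dots> = (s/a)\<^sup>2 * inner q q + (t/b)\<^sup>2 * inner r r - (s/a)*(t/b) * (2 * inner q r)"
    by (simp add: e_def e'_def inner_diff_left inner_diff_right inner_commute[of r q] power2_eq_square algebra_simps)
  also have "inner q q = a\<^sup>2" using qr by (simp add: power2_norm_eq_inner[symmetric])
  also have "inner r r = b\<^sup>2" using qr by (simp add: power2_norm_eq_inner[symmetric])
  also have "(s/a)\<^sup>2 * a\<^sup>2 + (t/b)\<^sup>2 * b\<^sup>2 - (s/a)*(t/b) * (2 * inner q r)
     = (s - t)\<^sup>2 + (s * t / (a * b)) * (D\<^sup>2 - (a - b)\<^sup>2)"
    unfolding qr(4) using pos' by (simp add: field_simps power2_eq_square)
  finally show ?thesis unfolding abD .
qed

text \<open>Truncation at radius \<open>r\<close> gives \<bar>s - t\<bar> \<le> \<bar>a - b\<bar>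
  and \<open>s * t \<le> a * b\<close>. So the two terms of the comparison bound are at most
  \<open>(a - b)\<^sup>2\<close> and \<open>(dist x y)\<^sup>2 - (a - b)\<^sup>2\<close>, and these
  add up to the square of the distance. A side of length 0 is treated apart because the bound
  divides by \<open>a * b\<close>.\<close>

lemma geodesic_radial_contraction:
  fixes p :: "'m::metric_space"
  assumes "CAT0 TYPE('m)" and c: "geodesic_between c p x" "geodesic_between c' p y" and r: "0 \<le> r"
  shows "dist (c (min r (dist p x))) (c' (min r (dist p y))) \<le> dist x y"
proof -
  define a b where ab: "a = dist p x" "b = dist p y"
  define s t where st: "s = min r a" "t = min r b"
  have tri: "\<bar>a - b\<bar> \<le> dist x y" unfolding ab
    by (metis abs_dist_diff_le dist_commute)
  have d0: "dist (c u) p = u" if "0 \<le> u" "u \<le> a" for u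
    using c(1) that unfolding geodesic_between_def ab
    by (metis abs_of_nonneg atLeastAtMost_iff diff_zero order_refl order_trans)
  have d0': "dist (c' u) p = u" if "0 \<le> u" "u \<le> b" for u
    using c(2) that unfolding geodesic_between_def ab
    by (metis abs_of_nonneg atLeastAtMost_iff diff_zero order_refl order_trans)
  have nn: "0 \<le> a" "0 \<le> b" "0 \<le> s" "0 \<le> t" "s \<le> a" "t \<le> b" using r by (auto simp: ab st)
  consider "a = 0" | "b = 0" | "a > 0" "b > 0" using nn by linarith
  then have "dist (c s) (c' t) \<le> dist x y"
  proof cases
    case 1
    then have "s = 0" using nn by auto
    then have "c s = p" using c(1) by (simp add: geodesic_between_def)
    then have "dist (c s) (c' t) = t" using d0'[of t] nn by (simp add: dist_commute)
    then show ?thesis using nn tri 1 by linarith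
  next
    case 2
    then have "t = 0" using nn by auto
    then have "c' t = p" using c(2) by (simp add: geodesic_between_def)
    then have "dist (c s) (c' t) = s" using d0[of s] nn by (simp add: dist_commute)
    then show ?thesis using nn tri 2 by linarith
  next
    case 3
    have "(dist (c s) (c' t))\<^sup>2 \<le> (s - t)\<^sup>2 + (s * t / (a * b)) * ((dist x y)\<^sup>2 - (a - b)\<^sup>2)"
      unfolding ab by (rule CAT0_dist_geodesics_le[OF assms(1) c]) (use nn 3 ab in auto)
    also have "\<dots> \<le> (a - b)\<^sup>2 + 1 * ((dist x y)\<^sup>2 - (a - b)\<^sup>2)"
    proof (intro add_mono mult_right_mono)
      show "(s - t)\<^sup>2 \<le> (a - b)\<^sup>2" by (intro abs_le_square_iff[THEN iffD1]) (auto simp: st)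
      have "s * t \<le> a * b" using nn by (intro mult_mono) auto
      then show "s * t / (a * b) \<le> 1" using 3 by simp
      show "0 \<le> (dist x y)\<^sup>2 - (a - b)\<^sup>2" using tri abs_le_square_iff[of "a-b" "dist x y"] by simp
    qed
    also have "\<dots> = (dist x y)\<^sup>2" by simp
    finally show ?thesis by (rule power2_le_imp_le) simp
  qed
  then show ?thesis unfolding st ab .
qed

text \<open>Any choice of geodesics from \<open>q\<close> works, because the contraction lemma
  compares arbitrary pairs. The formula for \<open>dist x (ret x)\<close> will bound how far points
  just outside the ball are moved.\<close>

lemma CAT0_ball_retraction:
  fixes q :: "'m::metric_space"
  assumes "CAT0 TYPE('m)" and r: "0 \<le> r"
  obtains ret :: "'m \<Rightarrow> 'm" where "\<And>x y. dist (ret x) (ret y) \<le> dist x y"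
    "\<And>x. dist q (ret x) \<le> r" "\<And>x. dist x (ret x) = max 0 (dist q x - r)"
proof -
  have "\<forall>x. \<exists>c. geodesic_between c q x" using assms(1) unfolding CAT0_def by blast
  then obtain c where c: "\<And>x. geodesic_between (c x) q x" by metis
  define ret where "ret x = c x (min r (dist q x))" for x
  show ?thesis
  proof
    show "dist (ret x) (ret y) \<le> dist x y" for x y
      unfolding ret_def by (rule geodesic_radial_contraction[OF assms(1) c c r])
    have e: "c x 0 = q" "c x (dist q x) = x" "\<And>s t. 0 \<le> s \<Longrightarrow> s \<le> dist q x \<Longrightarrow> 0 \<le> t \<Longrightarrow> t \<le> dist q x
       \<Longrightarrow> dist (c x s) (c x t) = \<bar>s - t\<bar>" for x
      using c[of x] by (auto simp: geodesic_between_def)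
    show "dist q (ret x) \<le> r" for x
      using e(3)[of 0 x "min r (dist q x)"] r unfolding ret_def e(1) by auto
    show "dist x (ret x) = max 0 (dist q x - r)" for x
      using e(3)[of "dist q x" x "min r (dist q x)"] r unfolding ret_def e(2) by auto
  qed
qed

text \<open>For fixed \<open>x\<close>, \<open>T - dist x (c T)\<close> is the Busemann function cut
  off at time \<open>T\<close>. It increases along the geodesic, and after time \<open>s\<close> it
  gains at most \<open>r\<^sup>2 / (2 * (s - r))\<close>, however long the geodesic is. So a far
  away point and a ray can be compared on an initial segment of fixed length.\<close>

lemma CAT0_geodesic_defect:
  fixes x :: "'m::metric_space"
  assumes C: "CAT0 TYPE('m)" and c: "\<And>s t. \<lbrakk>0 \<le> s; s \<le> T; 0 \<le> t; t \<le> T\<rbrakk> \<Longrightarrow> dist (c s) (c t) = \<bar>s - t\<bar>"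
    and r: "dist (c 0) x \<le> r" and s: "r < s" "s \<le> T"
  shows "s - dist x (c s) \<le> T - dist x (c T)"
    and "T - dist x (c T) \<le> s - dist x (c s) + r\<^sup>2 / (2 * (s - r))"
proof -
  define o' where "o' = c 0"
  define \<rho> where "\<rho> = dist o' x"
  have r0: "0 \<le> r" using r zero_le_dist[of "c 0" x] by linarith
  have T: "0 < T" "0 < s" using s r0 by auto
  show "s - dist x (c s) \<le> T - dist x (c T)"
    using dist_triangle[of x "c T" "c s"] c[of s T] s T by auto
  define a where "a = T - dist x (c T)"
  have oT: "dist o' (c T) = T" using c[of 0 T] T by (simp add: o'_def)
  have al: "\<bar>a\<bar> \<le> \<rho>" using abs_dist_diff_le[of o' "c T" x] oT by (simp add: a_def \<rho>_def dist_commute)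
  have \<rho>r: "\<rho> \<le> r" "0 \<le> \<rho>" using r by (auto simp: \<rho>_def o'_def)
  \<comment> \<open>The comparison bound at radius \<rho> equals
    \<open>(s - a)\<^sup>2 + (\<rho>\<^sup>2 - a\<^sup>2) * (1 - s / T)\<close>, and the correction
    is at most \<open>r\<^sup>2\<close>. If \<open>x\<close> is the origin, there is no comparison
    triangle and \<open>a\<close> is 0.\<close>
  have key: "(dist (c s) x)\<^sup>2 \<le> (s - a)\<^sup>2 + r\<^sup>2"
  proof (cases "\<rho> = 0")
    case True
    then have "x = o'" "a = 0" using al by (auto simp: \<rho>_def)
    then show ?thesis using c[of 0 s] s T by (simp add: o'_def dist_commute)
  next
    case False
    then have \<rho>0: "\<rho> > 0" by (simp add: \<rho>_def)
    have "\<exists>c. geodesic_between c o' x" using C unfolding CAT0_def by blast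
    then obtain c' where c': "geodesic_between c' o' x" by blast
    have cc: "geodesic_between c o' (c T)"
      using c oT T by (auto simp: geodesic_between_def o'_def)
    have c'x: "c' \<rho> = x" using c' by (simp add: geodesic_between_def \<rho>_def)
    have D: "dist (c T) x = T - a" by (simp add: a_def dist_commute)
    have "(dist (c s) (c' \<rho>))\<^sup>2 \<le> (s - \<rho>)\<^sup>2 + (s * \<rho> / (T * \<rho>)) * ((T - a)\<^sup>2 - (T - \<rho>)\<^sup>2)"
      using CAT0_dist_geodesics_le[OF C cc c', of s \<rho>] s T \<rho>0 oT D unfolding \<rho>_def[symmetric] by auto
    also have "\<dots> = (s - a)\<^sup>2 + (\<rho>\<^sup>2 - a\<^sup>2) * (1 - s / T)"
      using T \<rho>0 by (simp add: field_simps power2_eq_square)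
    also have "\<dots> \<le> (s - a)\<^sup>2 + r\<^sup>2 * 1"
    proof (intro add_left_mono mult_mono)
      show "\<rho>\<^sup>2 - a\<^sup>2 \<le> r\<^sup>2" using \<rho>r by (smt (verit) power_mono zero_le_power2)
    qed (use s T in auto)
    finally show ?thesis by (simp add: c'x)
  qed
  have sa: "s - a > 0" "s - a \<ge> s - r" using al \<rho>r s by auto
  \<comment> \<open>This is the estimate sqrt (u^2 + r^2) \<le> u + r^2 / (2 u) with
    \<open>u = s - a\<close>.\<close>
  have "(dist (c s) x)\<^sup>2 \<le> ((s - a) + r\<^sup>2 / (2 * (s - a)))\<^sup>2"
    using key sa by (simp add: power2_sum) (smt (verit) zero_le_power2)
  then have "dist (c s) x \<le> (s - a) + r\<^sup>2 / (2 * (s - a))"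
    by (rule power2_le_imp_le) (use sa in auto)
  also have "r\<^sup>2 / (2 * (s - a)) \<le> r\<^sup>2 / (2 * (s - r))"
    using sa s by (intro divide_left_mono) auto
  finally show "T - dist x (c T) \<le> s - dist x (c s) + r\<^sup>2 / (2 * (s - r))"
    by (simp add: a_def dist_commute)
qed

section \<open>Busemann functions and the compact space of rays\<close>

lemma busemann_tendsto:
  assumes "geodesic_ray \<gamma>"
  shows "((\<lambda>t. t - dist x (\<gamma> t)) \<longlongrightarrow> busemann \<gamma> x) at_top"
    and "t \<ge> 0 \<Longrightarrow> t - dist x (\<gamma> t) \<le> busemann \<gamma> x"
proof -
  define f where "f t = t - dist x (\<gamma> t)" for t
  have mono: "f s \<le> f t" if "0 \<le> s" "s \<le> t" for s t
    using dist_triangle[of x "\<gamma> t" "\<gamma> s"] assms that by (auto simp: f_def geodesic_ray_def)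
  have bd: "f t \<le> dist x (\<gamma> 0)" if "0 \<le> t" for t
    using dist_triangle[of "\<gamma> 0" "\<gamma> t" x] assms that by (auto simp: f_def geodesic_ray_def dist_commute)
  \<comment> \<open>By the triangle inequality \<open>f\<close> is increasing and bounded by the
    distance from \<open>x\<close> to \<gamma> 0, so the limit in the definition of
    \<open>busemann\<close> exists and is the supremum.\<close>
  define L where "L = (SUP t\<in>{0..}. f t)"
  have bdd: "bdd_above (f ` {0..})" using bd by (auto intro!: bdd_aboveI2[of _ _ "dist x (\<gamma> 0)"])
  have up: "f t \<le> L" if "0 \<le> t" for t using bdd that by (auto simp: L_def intro!: cSUP_upper)
  have lim: "(f \<longlongrightarrow> L) at_top"
  proof (rule increasing_tendsto)
    show "\<forall>\<^sub>F t in at_top. f t \<le> L" using eventually_ge_at_top[of 0] by eventually_elim (rule up)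
    fix l assume "l < L"
    then obtain t where t: "t \<ge> 0" "l < f t" using less_cSUP_iff[OF _ bdd] by (auto simp: L_def)
    show "\<forall>\<^sub>F t in at_top. l < f t"
      using eventually_ge_at_top[of t] by eventually_elim (use mono t in fastforce)
  qed
  then have "busemann \<gamma> x = L"
    unfolding busemann_def f_def[symmetric] by (intro tendsto_Lim) auto
  then show "((\<lambda>t. t - dist x (\<gamma> t)) \<longlongrightarrow> busemann \<gamma> x) at_top"
    and "t \<ge> 0 \<Longrightarrow> t - dist x (\<gamma> t) \<le> busemann \<gamma> x"
    using lim up unfolding f_def by auto
qed

lemma busemann_lipschitz:
  assumes "geodesic_ray \<gamma>"
  shows "\<bar>busemann \<gamma> x - busemann \<gamma> y\<bar> \<le> dist x y"
proof (rule tendsto_upperbound[OF tendsto_rabs[OF tendsto_diff[OF busemann_tendsto(1)[OF assms] busemann_tendsto(1)[OF assms]]]])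
  show "\<forall>\<^sub>F t in at_top. \<bar>t - dist x (\<gamma> t) - (t - dist y (\<gamma> t))\<bar> \<le> dist x y"
    by (intro always_eventually) (smt (verit) dist_commute dist_triangle)
qed auto

lemma busemann_asymptotic:
  assumes "(\<gamma>, \<gamma>') \<in> asymptotic"
  obtains K where "\<And>x. \<bar>busemann \<gamma> x - busemann \<gamma>' x\<bar> \<le> K"
proof -
  obtain K where r: "geodesic_ray \<gamma>" "geodesic_ray \<gamma>'" and K: "\<And>t. t \<ge> 0 \<Longrightarrow> dist (\<gamma> t) (\<gamma>' t) \<le> K"
    using assms by (auto simp: asymptotic_def)
  have "\<bar>busemann \<gamma> x - busemann \<gamma>' x\<bar> \<le> K" for x
  proof (rule tendsto_upperbound[OF tendsto_rabs[OF tendsto_diff[OF busemann_tendsto(1)[OF r(1)] busemann_tendsto(1)[OF r(2)]]]])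
    show "\<forall>\<^sub>F t in at_top. \<bar>t - dist x (\<gamma> t) - (t - dist x (\<gamma>' t))\<bar> \<le> K"
      using eventually_ge_at_top[of 0]
    proof eventually_elim
      case (elim t)
      then show ?case using K[of t] abs_dist_diff_le[of "\<gamma> t" x "\<gamma>' t"] by (auto simp: dist_commute)
    qed
  qed auto
  then show ?thesis using that by blast
qed

lemma closed_paths_from:
  fixes p :: "'m::metric_space"
  shows "closed {c :: real \<Rightarrow> 'm. (\<forall>t. dist p (c t) \<le> \<bar>t\<bar>) \<and>
    (\<forall>s\<ge>0. \<forall>t\<ge>0. s \<le> R \<longrightarrow> t \<le> R \<longrightarrow> dist (c s) (c t) = \<bar>s - t\<bar>)}" (is "closed ?S")
proof -
  have "?S = (\<Inter>t. {c. dist p (c t) \<le> \<bar>t\<bar>}) \<inter>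
      (\<Inter>s\<in>{0..R}. \<Inter>t\<in>{0..R}. {c. dist (c s) (c t) = \<bar>s - t\<bar>})"
    by auto
  moreover have "closed {c :: real \<Rightarrow> 'm. dist (c s) (c t) = \<bar>s - t\<bar>}" for s t :: real
    by (intro closed_Collect_eq continuous_intros continuous_on_product_coordinates)
  moreover have "closed {c :: real \<Rightarrow> 'm. dist p (c t) \<le> \<bar>t\<bar>}" for t :: real
    by (intro closed_Collect_le continuous_intros continuous_on_product_coordinates)
  ultimately show ?thesis by (simp add: closed_Int closed_INT)
qed

text \<open>Tychonoff. The bound by \<bar>t\<bar> is imposed at all real times, also outside the
  isometric part, so that the set lies in a product of compact balls. Pointwise convergence is
  strong enough, since the neighbourhoods used later look at one time only.\<close>

lemma compact_paths_from:
  fixes p :: "'m::metric_space"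
  assumes "proper_space TYPE('m)"
  shows "compact {c :: real \<Rightarrow> 'm. (\<forall>t. dist p (c t) \<le> \<bar>t\<bar>) \<and>
    (\<forall>s\<ge>0. \<forall>t\<ge>0. s \<le> R \<longrightarrow> t \<le> R \<longrightarrow> dist (c s) (c t) = \<bar>s - t\<bar>)}" (is "compact ?S")
proof -
  have eq: "?S = Pi\<^sub>E UNIV (\<lambda>t. cball p \<bar>t\<bar>) \<inter> ?S"
    by (auto simp: PiE_iff)
  have cP: "compact (Pi\<^sub>E UNIV (\<lambda>t::real. cball p \<bar>t\<bar>))"
    using assms
    by (simp add: compactin_PiE proper_space_def flip: compactin_euclidean_iff euclidean_product_topology)
  show ?thesis by (subst eq) (rule compact_Int_closed[OF cP closed_paths_from])
qed

lemma busemann_ray_approx: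
  fixes x :: "'m::metric_space"
  assumes C: "CAT0 TYPE('m)" and e: "geodesic_ray e"
    and r: "dist (e 0) x \<le> r" and s: "r < s"
  shows "s - dist x (e s) \<le> busemann e x"
    and "busemann e x \<le> s - dist x (e s) + r\<^sup>2 / (2 * (s - r))"
proof -
  have r0: "0 \<le> r" using r zero_le_dist[of "e 0" x] by linarith
  show "s - dist x (e s) \<le> busemann e x" using busemann_tendsto(2)[OF e] r0 s by auto
  show "busemann e x \<le> s - dist x (e s) + r\<^sup>2 / (2 * (s - r))"
  proof (rule tendsto_upperbound[OF busemann_tendsto(1)[OF e]])
    show "\<forall>\<^sub>F t in at_top. t - dist x (e t) \<le> s - dist x (e s) + r\<^sup>2 / (2 * (s - r))"
      using eventually_ge_at_top[of s]
      by eventually_elim (rule CAT0_geodesic_defect(2)[where c = e, OF C _ r s], use e in \<open>auto simp: geodesic_ray_def\<close>)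
  qed auto
qed

text \<open>Directions towards far away points accumulate only at rays, uniformly in the direction.\<close>

lemma far_points_busemann:
  fixes p :: "'m::metric_space" and W :: "(real \<Rightarrow> 'm) \<Rightarrow> 'm set"
  assumes C: "CAT0 TYPE('m)" and P: "proper_space TYPE('m)"
    and fin: "\<And>e. geodesic_ray e \<Longrightarrow> e 0 = p \<Longrightarrow> finite (W e)"
  obtains E \<rho> where "finite E" "\<forall>e\<in>E. geodesic_ray e \<and> e 0 = p"
    "\<forall>q. dist q p \<ge> \<rho> \<longrightarrow> (\<exists>e\<in>E. \<forall>x\<in>W e. \<bar>dist q p - dist q x - busemann e x\<bar> < 1)"
proof -
  define K where "K R = {c :: real \<Rightarrow> 'm. (\<forall>t. dist p (c t) \<le> \<bar>t\<bar>) \<and>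
    (\<forall>s\<ge>0. \<forall>t\<ge>0. s \<le> R \<longrightarrow> t \<le> R \<longrightarrow> dist (c s) (c t) = \<bar>s - t\<bar>)}" for R :: real
  have cK: "compact (K R)" for R unfolding K_def by (rule compact_paths_from[OF P])
  have Kmono: "K R' \<subseteq> K R" if "R \<le> R'" for R R' using that unfolding K_def by force
  \<comment> \<open>A path that is isometric on every \<open>[0, n]\<close> is a ray, and the bound
    at time 0 makes it start at \<open>p\<close>. As a decreasing intersection of compact sets,
    \<open>Ray\<close> is compact and approximated by the \<open>K n\<close>.\<close>
  define Ray where "Ray = (\<Inter>n::nat. K (real n))"
  have ray: "geodesic_ray e" "e 0 = p" if "e \<in> Ray" for e
  proof -
    have "dist (e s) (e t) = \<bar>s - t\<bar>" if st: "0 \<le> s" "0 \<le> t" for s t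
    proof -
      obtain n :: nat where "max s t \<le> real n" using real_arch_simple by blast
      moreover have "e \<in> K (real n)" using \<open>e \<in> Ray\<close> by (auto simp: Ray_def)
      ultimately show ?thesis using st by (auto simp: K_def)
    qed
    then show "geodesic_ray e" by (simp add: geodesic_ray_def)
    have "e \<in> K (real 0)" using \<open>e \<in> Ray\<close> unfolding Ray_def by blast
    then have "dist p (e 0) \<le> \<bar>0\<bar>" unfolding K_def by blast
    then show "e 0 = p" by simp
  qed
  have cRay: "compact Ray"
  proof -
    have "Ray \<subseteq> K (real 0)" unfolding Ray_def by blast
    then have "Ray = K 0 \<inter> Ray" by auto
    moreover have "closed Ray" unfolding Ray_def by (intro closed_INT ballI) (auto simp only: K_def closed_paths_from)
    ultimately show ?thesis using compact_Int_closed[OF cK[of 0]] by metis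
  qed
  have "\<exists>r>0. \<forall>x\<in>W e. dist p x \<le> r" if "e \<in> Ray" for e
  proof -
    have f: "finite ((\<lambda>x. dist p x) ` W e)" using fin ray[OF that] by auto
    have "dist p x \<le> Max (insert 1 ((\<lambda>x. dist p x) ` W e))" if "x \<in> W e" for x
      using f that by (intro Max_ge) auto
    moreover have "Max (insert 1 ((\<lambda>x. dist p x) ` W e)) > 0" using f by (subst Max_gr_iff) auto
    ultimately show ?thesis by blast
  qed
  then obtain r where r: "\<And>e. e \<in> Ray \<Longrightarrow> r e > 0" "\<And>e x. e \<in> Ray \<Longrightarrow> x \<in> W e \<Longrightarrow> dist p x \<le> r e"
    by metis
  \<comment> \<open>The time is chosen to make the error in \<open>CAT0_geodesic_defect\<close>
    equal to 1/4.\<close>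
  define s where "s e = r e + 2 * (r e)\<^sup>2" for e
  have s: "r e < s e" "(r e)\<^sup>2 / (2 * (s e - r e)) = 1/4" if "e \<in> Ray" for e
    using r(1)[OF that] by (auto simp: s_def)
  define U where "U e = {c :: real \<Rightarrow> 'm. dist (c (s e)) (e (s e)) < 1/4}" for e
  have oU: "open (U e)" for e unfolding U_def
    by (intro open_Collect_less continuous_intros continuous_on_product_coordinates)
  obtain E where E: "E \<subseteq> Ray" "finite E" "Ray \<subseteq> (\<Union>e\<in>E. U e)"
    using compactE_image[OF cRay, of Ray U] oU by (force simp: U_def)
  \<comment> \<open>The \<open>K n\<close> shrink to \<open>Ray\<close>, which the open sets
    \<open>U e\<close> cover, so some \<open>K n\<close> is covered already. The argument takes a
    finite subcover of \<open>K 0\<close> by the union of the \<open>U e\<close>, indexed by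
    \<open>None\<close>, and the complements of the \<open>K n\<close>.\<close>
  have "\<exists>N. K (real N) \<subseteq> (\<Union>e\<in>E. U e)"
  proof -
    define V where "V i = (case i of None \<Rightarrow> (\<Union>e\<in>E. U e) | Some n \<Rightarrow> - K (real n))" for i
    have clK: "closed (K R)" for R unfolding K_def by (rule closed_paths_from)
    have "open (V i)" for i using oU clK by (auto simp: V_def split: option.split)
    moreover have "K 0 \<subseteq> (\<Union>i\<in>UNIV. V i)"
    proof
      fix c assume "c \<in> K 0"
      show "c \<in> (\<Union>i\<in>UNIV. V i)"
      proof (cases "c \<in> Ray")
        case True
        then have "c \<in> V None" using E(3) by (auto simp: V_def)
        then show ?thesis by blast
      next
        case False
        then obtain n where "c \<in> V (Some n)" by (auto simp: Ray_def V_def)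
        then show ?thesis by blast
      qed
    qed
    ultimately obtain I where I: "finite I" "K 0 \<subseteq> (\<Union>i\<in>I. V i)"
      using compactE_image[OF cK[of 0], of UNIV V] by metis
    define N where "N = Max (insert 0 (the ` I))"
    have "c \<in> (\<Union>e\<in>E. U e)" if c: "c \<in> K (real N)" for c
    proof -
      obtain i where i: "i \<in> I" "c \<in> V i" using I(2) Kmono[of 0 "real N"] c by auto
      show ?thesis
      proof (cases i)
        case None
        then show ?thesis using i by (simp add: V_def)
      next
        case (Some n)
        then have "n \<le> N" using I(1) i(1) unfolding N_def by (intro Max_ge) force+
        then have "c \<in> K (real n)" using c Kmono[of "real n" "real N"] by auto
        then show ?thesis using i Some by (simp add: V_def)
      qed
    qed
    then show ?thesis by blast
  qed
  then obtain N where N: "K (real N) \<subseteq> (\<Union>e\<in>E. U e)" by blast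
  define \<rho> where "\<rho> = Max (insert (real N) (s ` E))"
  have \<rho>: "real N \<le> \<rho>" "\<And>e. e \<in> E \<Longrightarrow> s e \<le> \<rho>" using E(2) by (auto simp: \<rho>_def)
  show thesis
  proof (rule that[OF E(2)], use E(1) ray in blast, intro allI impI)
    fix q assume q: "dist q p \<ge> \<rho>"
    have "\<exists>c. geodesic_between c p q" using C unfolding CAT0_def by blast
    then obtain c where c: "c 0 = p" "c (dist p q) = q"
      "\<And>s t. \<lbrakk>0 \<le> s; s \<le> dist p q; 0 \<le> t; t \<le> dist p q\<rbrakk> \<Longrightarrow> dist (c s) (c t) = \<bar>s - t\<bar>"
      unfolding geodesic_between_def by auto
    \<comment> \<open>The segment is continued by its end points, which makes it an element of the
      compact space of paths.\<close>
    define c' where "c' t = c (max 0 (min t (dist p q)))" for t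
    have "c' \<in> K (real N)"
    proof -
      have "dist p (c' t) \<le> \<bar>t\<bar>" for t
        using c(3)[of 0 "max 0 (min t (dist p q))"] unfolding c'_def c(1) by auto
      moreover have "dist (c' s) (c' t) = \<bar>s - t\<bar>" if "0 \<le> s" "0 \<le> t" "s \<le> real N" "t \<le> real N" for s t
        using that q \<rho>(1) c(3)[of s t] by (auto simp: c'_def dist_commute)
      ultimately show ?thesis unfolding K_def by blast
    qed
    then obtain e where e: "e \<in> E" "c' \<in> U e" using N by blast
    then have eR: "e \<in> Ray" using E by blast
    have se: "0 < s e" "s e \<le> dist p q" using s(1)[OF eR] r(1)[OF eR] \<rho>(2)[OF e(1)] q by (auto simp: dist_commute)
    then have ce: "dist (c (s e)) (e (s e)) < 1/4" using e(2) by (auto simp: U_def c'_def)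
    show "\<exists>e\<in>E. \<forall>x\<in>W e. \<bar>dist q p - dist q x - busemann e x\<bar> < 1"
    proof (intro bexI[OF _ e(1)] ballI)
      fix x assume x: "x \<in> W e"
      have d: "dist (c 0) x \<le> r e" "dist (e 0) x \<le> r e" using r(2)[OF eR x] c(1) ray(2)[OF eR] by auto
      \<comment> \<open>At time \<open>s e\<close> the cut-off values fall short of
        \<open>dist q p - dist q x\<close> and of \<open>busemann e x\<close> by at most 1/4 each,
        and the two positions at that time differ by less than 1/4; the total stays below 1.\<close>
      note 1 = CAT0_geodesic_defect[of "dist p q" c, OF C c(3) d(1) s(1)[OF eR] se(2)]
      note 2 = busemann_ray_approx[OF C ray(1)[OF eR] d(2) s(1)[OF eR]]
      have "\<bar>dist x (c (s e)) - dist x (e (s e))\<bar> < 1/4"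
        using abs_dist_diff_le[of "c (s e)" x "e (s e)"] ce by (auto simp: dist_commute)
      then show "\<bar>dist q p - dist q x - busemann e x\<bar> < 1"
        using 1 2 unfolding s(2)[OF eR] c(2) by (auto simp: dist_commute abs_if split: if_splits)
    qed
  qed
qed

section \<open>Equivariant maps between complexes of free G-sets\<close>

abbreviation keys :: "('a \<Rightarrow>\<^sub>0 'b::zero) \<Rightarrow> 'a set" where
  "keys \<equiv> Poly_Mapping.keys"

section \<open>Finitely supported integer chains and their translates\<close>

definition chains :: "(nat \<Rightarrow> 'y set) \<Rightarrow> nat \<Rightarrow> ('y \<Rightarrow>\<^sub>0 int) set" where
  "chains Y k = {c. keys c \<subseteq> Y k}"

definition translate :: "('g \<Rightarrow> 'y \<Rightarrow> 'y) \<Rightarrow> 'g \<Rightarrow> ('y \<Rightarrow>\<^sub>0 int) \<Rightarrow> ('y \<Rightarrow>\<^sub>0 int)" where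
  "translate act g c = frag_extend (\<lambda>y. frag_of (act g y)) c"

lemma chains_frag_of [simp]: "frag_of y \<in> chains Y k \<longleftrightarrow> y \<in> Y k"
  by (simp add: chains_def)

lemma chains_0 [simp]: "0 \<in> chains Y k"
  by (simp add: chains_def)

lemma chains_add [intro]: "\<lbrakk>a \<in> chains Y k; b \<in> chains Y k\<rbrakk> \<Longrightarrow> a + b \<in> chains Y k"
  using Poly_Mapping.keys_add[of a b] by (auto simp: chains_def)

lemma chains_diff [intro]: "\<lbrakk>a \<in> chains Y k; b \<in> chains Y k\<rbrakk> \<Longrightarrow> a - b \<in> chains Y k"
  using Poly_Mapping.keys_diff[of a b] by (auto simp: chains_def)

lemma chains_uminus [intro]: "a \<in> chains Y k \<Longrightarrow> - a \<in> chains Y k"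
  by (simp add: chains_def)

lemma chains_frag_extend:
  assumes "c \<in> chains Y k" "\<And>y. y \<in> Y k \<Longrightarrow> u y \<in> chains Z j"
  shows "frag_extend u c \<in> chains Z j"
  using assms keys_frag_extend[of u c] by (fastforce simp: chains_def)

lemma keys_frag_extend_D:
  assumes "z \<in> keys (frag_extend u c)"
  obtains y where "y \<in> keys c" "z \<in> keys (u y)"
  using assms keys_frag_extend[of u c] by auto

lemma frag_extend_fn_add: "frag_extend (\<lambda>y. u y + v y) c = frag_extend u c + frag_extend v c"
  by (simp add: frag_extend_def frag_cmul_distrib2 sum.distrib)

lemma frag_extend_fn_diff: "frag_extend (\<lambda>y. u y - v y) c = frag_extend u c - frag_extend v c"
proof -
  have "frag_extend (\<lambda>y. u y - v y) c + frag_extend v c = frag_extend u c"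
    by (simp flip: frag_extend_fn_add)
  then show ?thesis by (simp add: eq_diff_eq)
qed

lemma frag_extend_fn_frag_of [simp]: "frag_extend frag_of c = c"
  using frag_expansion[of c] by simp

lemma frag_extend_frag_extend:
  "frag_extend u (frag_extend v c) = frag_extend (\<lambda>y. frag_extend u (v y)) c"
  using subset_UNIV by (induction c rule: frag_induction) (auto simp: frag_extend_diff)

lemma frag_extend_eq_on_chains:
  "\<lbrakk>c \<in> chains Y k; \<And>y. y \<in> Y k \<Longrightarrow> u y = v y\<rbrakk> \<Longrightarrow> frag_extend u c = frag_extend v c"
  by (rule frag_extend_eq) (auto simp: chains_def)

lemma translate_simps [simp]:
  "translate act g 0 = 0"
  "translate act g (a + b) = translate act g a + translate act g b"
  "translate act g (a - b) = translate act g a - translate act g b"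
  "translate act g (- a) = - translate act g a"
  "translate act g (frag_of y) = frag_of (act g y)"
  by (simp_all add: translate_def frag_extend_add frag_extend_diff frag_extend_minus)

lemma keys_translate: "keys (translate act g c) \<subseteq> act g ` keys c"
  using keys_frag_extend[of "\<lambda>y. frag_of (act g y)" c] by (auto simp: translate_def)

lemma frag_extend_translate:
  assumes "c \<in> chains Y k" "\<And>y. y \<in> Y k \<Longrightarrow> u (act g y) = translate act' g (u y)"
  shows "frag_extend u (translate act g c) = translate act' g (frag_extend u c)"
proof -
  have "frag_extend u (translate act g c) = frag_extend (\<lambda>y. u (act g y)) c"
    by (simp add: translate_def frag_extend_frag_extend)
  also have "\<dots> = frag_extend (\<lambda>y. translate act' g (u y)) c"
    by (rule frag_extend_eq_on_chains[OF assms(1)]) (rule assms(2))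
  also have "\<dots> = translate act' g (frag_extend u c)"
    by (simp add: translate_def frag_extend_frag_extend)
  finally show ?thesis .
qed

text \<open>A choice on orbit representatives extends equivariantly because the action is free.\<close>

lemma (in group) equivariant_choice:
  fixes a :: "'a \<Rightarrow> 's \<Rightarrow> 's" and b :: "'a \<Rightarrow> 'z \<Rightarrow> 'z"
  assumes a_closed: "\<And>g s. \<lbrakk>g \<in> carrier G; s \<in> S\<rbrakk> \<Longrightarrow> a g s \<in> S"
    and a_one: "\<And>s. s \<in> S \<Longrightarrow> a \<one> s = s"
    and a_mult: "\<And>g h s. \<lbrakk>g \<in> carrier G; h \<in> carrier G; s \<in> S\<rbrakk> \<Longrightarrow> a (g \<otimes> h) s = a g (a h s)"
    and a_free: "\<And>g s. \<lbrakk>g \<in> carrier G; s \<in> S; a g s = s\<rbrakk> \<Longrightarrow> g = \<one>"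
    and b_one: "\<And>s z. \<lbrakk>s \<in> S; Q s z\<rbrakk> \<Longrightarrow> b \<one> z = z"
    and b_mult: "\<And>g h s z. \<lbrakk>g \<in> carrier G; h \<in> carrier G; s \<in> S; Q s z\<rbrakk> \<Longrightarrow> b (g \<otimes> h) z = b g (b h z)"
    and ex: "\<And>s. s \<in> S \<Longrightarrow> \<exists>z. Q s z"
    and inv: "\<And>g s z. \<lbrakk>g \<in> carrier G; s \<in> S; Q s z\<rbrakk> \<Longrightarrow> Q (a g s) (b g z)"
  obtains u where "\<And>s. s \<in> S \<Longrightarrow> Q s (u s)"
    "\<And>g s. \<lbrakk>g \<in> carrier G; s \<in> S\<rbrakk> \<Longrightarrow> u (a g s) = b g (u s)"
proof -
  define O' where "O' s = {a g s | g. g \<in> carrier G}" for s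
  \<comment> \<open>The representative depends on the orbit as a set only, so all points of an orbit
    share it.\<close>
  define r where "r s = (SOME t. t \<in> O' s)" for s
  have r: "r s \<in> O' s" if "s \<in> S" for s
    unfolding r_def by (rule someI[of _ "a \<one> s"]) (auto simp: O'_def)
  have O'a: "O' (a g s) = O' s" if g: "g \<in> carrier G" and s: "s \<in> S" for g s
  proof (intro equalityI subsetI)
    fix t assume "t \<in> O' (a g s)"
    then obtain h where "h \<in> carrier G" "t = a h (a g s)" by (auto simp: O'_def)
    then have "t = a (h \<otimes> g) s" "h \<otimes> g \<in> carrier G" using g s by (auto simp: a_mult)
    then show "t \<in> O' s" by (auto simp: O'_def)
  next
    fix t assume "t \<in> O' s"
    then obtain h where h: "h \<in> carrier G" "t = a h s" by (auto simp: O'_def)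
    have "a (h \<otimes> inv g) (a g s) = a (h \<otimes> inv g \<otimes> g) s"
      using g s h by (intro a_mult[symmetric]) auto
    also have "\<dots> = t" using g s h by (simp add: m_assoc)
    finally show "t \<in> O' (a g s)" using g h by (auto simp: O'_def intro!: exI[of _ "h \<otimes> inv g"])
  qed
  have ra: "r (a g s) = r s" if "g \<in> carrier G" "s \<in> S" for g s
    using O'a[OF that] by (simp add: r_def)
  have rS: "r s \<in> S" if "s \<in> S" for s using r[OF that] that a_closed by (auto simp: O'_def)
  have cancel: "g = h" if "g \<in> carrier G" "h \<in> carrier G" "s \<in> S" "a g s = a h s" for g h s
  proof -
    have "a (inv h \<otimes> g) s = a (inv h \<otimes> h) s" using that by (simp only: a_mult inv_closed)
    then have "inv h \<otimes> g = \<one>" using that a_free[of "inv h \<otimes> g" s] a_one by simp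
    then show ?thesis using that by (metis inv_closed inv_equality inv_inv)
  qed
  have ex_g: "\<exists>g\<in>carrier G. s = a g (r s)" if sS: "s \<in> S" for s
  proof -
    obtain h where h: "h \<in> carrier G" "r s = a h s" using r[OF sS] by (auto simp: O'_def)
    have "a (inv h) (r s) = a (inv h \<otimes> h) s" using h sS by (simp only: a_mult inv_closed)
    then have "s = a (inv h) (r s)" using h sS a_one by simp
    then show ?thesis using h by blast
  qed
  \<comment> \<open>The group element that carries the representative to \<open>s\<close>. Freeness
    makes it unique, so \<eta> is equivariant, and a value chosen at the representative can be
    transported by it.\<close>
  define \<eta> where "\<eta> s = (SOME g. g \<in> carrier G \<and> s = a g (r s))" for s
  have \<eta>: "\<eta> s \<in> carrier G" "a (\<eta> s) (r s) = s" if "s \<in> S" for s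
  proof -
    have "\<eta> s \<in> carrier G \<and> s = a (\<eta> s) (r s)"
      unfolding \<eta>_def by (rule someI_ex) (use ex_g[OF that] in blast)
    then show "\<eta> s \<in> carrier G" "a (\<eta> s) (r s) = s" by metis+
  qed
  have \<eta>a: "\<eta> (a g s) = g \<otimes> \<eta> s" if "g \<in> carrier G" "s \<in> S" for g s
  proof (rule cancel[where s = "r s"])
    show "a (\<eta> (a g s)) (r s) = a (g \<otimes> \<eta> s) (r s)"
      using \<eta>(2)[of "a g s"] \<eta>[of s] that a_closed ra rS by (simp add: a_mult)
  qed (use \<eta> that a_closed rS in auto)
  define w where "w s = (SOME z. Q s z)" for s
  have w: "Q s (w s)" if "s \<in> S" for s using ex[OF that] by (auto simp: w_def intro: someI_ex)
  show thesis
  proof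
    show "Q s (b (\<eta> s) (w (r s)))" if "s \<in> S" for s
      using inv[OF \<eta>(1) rS w[OF rS], OF that that that] \<eta>(2)[OF that] by simp
    show "b (\<eta> (a g s)) (w (r (a g s))) = b g (b (\<eta> s) (w (r s)))" if "g \<in> carrier G" "s \<in> S" for g s
      using that \<eta>(1) by (simp add: \<eta>a ra b_mult[OF _ _ rS w[OF rS]])
  qed
qed

text \<open>Recursion over the degree for functions on a disjoint union. As \<open>Q k\<close>
  depends on the degrees up to \<open>k\<close> only, redefining the function on \<open>Y k\<close>
  does not spoil earlier conditions, and the stages glue: on \<open>Y j\<close> the value of stage
  \<open>Suc j\<close> is final.\<close>

lemma degreewise_construction:
  fixes Y :: "nat \<Rightarrow> 'y set" and Q :: "nat \<Rightarrow> ('y \<Rightarrow> 'z) \<Rightarrow> bool"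
  assumes disj: "\<And>i j y. \<lbrakk>y \<in> Y i; y \<in> Y j\<rbrakk> \<Longrightarrow> i = j"
    and local: "\<And>k u v. \<lbrakk>Q k u; \<And>j y. \<lbrakk>j \<le> k; y \<in> Y j\<rbrakk> \<Longrightarrow> u y = v y\<rbrakk> \<Longrightarrow> Q k v"
    and step: "\<And>k u. (\<And>j. j < k \<Longrightarrow> Q j u) \<Longrightarrow> \<exists>w. Q k (\<lambda>y. if y \<in> Y k then w y else u y)"
  obtains u where "\<And>k. Q k u"
proof -
  have "\<exists>U :: nat \<Rightarrow> 'y \<Rightarrow> 'z. \<forall>k. (\<forall>j<k. Q j (U k)) \<and> (\<forall>j<k. \<forall>y\<in>Y j. U (Suc k) y = U k y)"
  proof (rule dependent_nat_choice)
    fix u :: "'y \<Rightarrow> 'z" and k assume u: "\<forall>j<k. Q j u"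
    then obtain w where w: "Q k (\<lambda>y. if y \<in> Y k then w y else u y)" using step by blast
    let ?v = "\<lambda>y. if y \<in> Y k then w y else u y"
    have v: "?v y = u y" if "y \<in> Y j" "j < k" for y j using disj that by force
    then have "Q j ?v" if "j < k" for j
      by (rule_tac local[of j u]) (use u that in \<open>auto dest: order.strict_trans1\<close>)
    then show "\<exists>v. (\<forall>j<Suc k. Q j v) \<and> (\<forall>j<k. \<forall>y\<in>Y j. v y = u y)"
      using w v by (intro exI[of _ ?v]) (auto simp: less_Suc_eq)
  qed auto
  then obtain U where *: "\<forall>k. (\<forall>j<k. Q j (U k)) \<and> (\<forall>j<k. \<forall>y\<in>Y j. U (Suc k) y = U k y)" ..
  have U: "j < k \<Longrightarrow> Q j (U k)" "\<lbrakk>j < k; y \<in> Y j\<rbrakk> \<Longrightarrow> U (Suc k) y = U k y" for k j y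
    using *[rule_format, of k] by simp_all
  have U': "U m y = U (Suc j) y" if "Suc j \<le> m" "y \<in> Y j" for m j y
    using that(1)
  proof (induction m rule: dec_induct)
    case (step n)
    then show ?case using U(2)[of j n y] that(2) by simp
  qed simp
  define u where "u y = U (Suc (THE k. y \<in> Y k)) y" for y
  have u: "u y = U (Suc j) y" if "y \<in> Y j" for y j
  proof -
    have "(THE k. y \<in> Y k) = j" using that disj by blast
    then show ?thesis by (simp add: u_def)
  qed
  have "Q k u" for k
    by (rule local[OF U(1)[of k "Suc k"]]) (use u U' in auto)
  then show ?thesis using that by blast
qed

text \<open>A free resolution with its augmentation cut off: \<open>Y k\<close> is a free
  \<open>G\<close>-set that serves as \<int>-basis in degree \<open>k\<close>, exactness is required
  in positive degrees, and the resolved module is the cokernel of the boundary into degree 0. The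
  sets \<open>Y k\<close> are disjoint, so one function \<open>bd\<close> serves all degrees, and
  chain maps and homotopies need no index either.\<close>

locale free_complex = group G for G :: "('g, 'z) monoid_scheme" (structure) +
  fixes act :: "'g \<Rightarrow> 'y \<Rightarrow> 'y" and Y :: "nat \<Rightarrow> 'y set" and bd :: "'y \<Rightarrow> 'y \<Rightarrow>\<^sub>0 int"
  assumes act_closed: "\<lbrakk>g \<in> carrier G; y \<in> Y k\<rbrakk> \<Longrightarrow> act g y \<in> Y k"
    and act_one: "y \<in> Y k \<Longrightarrow> act \<one> y = y"
    and act_mult: "\<lbrakk>g \<in> carrier G; h \<in> carrier G; y \<in> Y k\<rbrakk> \<Longrightarrow> act (g \<otimes> h) y = act g (act h y)"
    and act_free: "\<lbrakk>g \<in> carrier G; y \<in> Y k; act g y = y\<rbrakk> \<Longrightarrow> g = \<one>"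
    and degree_unique: "\<lbrakk>y \<in> Y i; y \<in> Y j\<rbrakk> \<Longrightarrow> i = j"
    and bd_closed: "y \<in> Y (Suc k) \<Longrightarrow> bd y \<in> chains Y k"
    and bd_zero: "y \<in> Y 0 \<Longrightarrow> bd y = 0"
    and bd_bd: "y \<in> Y k \<Longrightarrow> frag_extend bd (bd y) = 0"
    and bd_act: "\<lbrakk>g \<in> carrier G; y \<in> Y k\<rbrakk> \<Longrightarrow> bd (act g y) = translate act g (bd y)"
    and exact: "\<lbrakk>c \<in> chains Y (Suc k); frag_extend bd c = 0\<rbrakk> \<Longrightarrow>
      \<exists>e\<in>chains Y (Suc (Suc k)). frag_extend bd e = c"
begin

abbreviation "C \<equiv> chains Y"
abbreviation "d \<equiv> frag_extend bd"

lemma d_closed: "c \<in> C (Suc k) \<Longrightarrow> d c \<in> C k"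
  by (rule chains_frag_extend[where Y = Y and k = "Suc k"]) (auto intro: bd_closed)

lemma d_zero: "c \<in> C 0 \<Longrightarrow> d c = 0"
  by (rule frag_extend_eq_0) (auto intro: bd_zero simp: chains_def)

lemma d_d: "c \<in> C k \<Longrightarrow> d (d c) = 0"
  unfolding frag_extend_frag_extend by (rule frag_extend_eq_0) (auto intro: bd_bd simp: chains_def)

lemma translate_closed: "\<lbrakk>g \<in> carrier G; c \<in> C k\<rbrakk> \<Longrightarrow> translate act g c \<in> C k"
  unfolding translate_def by (erule chains_frag_extend) (simp add: act_closed)

lemma translate_one: "c \<in> C k \<Longrightarrow> translate act \<one> c = c"
proof -
  assume c: "c \<in> C k"
  have "translate act \<one> c = frag_extend frag_of c"
    unfolding translate_def by (rule frag_extend_eq_on_chains[OF c]) (simp add: act_one)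
  then show ?thesis by simp
qed

lemma translate_mult:
  "\<lbrakk>g \<in> carrier G; h \<in> carrier G; c \<in> C k\<rbrakk> \<Longrightarrow> translate act (g \<otimes> h) c = translate act g (translate act h c)"
  unfolding translate_def frag_extend_frag_extend
  by (erule frag_extend_eq_on_chains) (simp add: act_mult)

lemma d_translate: "\<lbrakk>g \<in> carrier G; c \<in> C k\<rbrakk> \<Longrightarrow> d (translate act g c) = translate act g (d c)"
  by (erule frag_extend_translate) (rule bd_act)

text \<open>Preimages under \<open>d\<close> are chosen on orbit representatives and translated. The
  basis elements may come from another complex over \<open>G\<close>, whose free action makes the
  choice consistent.\<close>

lemma equivariant_preimage:
  assumes S: "free_complex G act' Y' bd'"
    and w: "\<And>y. y \<in> Y' k \<Longrightarrow> \<exists>e\<in>C j. d e = w y"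
    and w_act: "\<And>g y. \<lbrakk>g \<in> carrier G; y \<in> Y' k\<rbrakk> \<Longrightarrow> w (act' g y) = translate act g (w y)"
  obtains u where "\<And>y. y \<in> Y' k \<Longrightarrow> u y \<in> C j" "\<And>y. y \<in> Y' k \<Longrightarrow> d (u y) = w y"
    "\<And>g y. \<lbrakk>g \<in> carrier G; y \<in> Y' k\<rbrakk> \<Longrightarrow> u (act' g y) = translate act g (u y)"
proof -
  interpret S: free_complex G act' Y' bd' by fact
  obtain u where "\<And>y. y \<in> Y' k \<Longrightarrow> u y \<in> C j \<and> d (u y) = w y"
    "\<And>g y. \<lbrakk>g \<in> carrier G; y \<in> Y' k\<rbrakk> \<Longrightarrow> u (act' g y) = translate act g (u y)"
    by (rule equivariant_choice[where S = "Y' k" and a = act' and b = "translate act"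
          and Q = "\<lambda>y z. z \<in> C j \<and> d z = w y"])
      (use w in \<open>auto simp: S.act_closed S.act_one S.act_mult S.act_free translate_one translate_mult
         translate_closed d_translate w_act\<close>)
  then show ?thesis using that by blast
qed

lemma equivariant_homotopy:
  assumes r: "\<And>k y. y \<in> Y k \<Longrightarrow> r y \<in> C k"
    and r_act: "\<And>k g y. \<lbrakk>g \<in> carrier G; y \<in> Y k\<rbrakk> \<Longrightarrow> r (act g y) = translate act g (r y)"
    and r_bd: "\<And>k y. y \<in> Y k \<Longrightarrow> d (r y) = frag_extend r (bd y)"
    and r0: "\<And>y. y \<in> Y 0 \<Longrightarrow> \<exists>e\<in>C (Suc 0). d e = r y - frag_of y"
  obtains s where "\<And>k y. y \<in> Y k \<Longrightarrow> s y \<in> C (Suc k)"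
    "\<And>k g y. \<lbrakk>g \<in> carrier G; y \<in> Y k\<rbrakk> \<Longrightarrow> s (act g y) = translate act g (s y)"
    "\<And>k y. y \<in> Y k \<Longrightarrow> d (s y) = r y - frag_of y - frag_extend s (bd y)"
proof -
  define Q where "Q k s \<longleftrightarrow> (\<forall>y\<in>Y k. s y \<in> C (Suc k) \<and> (\<forall>g\<in>carrier G. s (act g y) = translate act g (s y)) \<and>
    d (s y) = r y - frag_of y - frag_extend s (bd y))" for k s
  have bdY: "bd y \<in> C (k - 1)" if "y \<in> Y k" for y k
    using that bd_closed bd_zero by (cases k) auto
  have "\<exists>s. \<forall>k. Q k s"
  proof (rule degreewise_construction[where Y = Y and Q = Q])
    show "i = j" if "y \<in> Y i" "y \<in> Y j" for i j y using degree_unique that .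
    show "Q k v" if Q: "Q k u" and eq: "\<And>j y. \<lbrakk>j \<le> k; y \<in> Y j\<rbrakk> \<Longrightarrow> u y = v y" for k u v
    proof -
      have "frag_extend u (bd y) = frag_extend v (bd y)" if "y \<in> Y k" for y
        by (rule frag_extend_eq_on_chains[OF bdY[OF that]]) (rule eq, auto)
      then show ?thesis using Q eq[of k] act_closed unfolding Q_def by auto
    qed
    fix k u assume IH: "\<And>j. j < k \<Longrightarrow> Q j u"
    define w where "w y = r y - frag_of y - frag_extend u (bd y)" for y
    have bd0: "bd y = 0 \<or> (\<exists>j. k = Suc j \<and> bd y \<in> C j)" if "y \<in> Y k" for y
      using that bd_closed bd_zero by (cases k) auto
    have ubd: "frag_extend u (bd (act g y)) = translate act g (frag_extend u (bd y))"
      if "g \<in> carrier G" "y \<in> Y k" for g y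
    proof (cases k)
      case 0
      then show ?thesis using that act_closed[of g y 0] by (simp add: bd_zero)
    next
      case (Suc j)
      then have "bd y \<in> C j" using that bd_closed by blast
      moreover have "u (act g y') = translate act g (u y')" if "y' \<in> Y j" for y'
        using IH[of j] Suc that \<open>g \<in> carrier G\<close> by (auto simp: Q_def)
      ultimately have "frag_extend u (translate act g (bd y)) = translate act g (frag_extend u (bd y))"
        by (rule frag_extend_translate)
      then show ?thesis using that by (simp add: bd_act)
    qed
    have w: "\<exists>e\<in>C (Suc k). d e = w y" if y: "y \<in> Y k" for y
    proof (cases k)
      case 0
      then show ?thesis using r0 y by (simp add: w_def bd_zero)
    next
      case (Suc j)
      have by1: "bd y \<in> C j" using y Suc bd_closed by blast
      have uu: "u y' \<in> C (Suc j)" "d (u y') = r y' - frag_of y' - frag_extend u (bd y')" if "y' \<in> Y j" for y'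
        using IH[of j] Suc that by (auto simp: Q_def)
      have "frag_extend u (bd y) \<in> C k" unfolding Suc
        by (rule chains_frag_extend[OF by1]) (rule uu)
      then have wC: "w y \<in> C (Suc j)" using y Suc by (auto simp: w_def intro!: chains_diff r)
      have "d (frag_extend u (bd y)) = frag_extend (\<lambda>y'. r y' - frag_of y' - frag_extend u (bd y')) (bd y)"
        unfolding frag_extend_frag_extend by (rule frag_extend_eq_on_chains[OF by1]) (rule uu)
      also have "\<dots> = frag_extend r (bd y) - bd y - frag_extend u (d (bd y))"
        by (simp add: frag_extend_fn_diff frag_extend_frag_extend)
      also have "d (bd y) = 0" using bd_bd y by blast
      finally have "d (w y) = 0" using y by (simp add: w_def frag_extend_diff r_bd)
      then show ?thesis using exact[OF wC] Suc by auto
    qed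
    obtain v where v: "\<And>y. y \<in> Y k \<Longrightarrow> v y \<in> C (Suc k)" "\<And>y. y \<in> Y k \<Longrightarrow> d (v y) = w y"
      "\<And>g y. \<lbrakk>g \<in> carrier G; y \<in> Y k\<rbrakk> \<Longrightarrow> v (act g y) = translate act g (v y)"
      by (rule equivariant_preimage[where k = k, OF free_complex_axioms w])
        (auto simp: w_def r_act ubd)
    have "frag_extend (\<lambda>y. if y \<in> Y k then v y else u y) (bd y) = frag_extend u (bd y)" if "y \<in> Y k" for y
      using bd0[OF that]
    proof
      assume "\<exists>j. k = Suc j \<and> bd y \<in> C j"
      then obtain j where j: "k = Suc j" "bd y \<in> C j" by blast
      show ?thesis by (rule frag_extend_eq_on_chains[OF j(2)]) (use degree_unique[of _ j k] j(1) in auto)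
    qed simp
    then show "\<exists>w. Q k (\<lambda>y. if y \<in> Y k then w y else u y)"
      using v act_closed by (intro exI[of _ v]) (auto simp: Q_def w_def)
  qed blast
  then obtain s where "\<forall>k. Q k s" ..
  then show ?thesis using that[of s] unfolding Q_def by blast
qed

end

section \<open>Finiteness modulo the group and bounded chains\<close>

definition orbit_finite :: "('g, 'z) monoid_scheme \<Rightarrow> ('g \<Rightarrow> 'y \<Rightarrow> 'y) \<Rightarrow> 'y set \<Rightarrow> bool" where
  "orbit_finite G act S \<longleftrightarrow>
    (\<exists>X. finite X \<and> X \<subseteq> S \<and> (\<forall>y\<in>S. \<exists>g\<in>carrier G. \<exists>x\<in>X. y = act g x))"

definition bounded_by :: "('y \<Rightarrow> real) \<Rightarrow> real \<Rightarrow> ('y \<Rightarrow>\<^sub>0 int) \<Rightarrow> bool" where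
  "bounded_by \<nu> R c \<longleftrightarrow> (\<forall>y\<in>keys c. \<nu> y \<le> R)"

lemma bounded_by_0 [simp]: "bounded_by \<nu> R 0"
  by (simp add: bounded_by_def)

lemma bounded_by_frag_of [simp]: "bounded_by \<nu> R (frag_of y) \<longleftrightarrow> \<nu> y \<le> R"
  by (simp add: bounded_by_def)

lemma bounded_by_add: "\<lbrakk>bounded_by \<nu> R a; bounded_by \<nu> R b\<rbrakk> \<Longrightarrow> bounded_by \<nu> R (a + b)"
  using Poly_Mapping.keys_add[of a b] by (auto simp: bounded_by_def)

lemma bounded_by_diff: "\<lbrakk>bounded_by \<nu> R a; bounded_by \<nu> R b\<rbrakk> \<Longrightarrow> bounded_by \<nu> R (a - b)"
  using Poly_Mapping.keys_diff[of a b] by (auto simp: bounded_by_def)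

lemma bounded_by_mono: "\<lbrakk>bounded_by \<nu> R a; R \<le> R'\<rbrakk> \<Longrightarrow> bounded_by \<nu> R' a"
  by (force simp: bounded_by_def)

lemma bounded_by_frag_extend:
  "(\<And>y. y \<in> keys c \<Longrightarrow> bounded_by \<nu> R (u y)) \<Longrightarrow> bounded_by \<nu> R (frag_extend u c)"
  using keys_frag_extend[of u c] unfolding bounded_by_def by blast

lemma bounded_by_ex: "\<exists>R. bounded_by \<nu> R c"
proof -
  have "\<forall>y\<in>keys c. \<nu> y \<le> Max (insert 0 (\<nu> ` keys c))" by (auto intro: Max_ge)
  then show ?thesis unfolding bounded_by_def by blast
qed

lemma uniform_bound:
  fixes P :: "nat \<Rightarrow> real \<Rightarrow> bool"
  assumes "\<And>k. k \<le> n \<Longrightarrow> \<exists>R. P k R" "\<And>k R R'. \<lbrakk>P k R; R \<le> R'\<rbrakk> \<Longrightarrow> P k R'"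
  shows "\<exists>R. \<forall>k\<le>n. P k R"
proof -
  obtain f where f: "\<And>k. k \<le> n \<Longrightarrow> P k (f k)" using assms(1) by metis
  have "P k (Max (f ` {..n}))" if "k \<le> n" for k
    by (rule assms(2)[OF f[OF that]]) (use that in auto)
  then show ?thesis by blast
qed

section \<open>Comparison of two free resolutions\<close>

definition equivariant_map ::
    "('g, 'z) monoid_scheme \<Rightarrow> ('g \<Rightarrow> 'y \<Rightarrow> 'y) \<Rightarrow> (nat \<Rightarrow> 'y set) \<Rightarrow>
     ('g \<Rightarrow> 'p \<Rightarrow> 'p) \<Rightarrow> (nat \<Rightarrow> 'p set) \<Rightarrow> nat \<Rightarrow> ('y \<Rightarrow> 'p \<Rightarrow>\<^sub>0 int) \<Rightarrow> bool" where
  "equivariant_map G act Y act' Y' j u \<longleftrightarrow> (\<forall>k. \<forall>y\<in>Y k. u y \<in> chains Y' (k + j) \<and>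
    (\<forall>g\<in>carrier G. u (act g y) = translate act' g (u y)))"

definition chain_map ::
    "(nat \<Rightarrow> 'y set) \<Rightarrow> ('y \<Rightarrow> 'y \<Rightarrow>\<^sub>0 int) \<Rightarrow> ('p \<Rightarrow> 'p \<Rightarrow>\<^sub>0 int) \<Rightarrow> ('y \<Rightarrow> 'p \<Rightarrow>\<^sub>0 int) \<Rightarrow> bool" where
  "chain_map Y bd bd' u \<longleftrightarrow> (\<forall>k. \<forall>y\<in>Y k. frag_extend bd' (u y) = frag_extend u (bd y))"

lemma equivariant_mapD:
  assumes "equivariant_map G act Y act' Y' j u"
  shows "y \<in> Y k \<Longrightarrow> u y \<in> chains Y' (k + j)"
    "\<lbrakk>g \<in> carrier G; y \<in> Y k\<rbrakk> \<Longrightarrow> u (act g y) = translate act' g (u y)"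
  using assms by (auto simp: equivariant_map_def)

lemma chain_mapD: "\<lbrakk>chain_map Y bd bd' u; y \<in> Y k\<rbrakk> \<Longrightarrow> frag_extend bd' (u y) = frag_extend u (bd y)"
  by (auto simp: chain_map_def)

text \<open>\<open>Rel c p\<close> stands for: \<open>c\<close> and \<open>p\<close> have the same
  image in the resolved module. A relation between the chains of degree 0 keeps the module and both
  augmentations out of the argument, and it is symmetric in the two complexes, so that results hold
  with the roles exchanged, by \<open>swap\<close>.\<close>

locale resolution_pair =
  F: free_complex G act Y bd + P: free_complex G act' Y' bd'
  for G :: "('g, 'z) monoid_scheme" (structure) and act :: "'g \<Rightarrow> 'y \<Rightarrow> 'y" and Y bd
    and act' :: "'g \<Rightarrow> 'p \<Rightarrow> 'p" and Y' bd' +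
  fixes Rel :: "('y \<Rightarrow>\<^sub>0 int) \<Rightarrow> ('p \<Rightarrow>\<^sub>0 int) \<Rightarrow> bool"
  assumes rel_0: "Rel 0 0"
    and rel_diff: "\<lbrakk>c \<in> F.C 0; c' \<in> F.C 0; p \<in> P.C 0; p' \<in> P.C 0; Rel c p; Rel c' p'\<rbrakk> \<Longrightarrow> Rel (c - c') (p - p')"
    and rel_act: "\<lbrakk>g \<in> carrier G; c \<in> F.C 0; p \<in> P.C 0; Rel c p\<rbrakk> \<Longrightarrow> Rel (translate act g c) (translate act' g p)"
    and rel_right: "c \<in> F.C 0 \<Longrightarrow> \<exists>p\<in>P.C 0. Rel c p"
    and rel_left: "p \<in> P.C 0 \<Longrightarrow> \<exists>c\<in>F.C 0. Rel c p"
    and rel_bd_left: "c \<in> F.C 0 \<Longrightarrow> Rel c 0 \<longleftrightarrow> (\<exists>e\<in>F.C (Suc 0). F.d e = c)"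
    and rel_bd_right: "p \<in> P.C 0 \<Longrightarrow> Rel 0 p \<longleftrightarrow> (\<exists>e\<in>P.C (Suc 0). P.d e = p)"

lemma (in resolution_pair) swap: "resolution_pair G act' Y' bd' act Y bd (\<lambda>p c. Rel c p)"
  by unfold_locales (use rel_0 rel_diff rel_act rel_right rel_left rel_bd_left rel_bd_right in auto)

context resolution_pair
begin

lemma rel_frag_extend:
  assumes "c \<in> F.C 0" and f: "\<And>y. y \<in> Y 0 \<Longrightarrow> f y \<in> P.C 0 \<and> Rel (frag_of y) (f y)"
  shows "Rel c (frag_extend f c)"
proof -
  have "keys c \<subseteq> Y 0" using assms(1) by (simp add: chains_def)
  then have "c \<in> F.C 0 \<and> frag_extend f c \<in> P.C 0 \<and> Rel c (frag_extend f c)"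
    by (induction c rule: frag_induction) (use f in \<open>auto simp: rel_0 frag_extend_diff intro: rel_diff\<close>)
  then show ?thesis by blast
qed

text \<open>The usual lifting of a map of modules to free resolutions. Basis elements of degree 0 go
  to related chains, and from degree 2 on the exactness of the target provides preimages. Degree 1
  lies between: there the preimages come from the conditions on \<open>Rel\<close>.\<close>

lemma equivariant_chain_map:
  obtains f where "\<And>k y. y \<in> Y k \<Longrightarrow> f y \<in> P.C k"
    "\<And>k g y. \<lbrakk>g \<in> carrier G; y \<in> Y k\<rbrakk> \<Longrightarrow> f (act g y) = translate act' g (f y)"
    "\<And>k y. y \<in> Y k \<Longrightarrow> P.d (f y) = frag_extend f (bd y)"
    "\<And>y. y \<in> Y 0 \<Longrightarrow> Rel (frag_of y) (f y)"
proof -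
  define Q where "Q k f \<longleftrightarrow> (\<forall>y\<in>Y k. f y \<in> P.C k \<and> (\<forall>g\<in>carrier G. f (act g y) = translate act' g (f y)) \<and>
    P.d (f y) = frag_extend f (bd y) \<and> (k = 0 \<longrightarrow> Rel (frag_of y) (f y)))" for k f
  have bdY: "bd y \<in> F.C (k - 1)" if "y \<in> Y k" for y k
    using that F.bd_closed F.bd_zero by (cases k) auto
  have "\<exists>f. \<forall>k. Q k f"
  proof (rule degreewise_construction[where Y = Y and Q = Q])
    show "i = j" if "y \<in> Y i" "y \<in> Y j" for i j y using F.degree_unique that .
    show "Q k v" if Q: "Q k u" and eq: "\<And>j y. \<lbrakk>j \<le> k; y \<in> Y j\<rbrakk> \<Longrightarrow> u y = v y" for k u v
    proof -
      have "frag_extend u (bd y) = frag_extend v (bd y)" if "y \<in> Y k" for y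
        by (rule frag_extend_eq_on_chains[OF bdY[OF that]]) (rule eq, auto)
      then show ?thesis using Q eq[of k] F.act_closed unfolding Q_def by auto
    qed
    fix k u assume IH: "\<And>j. j < k \<Longrightarrow> Q j u"
    show "\<exists>w. Q k (\<lambda>y. if y \<in> Y k then w y else u y)"
    proof (cases k)
      case 0
      obtain v where v: "\<And>y. y \<in> Y 0 \<Longrightarrow> v y \<in> P.C 0 \<and> Rel (frag_of y) (v y)"
        "\<And>g y. \<lbrakk>g \<in> carrier G; y \<in> Y 0\<rbrakk> \<Longrightarrow> v (act g y) = translate act' g (v y)"
      proof (rule F.equivariant_choice[where S = "Y 0" and a = act and b = "translate act'"
          and Q = "\<lambda>y z. z \<in> P.C 0 \<and> Rel (frag_of y) z"])
        show "\<exists>z. z \<in> P.C 0 \<and> Rel (frag_of s) z" if "s \<in> Y 0" for s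
          using rel_right[of "frag_of s"] that by auto
        show "translate act' g z \<in> P.C 0 \<and> Rel (frag_of (act g s)) (translate act' g z)"
          if "g \<in> carrier G" "s \<in> Y 0" "z \<in> P.C 0 \<and> Rel (frag_of s) z" for g s z
          using rel_act[of g "frag_of s" z] P.translate_closed that by auto
      qed (auto simp: F.act_closed F.act_one F.act_mult F.act_free P.translate_one P.translate_mult)
      have "frag_extend (\<lambda>y. if y \<in> Y 0 then v y else u y) (bd y) = 0" if "y \<in> Y 0" for y
        using that by (simp add: F.bd_zero)
      then show ?thesis using v F.act_closed P.d_zero unfolding 0
        by (intro exI[of _ v]) (auto simp: Q_def)
    next
      case (Suc j)
      have u: "\<And>y. y \<in> Y j \<Longrightarrow> u y \<in> P.C j" "\<And>y. y \<in> Y j \<Longrightarrow> P.d (u y) = frag_extend u (bd y)"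
        "\<And>g y. \<lbrakk>g \<in> carrier G; y \<in> Y j\<rbrakk> \<Longrightarrow> u (act g y) = translate act' g (u y)"
        "\<And>y. \<lbrakk>j = 0; y \<in> Y 0\<rbrakk> \<Longrightarrow> Rel (frag_of y) (u y)"
        using IH[of j] Suc by (auto simp: Q_def)
      have w: "\<exists>e\<in>P.C k. P.d e = frag_extend u (bd y)" if y: "y \<in> Y k" for y
      proof -
        have b: "bd y \<in> F.C j" using y Suc F.bd_closed by blast
        have uC: "frag_extend u (bd y) \<in> P.C j" by (rule chains_frag_extend[OF b u(1)])
        show ?thesis
        proof (cases j)
          case 0
          have 1: "Rel (bd y) (frag_extend u (bd y))"
            using rel_frag_extend[of "bd y" u] b u 0 by auto
          have "F.d (frag_of y) = bd y" "frag_of y \<in> F.C (Suc 0)" using y Suc 0 by auto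
          then have "Rel (bd y) 0" using rel_bd_left[of "bd y"] b 0 by blast
          \<comment> \<open>\<open>bd y\<close> is related both to its image and to 0. The
            difference relates 0 to the image, which is therefore a boundary.\<close>
          then have "Rel (bd y - bd y) (frag_extend u (bd y) - 0)"
            using rel_diff[of "bd y" "bd y" "frag_extend u (bd y)" 0] 1 b uC 0 by auto
          then show ?thesis using rel_bd_right uC 0 Suc by auto
        next
          case (Suc i)
          have "P.d (frag_extend u (bd y)) = frag_extend (\<lambda>y. frag_extend u (bd y)) (bd y)"
            unfolding frag_extend_frag_extend by (rule frag_extend_eq_on_chains[OF b u(2)])
          also have "\<dots> = frag_extend u (F.d (bd y))" by (simp add: frag_extend_frag_extend)
          also have "\<dots> = 0" using F.bd_bd[OF y] by simp
          finally show ?thesis using P.exact uC Suc \<open>k = Suc j\<close> by blast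
        qed
      qed
      have w_act: "frag_extend u (bd (act g y)) = translate act' g (frag_extend u (bd y))"
        if "g \<in> carrier G" "y \<in> Y k" for g y
        using that frag_extend_translate[of "bd y" Y j u act g act'] u(3) F.bd_closed Suc
        by (auto simp: F.bd_act)
      obtain v where v: "\<And>y. y \<in> Y k \<Longrightarrow> v y \<in> P.C k" "\<And>y. y \<in> Y k \<Longrightarrow> P.d (v y) = frag_extend u (bd y)"
        "\<And>g y. \<lbrakk>g \<in> carrier G; y \<in> Y k\<rbrakk> \<Longrightarrow> v (act g y) = translate act' g (v y)"
        by (rule P.equivariant_preimage[where k = k, OF F.free_complex_axioms w])
          (auto simp: w_act)
      have "frag_extend (\<lambda>y. if y \<in> Y k then v y else u y) (bd y) = frag_extend u (bd y)" if "y \<in> Y k" for y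
      proof (rule frag_extend_eq_on_chains)
        show "bd y \<in> F.C j" using that Suc F.bd_closed by blast
      qed (use F.degree_unique[of _ j k] Suc in auto)
      then show ?thesis using v F.act_closed Suc by (intro exI[of _ v]) (auto simp: Q_def)
    qed
  qed blast
  then obtain f where "\<forall>k. Q k f" ..
  then show ?thesis using that[of f] unfolding Q_def by blast
qed

text \<open>The composite of \<open>f\<close> and \<open>h\<close> preserves \<open>Rel\<close>, so
  in degree 0 it differs from the identity by a boundary and \<open>equivariant_homotopy\<close>
  applies. The round trip that starts in the other complex is obtained through
  \<open>swap\<close>.\<close>

lemma round_trip_homotopy:
  obtains f h s where "equivariant_map G act Y act' Y' 0 f" "chain_map Y bd bd' f"
    "equivariant_map G act' Y' act Y 0 h" "chain_map Y' bd' bd h" "equivariant_map G act Y act Y 1 s"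
    "\<forall>k. \<forall>c\<in>F.C k. F.d (frag_extend s c) = frag_extend h (frag_extend f c) - c - frag_extend s (F.d c)"
proof -
  interpret sw: resolution_pair G act' Y' bd' act Y bd "\<lambda>p c. Rel c p" by (rule swap)
  obtain f where f: "\<And>k y. y \<in> Y k \<Longrightarrow> f y \<in> P.C k"
    "\<And>k g y. \<lbrakk>g \<in> carrier G; y \<in> Y k\<rbrakk> \<Longrightarrow> f (act g y) = translate act' g (f y)"
    "\<And>k y. y \<in> Y k \<Longrightarrow> P.d (f y) = frag_extend f (bd y)"
    "\<And>y. y \<in> Y 0 \<Longrightarrow> Rel (frag_of y) (f y)" using equivariant_chain_map by metis
  obtain h where h: "\<And>k y. y \<in> Y' k \<Longrightarrow> h y \<in> F.C k"
    "\<And>k g y. \<lbrakk>g \<in> carrier G; y \<in> Y' k\<rbrakk> \<Longrightarrow> h (act' g y) = translate act g (h y)"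
    "\<And>k y. y \<in> Y' k \<Longrightarrow> F.d (h y) = frag_extend h (bd' y)"
    "\<And>y. y \<in> Y' 0 \<Longrightarrow> Rel (h y) (frag_of y)" using sw.equivariant_chain_map by metis
  have hd: "F.d (frag_extend h c) = frag_extend h (P.d c)" if "c \<in> P.C k" for c k
    unfolding frag_extend_frag_extend by (rule frag_extend_eq_on_chains[OF that h(3)])
  define r where "r y = frag_extend h (f y)" for y
  obtain s where s: "\<And>k y. y \<in> Y k \<Longrightarrow> s y \<in> F.C (Suc k)"
    "\<And>k g y. \<lbrakk>g \<in> carrier G; y \<in> Y k\<rbrakk> \<Longrightarrow> s (act g y) = translate act g (s y)"
    "\<And>k y. y \<in> Y k \<Longrightarrow> F.d (s y) = r y - frag_of y - frag_extend s (bd y)"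
  proof (rule F.equivariant_homotopy[of r])
    show "r y \<in> F.C k" if "y \<in> Y k" for k y unfolding r_def
      by (rule chains_frag_extend[OF f(1)[OF that] h(1)])
    show "r (act g y) = translate act g (r y)" if "g \<in> carrier G" "y \<in> Y k" for k g y
      unfolding r_def f(2)[OF that] by (rule frag_extend_translate[OF f(1)[OF that(2)]]) (use h(2) that in blast)
    show "F.d (r y) = frag_extend r (bd y)" if "y \<in> Y k" for k y
      unfolding r_def hd[OF f(1)[OF that]] f(3)[OF that] by (simp add: frag_extend_frag_extend)
    show "\<exists>e\<in>F.C (Suc 0). F.d e = r y - frag_of y" if "y \<in> Y 0" for y
    proof -
      have rC: "r y \<in> F.C 0" unfolding r_def by (rule chains_frag_extend[OF f(1)[OF that] h(1)])
      have "Rel (r y) (f y)" using sw.rel_frag_extend[of "f y" h] f(1)[OF that] h by (auto simp: r_def)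
      then have "Rel (r y - frag_of y) (f y - f y)"
        using rel_diff[of "r y" "frag_of y" "f y" "f y"] rC f(1,4) that by auto
      moreover have "r y - frag_of y \<in> F.C 0" by (rule chains_diff[OF rC]) (use that in simp)
      ultimately show ?thesis using rel_bd_left[of "r y - frag_of y"] by simp
    qed
  qed blast
  have hom: "F.d (frag_extend s c) = frag_extend h (frag_extend f c) - c - frag_extend s (F.d c)" if "c \<in> F.C k" for k c
  proof -
    have "F.d (frag_extend s c) = frag_extend (\<lambda>y. r y - frag_of y - frag_extend s (bd y)) c"
      unfolding frag_extend_frag_extend by (rule frag_extend_eq_on_chains[OF that s(3)])
    then show ?thesis by (simp add: frag_extend_fn_diff frag_extend_frag_extend r_def)
  qed
  show ?thesis
    by (rule that[of f h s]) (use f(1-3) h(1-3) s(1,2) hom in \<open>auto simp: equivariant_map_def chain_map_def\<close>)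
qed

end

text \<open>The \<int>G-submodule generated by \<open>X\<close>, described as the additive group
  generated by the translates of its elements.\<close>

inductive_set translate_span :: "('g, 'z) monoid_scheme \<Rightarrow> ('g \<Rightarrow> 'y \<Rightarrow> 'y) \<Rightarrow> ('y \<Rightarrow>\<^sub>0 int) set \<Rightarrow> ('y \<Rightarrow>\<^sub>0 int) set"
  for G act X where
  zero: "0 \<in> translate_span G act X"
| gen: "\<lbrakk>x \<in> X; g \<in> carrier G\<rbrakk> \<Longrightarrow> translate act g x \<in> translate_span G act X"
| diff: "\<lbrakk>a \<in> translate_span G act X; b \<in> translate_span G act X\<rbrakk> \<Longrightarrow> a - b \<in> translate_span G act X"

lemma orbit_finiteE:
  assumes "orbit_finite G act S"
  obtains X where "finite X" "X \<subseteq> S" "\<forall>y\<in>S. \<exists>g\<in>carrier G. \<exists>x\<in>X. y = act g x"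
  using assms unfolding orbit_finite_def by blast

lemma translate_span_frag_extend:
  assumes "\<And>y. y \<in> keys c \<Longrightarrow> u y \<in> translate_span G act X"
  shows "frag_extend u c \<in> translate_span G act X"
  using subset_refl[of "keys c"]
proof (induction c rule: frag_induction)
  case (diff a b)
  then show ?case by (simp add: frag_extend_diff translate_span.diff)
qed (use assms translate_span.zero in auto)

text \<open>A bound at the finitely many representatives is a bound everywhere, because \<nu> is
  constant on orbits.\<close>

lemma (in free_complex) equivariant_bounded:
  assumes S: "orbit_finite G a S"
    and u: "\<And>y. y \<in> S \<Longrightarrow> u y \<in> C j" "\<And>g y. \<lbrakk>g \<in> carrier G; y \<in> S\<rbrakk> \<Longrightarrow> u (a g y) = translate act g (u y)"
    and \<nu>: "\<And>k g y. \<lbrakk>g \<in> carrier G; y \<in> Y k\<rbrakk> \<Longrightarrow> \<nu> (act g y) = \<nu> y"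
  shows "\<exists>R. \<forall>y\<in>S. bounded_by \<nu> R (u y)"
proof -
  obtain X where X: "finite X" "X \<subseteq> S" "\<forall>y\<in>S. \<exists>g\<in>carrier G. \<exists>x\<in>X. y = a g x"
    by (rule orbit_finiteE[OF S])
  have "\<exists>R. bounded_by \<nu> R (u x)" for x by (rule bounded_by_ex)
  then obtain R where R: "\<And>x. bounded_by \<nu> (R x) (u x)" by metis
  have "bounded_by \<nu> (Max (insert 0 (R ` X))) (u y)" if yS: "y \<in> S" for y
  proof -
    obtain g x where gx: "g \<in> carrier G" "x \<in> X" "y = a g x" using X(3) yS by blast
    have xS: "x \<in> S" using gx X by auto
    have "bounded_by \<nu> (Max (insert 0 (R ` X))) (u x)"
      by (rule bounded_by_mono[OF R]) (use X gx in auto)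
    then show ?thesis
      using keys_translate[of act g "u x"] u(1)[OF xS] \<nu>[OF gx(1)]
      unfolding gx(3) u(2)[OF gx(1) xS] bounded_by_def chains_def by force
  qed
  then show ?thesis by blast
qed

section \<open>Brown's criterion\<close>

context resolution_pair
begin

text \<open>The filling is \<open>t = s w\<close> for the round trip homotopy: then
  \<open>w + d t = h (f w) - s (d w)\<close>. The first term is bounded because it passes through a
  complex with finitely many orbits, the second because \<open>d w\<close> is bounded. No bound on
  \<open>w\<close> itself is involved.\<close>

lemma essentially_acyclic_if_finite:
  assumes \<nu>: "\<And>k g y. \<lbrakk>g \<in> carrier G; y \<in> Y k\<rbrakk> \<Longrightarrow> \<nu> (act g y) = \<nu> y"
    and fin: "\<And>k R. k \<le> n \<Longrightarrow> orbit_finite G act {y \<in> Y k. \<nu> y \<le> R}"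
    and finP: "\<And>k. k \<le> n \<Longrightarrow> orbit_finite G act' (Y' k)"
  shows "\<exists>R'. \<forall>k\<le>n. \<forall>w\<in>F.C k. bounded_by \<nu> R (F.d w) \<longrightarrow>
    (\<exists>t\<in>F.C (Suc k). bounded_by \<nu> R' (w + F.d t))"
proof -
  obtain f h s where fm: "equivariant_map G act Y act' Y' 0 f" "chain_map Y bd bd' f"
    and hm: "equivariant_map G act' Y' act Y 0 h" "chain_map Y' bd' bd h"
    and sm: "equivariant_map G act Y act Y 1 s"
    and hom: "\<forall>k. \<forall>c\<in>F.C k. F.d (frag_extend s c) = frag_extend h (frag_extend f c) - c - frag_extend s (F.d c)"
    by (rule round_trip_homotopy)
  note f = equivariant_mapD[OF fm(1), unfolded add_0_right] chain_mapD[OF fm(2)]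
  note h = equivariant_mapD[OF hm(1), unfolded add_0_right] chain_mapD[OF hm(2)]
  note s = equivariant_mapD[OF sm, unfolded Suc_eq_plus1[symmetric]] hom[rule_format]
  have "\<exists>R'. \<forall>k\<le>n. \<forall>y\<in>Y' k. bounded_by \<nu> R' (h y)"
  proof (rule uniform_bound)
    show "\<exists>R'. \<forall>y\<in>Y' k. bounded_by \<nu> R' (h y)" if "k \<le> n" for k
      by (rule F.equivariant_bounded[OF finP[OF that], of h k \<nu>]) (use h \<nu> in auto)
  qed (blast intro: bounded_by_mono)
  then obtain R1 where R1: "\<And>k y. \<lbrakk>k \<le> n; y \<in> Y' k\<rbrakk> \<Longrightarrow> bounded_by \<nu> R1 (h y)" by blast
  have "\<exists>R'. \<forall>k\<le>n. \<forall>y\<in>{y\<in>Y k. \<nu> y \<le> R}. bounded_by \<nu> R' (s y)"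
  proof (rule uniform_bound)
    show "\<exists>R'. \<forall>y\<in>{y\<in>Y k. \<nu> y \<le> R}. bounded_by \<nu> R' (s y)" if "k \<le> n" for k
      by (rule F.equivariant_bounded[where u = s and j = "Suc k" and \<nu> = \<nu>, OF fin[OF that]]) (use s(1,2) \<nu> in auto)
  qed (blast intro: bounded_by_mono)
  then obtain R2 where R2: "\<And>k y. \<lbrakk>k \<le> n; y \<in> Y k; \<nu> y \<le> R\<rbrakk> \<Longrightarrow> bounded_by \<nu> R2 (s y)" by blast
  have "\<exists>t\<in>F.C (Suc k). bounded_by \<nu> (max R1 R2) (w + F.d t)"
    if k: "k \<le> n" and w: "w \<in> F.C k" and dw: "bounded_by \<nu> R (F.d w)" for k w
  proof (intro bexI)
    have "frag_extend f w \<in> P.C k" by (rule chains_frag_extend[OF w f(1)])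
    then have 1: "bounded_by \<nu> (max R1 R2) (frag_extend h (frag_extend f w))"
      by (intro bounded_by_frag_extend bounded_by_mono[OF R1[OF k]]) (auto simp: chains_def)
    have "bounded_by \<nu> (max R1 R2) (frag_extend s (F.d w))"
    proof (cases k)
      case 0
      then show ?thesis using w F.d_zero by simp
    next
      case (Suc j)
      then have "F.d w \<in> F.C j" using w F.d_closed by blast
      then show ?thesis using dw k Suc
        by (intro bounded_by_frag_extend bounded_by_mono[OF R2[of j]]) (auto simp: chains_def bounded_by_def)
    qed
    then show "bounded_by \<nu> (max R1 R2) (w + F.d (frag_extend s w))"
      using 1 s(3)[OF w] by (simp add: bounded_by_diff)
    show "frag_extend s w \<in> F.C (Suc k)" by (rule chains_frag_extend[OF w s(1)])
  qed
  then show ?thesis by blast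
qed

text \<open>A boundary \<open>p\<close> of the second complex is sent by \<open>f\<close> to a
  boundary that is bounded by a constant, since \<open>Y' k\<close> has finitely many orbits.
  Filling it by a chain \<open>w\<close> bounded by \<open>R'\<close> and returning with
  \<open>h\<close> gives \<open>p = d (h w) - d (s p)\<close>. So the elements
  \<open>d (h y)\<close>, for \<open>y\<close> in the sublevel \<open>R'\<close>, and
  \<open>d (s y)\<close>, for \<open>y\<close> in \<open>Y' k\<close>, generate the boundaries, and
  finitely many of each suffice up to translation.\<close>

lemma boundaries_finitely_generated:
  assumes \<nu>: "\<And>k g y. \<lbrakk>g \<in> carrier G; y \<in> Y k\<rbrakk> \<Longrightarrow> \<nu> (act g y) = \<nu> y"
    and fin: "\<And>R. orbit_finite G act {y \<in> Y (Suc k). \<nu> y \<le> R}"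
    and ess: "\<And>R. \<exists>R'. \<forall>w\<in>F.C (Suc k). bounded_by \<nu> R (F.d w) \<longrightarrow>
      (\<exists>t\<in>F.C (Suc (Suc k)). bounded_by \<nu> R' (w + F.d t))"
    and finP: "orbit_finite G act' (Y' k)"
  obtains X where "finite X" "X \<subseteq> P.d ` P.C (Suc k)" "P.d ` P.C (Suc k) \<subseteq> translate_span G act' X"
proof -
  interpret sw: resolution_pair G act' Y' bd' act Y bd "\<lambda>p c. Rel c p" by (rule swap)
  obtain f h s where fm: "equivariant_map G act' Y' act Y 0 f" "chain_map Y' bd' bd f"
    and hm: "equivariant_map G act Y act' Y' 0 h" "chain_map Y bd bd' h"
    and sm: "equivariant_map G act' Y' act' Y' 1 s"
    and hom: "\<forall>k. \<forall>c\<in>P.C k. P.d (frag_extend s c) = frag_extend h (frag_extend f c) - c - frag_extend s (P.d c)"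
    by (rule sw.round_trip_homotopy)
  note f = equivariant_mapD[OF fm(1), unfolded add_0_right] chain_mapD[OF fm(2)]
  note h = equivariant_mapD[OF hm(1), unfolded add_0_right] chain_mapD[OF hm(2)]
  note s = equivariant_mapD[OF sm, unfolded Suc_eq_plus1[symmetric]] hom[rule_format]
  obtain R where R: "\<And>y. y \<in> Y' k \<Longrightarrow> bounded_by \<nu> R (f y)"
    using F.equivariant_bounded[OF finP, of f k \<nu>] f(1,2) \<nu> by blast
  obtain R' where R': "\<And>w. \<lbrakk>w \<in> F.C (Suc k); bounded_by \<nu> R (F.d w)\<rbrakk> \<Longrightarrow>
      \<exists>t\<in>F.C (Suc (Suc k)). bounded_by \<nu> R' (w + F.d t)" using ess by blast
  obtain X1 where X1: "finite X1" "X1 \<subseteq> {y \<in> Y (Suc k). \<nu> y \<le> R'}"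
    "\<forall>y\<in>{y \<in> Y (Suc k). \<nu> y \<le> R'}. \<exists>g\<in>carrier G. \<exists>x\<in>X1. y = act g x"
    by (rule orbit_finiteE[OF fin[of R']])
  obtain X2 where X2: "finite X2" "X2 \<subseteq> Y' k"
    "\<forall>y\<in>Y' k. \<exists>g\<in>carrier G. \<exists>x\<in>X2. y = act' g x"
    by (rule orbit_finiteE[OF finP])
  define X where "X = (\<lambda>y. P.d (h y)) ` X1 \<union> (\<lambda>y. P.d (s y)) ` X2"
  have gen1: "P.d (h y) \<in> translate_span G act' X" if y: "y \<in> Y (Suc k)" "\<nu> y \<le> R'" for y
  proof -
    obtain g x where gx: "g \<in> carrier G" "x \<in> X1" "y = act g x" using X1(3) y by blast
    have "P.d (h y) = translate act' g (P.d (h x))"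
      using gx X1(2) h(1,2) P.d_translate[of g "h x" "Suc k"] by auto
    then show ?thesis using gx by (auto simp: X_def intro: translate_span.gen)
  qed
  have gen2: "P.d (s y) \<in> translate_span G act' X" if y: "y \<in> Y' k" for y
  proof -
    obtain g x where gx: "g \<in> carrier G" "x \<in> X2" "y = act' g x" using X2(3) y by blast
    have "P.d (s y) = translate act' g (P.d (s x))"
      using gx X2(2) s(1,2) P.d_translate[of g "s x" "Suc k"] by auto
    then show ?thesis using gx by (auto simp: X_def intro: translate_span.gen)
  qed
  have "P.d p' \<in> translate_span G act' X" if p': "p' \<in> P.C (Suc k)" for p'
  proof -
    define p where "p = P.d p'"
    have p: "p \<in> P.C k" "P.d p = 0" using p' P.d_closed P.d_d by (auto simp: p_def)
    have fp': "frag_extend f p' \<in> F.C (Suc k)" by (rule chains_frag_extend[OF p' f(1)])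
    have dfp: "F.d (frag_extend f p') = frag_extend f p"
      unfolding p_def frag_extend_frag_extend by (rule frag_extend_eq_on_chains[OF p' f(3)])
    have "bounded_by \<nu> R (frag_extend f p)"
      using p(1) by (intro bounded_by_frag_extend R) (auto simp: chains_def)
    then obtain t where t: "t \<in> F.C (Suc (Suc k))" "bounded_by \<nu> R' (frag_extend f p' + F.d t)"
      using R'[OF fp'] dfp by auto
    define w where "w = frag_extend f p' + F.d t"
    have w: "w \<in> F.C (Suc k)" using fp' t F.d_closed by (auto simp: w_def)
    have dw: "F.d w = frag_extend f p"
      using dfp t F.d_d by (auto simp: w_def frag_extend_add)
    have "P.d (frag_extend h w) = frag_extend h (F.d w)"
      unfolding frag_extend_frag_extend by (rule frag_extend_eq_on_chains[OF w h(3)])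
    then have "p = P.d (frag_extend h w) - P.d (frag_extend s p)"
      using s(3)[OF p(1)] p(2) dw by simp
    moreover have "P.d (frag_extend h w) \<in> translate_span G act' X"
      unfolding frag_extend_frag_extend
      by (rule translate_span_frag_extend, rule gen1) (use w t(2) in \<open>auto simp: w_def[symmetric] chains_def bounded_by_def\<close>)
    moreover have "P.d (frag_extend s p) \<in> translate_span G act' X"
      unfolding frag_extend_frag_extend
      by (rule translate_span_frag_extend, rule gen2) (use p(1) in \<open>auto simp: chains_def\<close>)
    ultimately show ?thesis unfolding p_def using translate_span.diff by metis
  qed
  moreover have "X \<subseteq> P.d ` P.C (Suc k)" using X1(2) X2(2) h(1) s(1) by (auto simp: X_def)
  moreover have "finite X" using X1 X2 by (simp add: X_def)
  ultimately show ?thesis using that by blast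
qed

end

section \<open>Retracting to balls\<close>

text \<open>Quantities that are invariant under \<open>G\<close> take finitely many values on the
  basis of each degree up to \<open>n\<close>; this is the source of the uniform constants.\<close>

locale controlled_complex = free_complex G act Y bd
  for G :: "('g, 'z) monoid_scheme" (structure) and act :: "'g \<Rightarrow> 'y \<Rightarrow> 'y" and Y bd +
  fixes \<rho> :: "'g \<Rightarrow> 'm::metric_space \<Rightarrow> 'm" and \<pi> :: "'y \<Rightarrow> 'm" and n :: nat
  assumes \<rho>_dist: "g \<in> carrier G \<Longrightarrow> dist (\<rho> g x) (\<rho> g x') = dist x x'"
    and \<rho>_one: "\<rho> \<one> x = x"
    and \<rho>_mult: "\<lbrakk>g \<in> carrier G; h \<in> carrier G\<rbrakk> \<Longrightarrow> \<rho> (g \<otimes> h) x = \<rho> g (\<rho> h x)"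
    and \<pi>_act: "\<lbrakk>g \<in> carrier G; y \<in> Y k\<rbrakk> \<Longrightarrow> \<pi> (act g y) = \<rho> g (\<pi> y)"
    and orbit_finite_Y: "k \<le> n \<Longrightarrow> orbit_finite G act (Y k)"
begin

abbreviation near :: "'m \<Rightarrow> real \<Rightarrow> ('y \<Rightarrow>\<^sub>0 int) \<Rightarrow> bool" where
  "near p \<equiv> bounded_by (\<lambda>y. dist p (\<pi> y))"

lemma near_shift: "near p R c \<Longrightarrow> dist p' p \<le> \<delta> \<Longrightarrow> R + \<delta> \<le> R' \<Longrightarrow> near p' R' c"
  using dist_triangle[of p' _ p] unfolding bounded_by_def by (smt (verit))

lemma \<rho>_inv: "g \<in> carrier G \<Longrightarrow> \<rho> g (\<rho> (inv g) x) = x"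
  using \<rho>_mult[of g "inv g" x] \<rho>_one by simp

lemma near_translate:
  assumes "near p R c" "c \<in> C k" "g \<in> carrier G"
  shows "near (\<rho> g p) R (translate act g c)"
  unfolding bounded_by_def
proof
  fix z assume "z \<in> keys (translate act g c)"
  then obtain y where y: "y \<in> keys c" "z = act g y" using keys_translate[of act g c] by auto
  then have "y \<in> Y k" using assms(2) by (auto simp: chains_def)
  then show "dist (\<rho> g p) (\<pi> z) \<le> R"
    using y assms by (simp add: \<pi>_act \<rho>_dist bounded_by_def)
qed

lemma translate_inv: "\<lbrakk>g \<in> carrier G; c \<in> C k\<rbrakk> \<Longrightarrow> translate act g (translate act (inv g) c) = c"
  using translate_mult[of g "inv g" c k] translate_one by simp

lemma finite_family_displacement:
  assumes k: "k \<le> n"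
    and U: "\<And>y. y \<in> Y k \<Longrightarrow> finite (U y)" "\<And>y. y \<in> Y k \<Longrightarrow> U y \<subseteq> C j"
    and U_act: "\<And>g y. \<lbrakk>g \<in> carrier G; y \<in> Y k\<rbrakk> \<Longrightarrow> U (act g y) \<subseteq> translate act g ` U y"
  shows "\<exists>D. \<forall>y\<in>Y k. \<forall>c\<in>U y. near (\<pi> y) D c"
proof -
  obtain X where X: "finite X" "X \<subseteq> Y k" "\<forall>y\<in>Y k. \<exists>g\<in>carrier G. \<exists>x\<in>X. y = act g x"
    by (rule orbit_finiteE[OF orbit_finite_Y[OF k]])
  define f where "f x c = (SOME D. near (\<pi> x) D c)" for x c
  have f: "near (\<pi> x) (f x c) c" for x c
    unfolding f_def by (rule someI_ex[OF bounded_by_ex])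
  define B where "B = (\<Union>x\<in>X. f x ` U x)"
  have fB: "finite B" unfolding B_def using X U by auto
  have "near (\<pi> y) (Max (insert 0 B)) c" if y: "y \<in> Y k" and c: "c \<in> U y" for y c
  proof -
    obtain g x where gx: "g \<in> carrier G" "x \<in> X" "y = act g x" using X(3) y by blast
    have xY: "x \<in> Y k" using gx X by auto
    obtain c' where c': "c' \<in> U x" "c = translate act g c'" using U_act[OF gx(1) xY] c gx by auto
    have "near (\<pi> x) (Max (insert 0 B)) c'"
      by (rule bounded_by_mono[OF f]) (use fB gx c' in \<open>auto simp: B_def intro!: Max_ge\<close>)
    then show ?thesis using near_translate[of "\<pi> x" _ c' j g] c' U(2)[OF xY] gx xY
      by (auto simp: \<pi>_act)
  qed
  then show ?thesis by blast
qed

lemma bd_displacement: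
  obtains D where "D \<ge> 0" "\<And>k y. \<lbrakk>k \<le> n; y \<in> Y k\<rbrakk> \<Longrightarrow> near (\<pi> y) D (bd y)"
proof -
  have "\<exists>D. \<forall>k\<le>n. \<forall>y\<in>Y k. near (\<pi> y) D (bd y)"
  proof (rule uniform_bound)
    show "\<exists>D. \<forall>y\<in>Y k. near (\<pi> y) D (bd y)" if k: "k \<le> n" for k
    proof -
      have "bd y \<in> C (k - 1)" if "y \<in> Y k" for y using that bd_closed bd_zero by (cases k) auto
      then show ?thesis using finite_family_displacement[OF k, of "\<lambda>y. {bd y}" "k - 1"] by (auto simp: bd_act)
    qed
  qed (blast intro: bounded_by_mono)
  then obtain D where "\<And>k y. \<lbrakk>k \<le> n; y \<in> Y k\<rbrakk> \<Longrightarrow> near (\<pi> y) D (bd y)" by blast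
  then have "near (\<pi> y) (max 0 D) (bd y)" if "k \<le> n" "y \<in> Y k" for k y
    by (rule bounded_by_mono) (use that in auto)
  then show ?thesis by (intro that[of "max 0 D"]) auto
qed

text \<open>The chain is moved by a group element that brings \<open>p\<close> within
  \<open>D0\<close> of \<open>b\<close>, filled there and moved back; both passages cost
  \<open>D0\<close>.\<close>

lemma essentially_acyclic_all_points:
  assumes ess: "\<And>R. \<exists>R'. \<forall>k\<le>n. \<forall>w\<in>C k. near b R (d w) \<longrightarrow> (\<exists>t\<in>C (Suc k). near b R' (w + d t))"
    and coc: "\<And>p. \<exists>g\<in>carrier G. dist p (\<rho> g b) \<le> D0"
  obtains R' where "\<And>p k w. \<lbrakk>k \<le> n; w \<in> C k; near p R (d w)\<rbrakk> \<Longrightarrow> \<exists>t\<in>C (Suc k). near p R' (w + d t)"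
proof -
  obtain R' where R': "\<And>k w. \<lbrakk>k \<le> n; w \<in> C k; near b (R + D0) (d w)\<rbrakk> \<Longrightarrow> \<exists>t\<in>C (Suc k). near b R' (w + d t)"
    using ess by blast
  have "\<exists>t\<in>C (Suc k). near p (R' + D0) (w + d t)" if k: "k \<le> n" and w: "w \<in> C k" and nd: "near p R (d w)" for p k w
  proof -
    obtain g where g: "g \<in> carrier G" "dist p (\<rho> g b) \<le> D0" using coc by blast
    have gi: "inv g \<in> carrier G" using g by simp
    have dC: "d w \<in> C (k - 1)" using w d_closed d_zero by (cases k) auto
    have "near (\<rho> (inv g) p) R (d (translate act (inv g) w))"
      unfolding d_translate[OF gi w] by (rule near_translate[OF nd dC gi])
    moreover have "dist b (\<rho> (inv g) p) \<le> D0"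
      using \<rho>_dist[OF g(1), of b "\<rho> (inv g) p"] g by (simp add: \<rho>_inv dist_commute)
    ultimately have "near b (R + D0) (d (translate act (inv g) w))" by (rule near_shift) simp
    then obtain t where t: "t \<in> C (Suc k)" "near b R' (translate act (inv g) w + d t)"
      using R'[OF k translate_closed[OF gi w]] by blast
    have "near (\<rho> g b) R' (translate act g (translate act (inv g) w + d t))"
      by (rule near_translate[OF t(2), of k])
        (use t g gi w translate_closed d_closed in auto)
    also have "translate act g (translate act (inv g) w + d t) = w + d (translate act g t)"
      by (simp add: translate_inv[OF g(1) w] d_translate[OF g(1) t(1)])
    finally have "near p (R' + D0) (w + d (translate act g t))"
      by (rule near_shift[OF _ g(2)]) simp
    then show ?thesis using translate_closed[OF g(1) t(1)] by blast
  qed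
  then show ?thesis using that by blast
qed

text \<open>A chain map \<open>id + d \<sigma> + \<sigma> d\<close> that follows the retraction of \<open>M\<close> to a ball is built degree by
  degree. It is the identity on basis elements in the ball, with thresholds decreasing in the degree
  so that this is compatible with the boundary.\<close>

lemma ball_acyclic:
  assumes CAT0: "CAT0 TYPE('m)"
    and ess: "\<And>R. \<exists>R'. \<forall>p. \<forall>k\<le>n. \<forall>w\<in>C k. near p R (d w) \<longrightarrow> (\<exists>t\<in>C (Suc k). near p R' (w + d t))"
  obtains \<Lambda> where "\<Lambda> \<ge> 0" "\<And>q r k w. \<lbrakk>r \<ge> 0; k \<le> n; w \<in> C k; near q r (d w)\<rbrakk> \<Longrightarrow>
    \<exists>t\<in>C (Suc k). near q (r + \<Lambda>) (w + d t)"
proof -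
  define is_ret where "is_ret q r f \<longleftrightarrow> (\<forall>x y. dist (f x) (f y) \<le> dist x y) \<and> (\<forall>x. dist q (f x) \<le> r) \<and>
    (\<forall>x. dist x (f x) = max 0 (dist q x - r))" for q :: 'm and r :: real and f
  define ret where "ret q r = (SOME f. is_ret q r f)" for q r
  have ex: "\<exists>f. is_ret q r f" if "r \<ge> 0" for q r
    by (rule CAT0_ball_retraction[OF CAT0 that, of q]) (auto simp: is_ret_def)
  have "is_ret q r (ret q r)" if "r \<ge> 0" for q r
    unfolding ret_def by (rule someI_ex[OF ex[OF that]])
  then have ret: "dist (ret q r x) (ret q r y) \<le> dist x y" "dist q (ret q r x) \<le> r"
      "dist x (ret q r x) = max 0 (dist q x - r)" if "r \<ge> 0" for q r x y
    using that unfolding is_ret_def by blast+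
  obtain D where D: "D \<ge> 0" "\<And>k y. \<lbrakk>k \<le> n; y \<in> Y k\<rbrakk> \<Longrightarrow> near (\<pi> y) D (bd y)"
    using bd_displacement by blast
  \<comment> \<open>The step \<open>D\<close> between consecutive degrees is the displacement of the
    boundary. As \<theta> is nonnegative, basis elements in the ball itself are fixed, and those
    fixed outside it are moved by the retraction by at most \<open>real n * D\<close>.\<close>
  define \<theta> where "\<theta> k = real (n - k) * D" for k
  have \<theta>: "0 \<le> \<theta> k" "k \<le> n \<Longrightarrow> \<theta> k \<le> real n * D" "Suc k \<le> n \<Longrightarrow> \<theta> k = \<theta> (Suc k) + D" for k
    using D(1) by (auto simp: \<theta>_def mult_right_mono of_nat_diff algebra_simps)
  define \<phi> where "\<phi> \<sigma> y = frag_of y + d (\<sigma> y) + frag_extend \<sigma> (bd y)" for \<sigma> y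
  have \<phi>_ext: "frag_extend (\<phi> \<sigma>) c = c + d (frag_extend \<sigma> c) + frag_extend \<sigma> (d c)" for \<sigma> c
    by (simp add: \<phi>_def[abs_def] frag_extend_fn_add frag_extend_frag_extend)
  \<comment> \<open>The bound \<open>N\<close> is chosen before the centre and the radius. This is
    what makes the additive constant of the conclusion independent of the radius.\<close>
  have "\<exists>N\<ge>0. \<forall>q r. r \<ge> 0 \<longrightarrow> (\<exists>\<sigma>. \<forall>k<m. \<forall>y\<in>Y k. \<sigma> y \<in> C (Suc k) \<and>
      (dist q (\<pi> y) \<le> r + \<theta> k \<longrightarrow> \<sigma> y = 0) \<and> near (ret q r (\<pi> y)) N (\<phi> \<sigma> y))" if "m \<le> Suc n" for m
    using that
  proof (induction m)
    case 0
    show ?case by (intro exI[of _ 0]) auto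
  next
    case (Suc m)
    then obtain N where N: "N \<ge> 0" "\<And>q r. r \<ge> 0 \<Longrightarrow> (\<exists>\<sigma>. \<forall>k<m. \<forall>y\<in>Y k. \<sigma> y \<in> C (Suc k) \<and>
      (dist q (\<pi> y) \<le> r + \<theta> k \<longrightarrow> \<sigma> y = 0) \<and> near (ret q r (\<pi> y)) N (\<phi> \<sigma> y))" by auto
    have mn: "m \<le> n" using Suc.prems by simp
    obtain R' where R': "\<And>p w. \<lbrakk>w \<in> C m; near p (N + D) (d w)\<rbrakk> \<Longrightarrow> \<exists>t\<in>C (Suc m). near p R' (w + d t)"
      using ess[of "N + D"] mn by blast
    \<comment> \<open>The three entries serve the lower degrees, the basis elements that are fixed,
      and the new fillings.\<close>
    define N' where "N' = Max {N, real n * D, R'}"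
    have N': "N \<le> N'" "real n * D \<le> N'" "R' \<le> N'" by (auto simp: N'_def)
    have "\<exists>\<sigma>. \<forall>k<Suc m. \<forall>y\<in>Y k. \<sigma> y \<in> C (Suc k) \<and>
      (dist q (\<pi> y) \<le> r + \<theta> k \<longrightarrow> \<sigma> y = 0) \<and> near (ret q r (\<pi> y)) N' (\<phi> \<sigma> y)" if r: "r \<ge> 0" for q r
    proof -
      obtain \<sigma> where \<sigma>: "\<And>k y. \<lbrakk>k < m; y \<in> Y k\<rbrakk> \<Longrightarrow> \<sigma> y \<in> C (Suc k)"
        "\<And>k y. \<lbrakk>k < m; y \<in> Y k; dist q (\<pi> y) \<le> r + \<theta> k\<rbrakk> \<Longrightarrow> \<sigma> y = 0"
        "\<And>k y. \<lbrakk>k < m; y \<in> Y k\<rbrakk> \<Longrightarrow> near (ret q r (\<pi> y)) N (\<phi> \<sigma> y)"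
        using N(2)[OF r, of q] by (elim exE) auto
      have "\<exists>t\<in>C (Suc m). (dist q (\<pi> y) \<le> r + \<theta> m \<longrightarrow> t = 0) \<and>
         near (ret q r (\<pi> y)) N' (frag_of y + d t + frag_extend \<sigma> (bd y))" if y: "y \<in> Y m" for y
      proof (cases "dist q (\<pi> y) \<le> r + \<theta> m")
        case True
        have "frag_extend \<sigma> (bd y) = 0"
        proof (cases m)
          case 0
          then show ?thesis using y by (simp add: bd_zero)
        next
          case (Suc j)
          show ?thesis
          proof (rule frag_extend_eq_0)
            fix y' assume y': "y' \<in> keys (bd y)"
            then have "dist (\<pi> y) (\<pi> y') \<le> D" using D(2)[OF mn y] by (auto simp: bounded_by_def)
            then have "dist q (\<pi> y') \<le> r + \<theta> j"
              using True dist_triangle[of q "\<pi> y'" "\<pi> y"] \<theta>(3)[of j] Suc mn by auto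
            moreover have "y' \<in> Y j" using y y' Suc bd_closed by (auto simp: chains_def)
            ultimately show "\<sigma> y' = 0" using \<sigma>(2)[of j] Suc by auto
          qed
        qed
        moreover have "dist (ret q r (\<pi> y)) (\<pi> y) \<le> N'"
          using ret(3)[OF r, of "\<pi> y" q] True \<theta>(1)[of m] \<theta>(2)[OF mn] N'(2) by (simp add: dist_commute)
        ultimately show ?thesis by (intro bexI[of _ 0]) auto
      next
        case False
        \<comment> \<open>The boundary of \<open>w\<close> is \<phi> applied to \<open>bd y\<close>.
          It lies within \<open>N + D\<close> of the retracted point of \<open>y\<close>, since the
          retraction does not increase the distance, at most \<open>D\<close>, between
          \<open>y\<close> and its boundary. So the hypothesis provides a filling at bounded
          cost.\<close>
        define w where "w = frag_of y + frag_extend \<sigma> (bd y)"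
        have w: "w \<in> C m"
        proof (cases m)
          case 0
          then show ?thesis using y by (simp add: w_def bd_zero)
        next
          case (Suc j)
          then have b: "bd y \<in> C j" using y bd_closed by blast
          have "frag_extend \<sigma> (bd y) \<in> C m" unfolding Suc
            by (rule chains_frag_extend[OF b]) (use \<sigma>(1)[of j] Suc in auto)
          then show ?thesis using y by (auto simp: w_def intro: chains_add)
        qed
        have "d w = frag_extend (\<phi> \<sigma>) (bd y)"
          using bd_bd[OF y] by (simp add: \<phi>_ext w_def frag_extend_add)
        moreover have "near (ret q r (\<pi> y)) (N + D) (frag_extend (\<phi> \<sigma>) (bd y))"
        proof (rule bounded_by_frag_extend)
          fix y' assume y': "y' \<in> keys (bd y)"
          then have dd: "dist (\<pi> y) (\<pi> y') \<le> D" using D(2)[OF mn y] by (auto simp: bounded_by_def)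
          obtain j where j: "m = Suc j" using y y' by (cases m) (auto simp: bd_zero)
          then have "y' \<in> Y j" using y y' bd_closed by (auto simp: chains_def)
          then have "near (ret q r (\<pi> y')) N (\<phi> \<sigma> y')" using \<sigma>(3)[of j] j by auto
          then show "near (ret q r (\<pi> y)) (N + D) (\<phi> \<sigma> y')"
            by (rule near_shift[where \<delta> = D]) (use ret(1)[OF r, of q "\<pi> y" "\<pi> y'"] dd in auto)
        qed
        ultimately obtain t where t: "t \<in> C (Suc m)" "near (ret q r (\<pi> y)) R' (w + d t)"
          using R'[OF w] by metis
        have "near (ret q r (\<pi> y)) N' (frag_of y + d t + frag_extend \<sigma> (bd y))"
          using bounded_by_mono[OF t(2) N'(3)] by (simp add: w_def add_ac)
        then show ?thesis using False t(1) by blast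
      qed
      then have "\<forall>y\<in>Y m. \<exists>t. t \<in> C (Suc m) \<and> (dist q (\<pi> y) \<le> r + \<theta> m \<longrightarrow> t = 0) \<and>
         near (ret q r (\<pi> y)) N' (frag_of y + d t + frag_extend \<sigma> (bd y))" by blast
      from bchoice[OF this] obtain \<tau> where \<tau>: "\<And>y. y \<in> Y m \<Longrightarrow> \<tau> y \<in> C (Suc m)"
        "\<And>y. \<lbrakk>y \<in> Y m; dist q (\<pi> y) \<le> r + \<theta> m\<rbrakk> \<Longrightarrow> \<tau> y = 0"
        "\<And>y. y \<in> Y m \<Longrightarrow> near (ret q r (\<pi> y)) N' (frag_of y + d (\<tau> y) + frag_extend \<sigma> (bd y))"
        by auto
      define \<sigma>' where "\<sigma>' y = (if y \<in> Y m then \<tau> y else \<sigma> y)" for y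
      have low: "\<sigma>' y = \<sigma> y" if "y \<in> Y j" "j < m" for y j
        using degree_unique[of y j m] that by (auto simp: \<sigma>'_def)
      have ext: "frag_extend \<sigma>' (bd y) = frag_extend \<sigma> (bd y)" if "y \<in> Y k" "k \<le> m" for y k
      proof (cases k)
        case (Suc j)
        show ?thesis by (rule frag_extend_eq_on_chains[OF bd_closed[of y j]]) (use that Suc low in auto)
      qed (use that in \<open>simp add: bd_zero\<close>)
      have top: "\<sigma>' y = \<tau> y" if "y \<in> Y m" for y using that by (simp add: \<sigma>'_def)
      show ?thesis
      proof (intro exI[of _ \<sigma>'] allI impI ballI)
        fix k y assume k: "k < Suc m" and y: "y \<in> Y k"
        show "\<sigma>' y \<in> C (Suc k) \<and> (dist q (\<pi> y) \<le> r + \<theta> k \<longrightarrow> \<sigma>' y = 0) \<and> near (ret q r (\<pi> y)) N' (\<phi> \<sigma>' y)"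
        proof (cases "k = m")
          case True
          then show ?thesis using \<tau> y top ext[OF y] by (simp add: \<phi>_def)
        next
          case False
          then have "k < m" using k by simp
          then show ?thesis using \<sigma>[of k y] y low ext[OF y] bounded_by_mono[OF _ N'(1)]
            by (auto simp: \<phi>_def)
        qed
      qed
    qed
    then show ?case using N(1) N'(1) by (intro exI[of _ N']) auto
  qed
  from this[of "Suc n"] obtain N where N: "N \<ge> 0" "\<And>q r. r \<ge> 0 \<Longrightarrow> (\<exists>\<sigma>. \<forall>k<Suc n. \<forall>y\<in>Y k. \<sigma> y \<in> C (Suc k) \<and>
      (dist q (\<pi> y) \<le> r + \<theta> k \<longrightarrow> \<sigma> y = 0) \<and> near (ret q r (\<pi> y)) N (\<phi> \<sigma> y))" by auto
  have "\<exists>t\<in>C (Suc k). near q (r + N) (w + d t)"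
    if r: "r \<ge> 0" and k: "k \<le> n" and w: "w \<in> C k" and dw: "near q r (d w)" for q r k w
  proof -
    obtain \<sigma> where \<sigma>: "\<And>k y. \<lbrakk>k \<le> n; y \<in> Y k\<rbrakk> \<Longrightarrow> \<sigma> y \<in> C (Suc k)"
        "\<And>k y. \<lbrakk>k \<le> n; y \<in> Y k; dist q (\<pi> y) \<le> r + \<theta> k\<rbrakk> \<Longrightarrow> \<sigma> y = 0"
        "\<And>k y. \<lbrakk>k \<le> n; y \<in> Y k\<rbrakk> \<Longrightarrow> near (ret q r (\<pi> y)) N (\<phi> \<sigma> y)"
      using N(2)[OF r, of q] by (elim exE) (auto simp: less_Suc_eq_le)
    \<comment> \<open>As \<open>d w\<close> lies in the ball, \<sigma> vanishes on it and \<phi>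
      changes \<open>w\<close> by a boundary only. On the other hand \<phi> carries everything to
      within \<open>N\<close> of the ball.\<close>
    have "frag_extend \<sigma> (d w) = 0"
    proof (cases k)
      case (Suc j)
      then have dj: "d w \<in> C j" using w d_closed by blast
      show ?thesis
      proof (rule frag_extend_eq_0)
        fix y assume y: "y \<in> keys (d w)"
        then have "dist q (\<pi> y) \<le> r + \<theta> j" using dw \<theta>(1)[of j] by (auto simp: bounded_by_def intro: order_trans)
        then show "\<sigma> y = 0" using \<sigma>(2)[of j y] dj y Suc k by (auto simp: chains_def)
      qed
    qed (use w d_zero in simp)
    then have eq: "w + d (frag_extend \<sigma> w) = frag_extend (\<phi> \<sigma>) w" by (simp add: \<phi>_ext)
    have "near q (r + N) (frag_extend (\<phi> \<sigma>) w)"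
    proof (rule bounded_by_frag_extend)
      fix y assume "y \<in> keys w"
      then have "y \<in> Y k" using w by (auto simp: chains_def)
      then show "near q (r + N) (\<phi> \<sigma> y)"
        by (intro near_shift[OF \<sigma>(3)[OF k]]) (use ret(2)[OF r] in auto)
    qed
    moreover have "frag_extend \<sigma> w \<in> C (Suc k)" by (rule chains_frag_extend[OF w]) (rule \<sigma>(1)[OF k])
    ultimately show ?thesis using eq by metis
  qed
  then show ?thesis using that N(1) by blast
qed

text \<open>The finite support of \<open>d w\<close> lies in the ball of radius
  \<open>T - (s - 1)\<close> around \<gamma> T for large \<open>T\<close>; the 1 makes room for the
  convergence to the Busemann function. The filling lies in that ball enlarged by \<Lambda>, which
  is contained in a horoball because \<open>T - dist x (\<gamma> T)\<close> never exceeds the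
  Busemann function.\<close>

lemma ray_acyclic:
  assumes \<Lambda>: "\<Lambda> \<ge> 0" "\<And>q r k w. \<lbrakk>r \<ge> 0; k \<le> n; w \<in> C k; near q r (d w)\<rbrakk> \<Longrightarrow>
    \<exists>t\<in>C (Suc k). near q (r + \<Lambda>) (w + d t)"
    and \<gamma>: "geodesic_ray \<gamma>" and k: "k \<le> n" and w: "w \<in> C k"
    and dw: "\<And>y. y \<in> keys (d w) \<Longrightarrow> s \<le> busemann \<gamma> (\<pi> y)"
  obtains t where "t \<in> C (Suc k)" "\<And>y. y \<in> keys (w + d t) \<Longrightarrow> s - (\<Lambda> + 1) \<le> busemann \<gamma> (\<pi> y)"
proof -
  have "\<forall>\<^sub>F T in at_top. \<forall>y\<in>keys (d w). s - 1 < T - dist (\<pi> y) (\<gamma> T)"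
  proof (rule eventually_ball_finite)
    show "\<forall>y\<in>keys (d w). \<forall>\<^sub>F T in at_top. s - 1 < T - dist (\<pi> y) (\<gamma> T)"
    proof
      fix y assume "y \<in> keys (d w)"
      then have "s - 1 < busemann \<gamma> (\<pi> y)" using dw[of y] by simp
      then show "\<forall>\<^sub>F T in at_top. s - 1 < T - dist (\<pi> y) (\<gamma> T)"
        by (rule order_tendstoD(1)[OF busemann_tendsto(1)[OF \<gamma>]])
    qed
  qed simp
  moreover have "\<forall>\<^sub>F T in at_top. max 0 (s - 1) \<le> (T::real)" by (rule eventually_ge_at_top)
  ultimately have "\<forall>\<^sub>F T in at_top. (\<forall>y\<in>keys (d w). s - 1 < T - dist (\<pi> y) (\<gamma> T)) \<and> max 0 (s - 1) \<le> T"
    by (rule eventually_conj)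
  then obtain T where T: "\<And>y. y \<in> keys (d w) \<Longrightarrow> s - 1 < T - dist (\<pi> y) (\<gamma> T)" "0 \<le> T" "s - 1 \<le> T"
    by (auto dest!: eventually_happens)
  have "near (\<gamma> T) (T - s + 1) (d w)" unfolding bounded_by_def
  proof
    fix y assume "y \<in> keys (d w)"
    from T(1)[OF this] show "dist (\<gamma> T) (\<pi> y) \<le> T - s + 1" by (simp add: dist_commute)
  qed
  then obtain t where t: "t \<in> C (Suc k)" "near (\<gamma> T) (T - s + 1 + \<Lambda>) (w + d t)"
    using \<Lambda>(2)[of "T - s + 1" k w] T k w by auto
  have "s - (\<Lambda> + 1) \<le> busemann \<gamma> (\<pi> y)" if "y \<in> keys (w + d t)" for y
  proof -
    have "dist (\<gamma> T) (\<pi> y) \<le> T - s + 1 + \<Lambda>" using t(2) that by (simp add: bounded_by_def)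
    then show ?thesis using busemann_tendsto(2)[OF \<gamma> T(2), of "\<pi> y"] by (simp add: dist_commute)
  qed
  then show ?thesis using that t(1) by blast
qed

end

section \<open>Pushing towards a point\<close>

text \<open>\<open>\<sigma> q\<close> is a homotopy from the identity to a chain map \<open>\<phi> q\<close> that moves everything
  far from the point \<open>q\<close> closer to \<open>q\<close>.\<close>

locale push_system = controlled_complex G act Y bd \<rho> \<pi> n
  for G :: "('g, 'z) monoid_scheme" (structure) and act :: "'g \<Rightarrow> 'y \<Rightarrow> 'y" and Y bd
    and \<rho> :: "'g \<Rightarrow> 'm::metric_space \<Rightarrow> 'm" and \<pi> n +
  fixes \<sigma> :: "'m \<Rightarrow> 'y \<Rightarrow> 'y \<Rightarrow>\<^sub>0 int" and m :: nat and r :: real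
  assumes m_le: "m \<le> Suc n"
    and \<sigma>_closed: "\<lbrakk>k < m; y \<in> Y k\<rbrakk> \<Longrightarrow> \<sigma> q y \<in> chains Y (Suc k)"
    and \<sigma>_finite: "\<lbrakk>k < m; y \<in> Y k\<rbrakk> \<Longrightarrow> finite (range (\<lambda>q. \<sigma> q y))"
    and \<sigma>_act: "\<lbrakk>k < m; y \<in> Y k; g \<in> carrier G\<rbrakk> \<Longrightarrow> \<sigma> (\<rho> g q) (act g y) = translate act g (\<sigma> q y)"
    and \<sigma>_push: "\<lbrakk>k < m; y \<in> Y k; r \<le> dist q (\<pi> y)\<rbrakk> \<Longrightarrow>
      bounded_by (\<lambda>y. dist q (\<pi> y)) (dist q (\<pi> y) - 1)
        (frag_of y + frag_extend bd (\<sigma> q y) + frag_extend (\<sigma> q) (bd y))"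
begin

definition \<phi> where "\<phi> q y = frag_of y + d (\<sigma> q y) + frag_extend (\<sigma> q) (bd y)"

definition iter where "iter j q c = (frag_extend (\<phi> q) ^^ j) c"

definition homotopy where "homotopy j q c = (\<Sum>i<j. frag_extend (\<sigma> q) (iter i q c))"

lemma \<phi>_ext: "frag_extend (\<phi> q) c = c + d (frag_extend (\<sigma> q) c) + frag_extend (\<sigma> q) (d c)"
  by (simp add: \<phi>_def[abs_def] frag_extend_fn_add frag_extend_frag_extend)

lemma iter_simps [simp]: "iter 0 q c = c" "iter (Suc j) q c = frag_extend (\<phi> q) (iter j q c)"
  by (simp_all add: iter_def)

lemma homotopy_simps [simp]: "homotopy 0 q c = 0"
  "homotopy (Suc j) q c = homotopy j q c + frag_extend (\<sigma> q) (iter j q c)"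
  by (simp_all add: homotopy_def)

lemma iter_0 [simp]: "iter j q 0 = 0"
  by (induction j) auto

lemma homotopy_0 [simp]: "homotopy j q 0 = 0"
  by (induction j) auto

lemma iter_ext: "frag_extend (\<lambda>y. iter j q (frag_of y)) c = iter j q c"
  by (induction j) (simp_all flip: frag_extend_frag_extend)

lemma homotopy_ext: "frag_extend (\<lambda>y. homotopy j q (frag_of y)) c = homotopy j q c"
proof (induction j)
  case 0
  show ?case by (simp add: frag_extend_eq_0)
next
  case (Suc j)
  have "frag_extend (\<lambda>y. frag_extend (\<sigma> q) (iter j q (frag_of y))) c = frag_extend (\<sigma> q) (iter j q c)"
    by (simp add: iter_ext flip: frag_extend_frag_extend)
  then show ?case using Suc by (simp add: frag_extend_fn_add)
qed

lemma \<sigma>_ext_closed: "\<lbrakk>k < m; c \<in> C k\<rbrakk> \<Longrightarrow> frag_extend (\<sigma> q) c \<in> C (Suc k)"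
  by (erule chains_frag_extend) (rule \<sigma>_closed)

lemma d_chain: "c \<in> C k \<Longrightarrow> d c = 0 \<or> (\<exists>j. k = Suc j \<and> d c \<in> C j)"
  using d_closed d_zero by (cases k) auto

lemma d_chain_less:
  assumes "c \<in> C k" "k \<le> m"
  shows "d c = 0 \<or> (\<exists>j<m. d c \<in> C j)"
  using d_chain[OF assms(1)] assms(2) Suc_le_lessD by blast

lemma \<sigma>_d_closed: "\<lbrakk>k \<le> m; c \<in> C k\<rbrakk> \<Longrightarrow> frag_extend (\<sigma> q) (d c) \<in> C k"
  using d_chain[of c k] \<sigma>_ext_closed by auto

lemma \<phi>_ext_closed: "\<lbrakk>k < m; c \<in> C k\<rbrakk> \<Longrightarrow> frag_extend (\<phi> q) c \<in> C k"
  unfolding \<phi>_ext by (intro chains_add d_closed \<sigma>_ext_closed \<sigma>_d_closed) auto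

lemma d_\<phi>_ext: "\<lbrakk>k < m; c \<in> C k\<rbrakk> \<Longrightarrow> d (frag_extend (\<phi> q) c) = frag_extend (\<phi> q) (d c)"
  using d_d[OF \<sigma>_ext_closed, of k c q] d_d[of c k] by (simp add: \<phi>_ext frag_extend_add)

lemma iter_closed: "\<lbrakk>k < m; c \<in> C k\<rbrakk> \<Longrightarrow> iter j q c \<in> C k"
  by (induction j) (auto intro: \<phi>_ext_closed)

lemma homotopy_closed: "\<lbrakk>k < m; c \<in> C k\<rbrakk> \<Longrightarrow> homotopy j q c \<in> C (Suc k)"
  by (induction j) (auto intro: \<sigma>_ext_closed iter_closed chains_add)

lemma d_iter: "\<lbrakk>k < m; c \<in> C k\<rbrakk> \<Longrightarrow> d (iter j q c) = iter j q (d c)"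
  by (induction j) (auto simp: d_\<phi>_ext[OF _ iter_closed])

text \<open>Telescoping: since the iterates commute with \<open>d\<close>, the terms \<sigma> (d
  (iter i q c)) add up to \<open>homotopy j q (d c)\<close>.\<close>

lemma iter_homotopy: "\<lbrakk>k < m; c \<in> C k\<rbrakk> \<Longrightarrow> iter j q c = c + d (homotopy j q c) + homotopy j q (d c)"
proof (induction j)
  case (Suc j)
  then have IH: "iter j q c = c + d (homotopy j q c) + homotopy j q (d c)" by blast
  have "iter (Suc j) q c = iter j q c + d (frag_extend (\<sigma> q) (iter j q c)) + frag_extend (\<sigma> q) (d (iter j q c))"
    by (simp add: \<phi>_ext)
  also have "d (iter j q c) = iter j q (d c)" using d_iter Suc.prems .
  finally show ?case using IH by (simp add: frag_extend_add algebra_simps)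
qed simp

text \<open>In degree \<open>m\<close> the homotopy is still to be constructed. The chain
  \<open>frag_of y + homotopy j q (bd y)\<close> is what has to be improved there: its boundary is
  the boundary of \<open>y\<close> after \<open>j\<close> pushes.\<close>

lemma iter_bd:
  assumes "y \<in> Y m"
  shows "d (frag_of y + homotopy j q (bd y)) = iter j q (bd y)" "homotopy j q (bd y) \<in> C m"
proof -
  have "d (frag_of y + homotopy j q (bd y)) = iter j q (bd y) \<and> homotopy j q (bd y) \<in> C m"
  proof (cases m)
    case 0
    then show ?thesis using assms by (simp add: bd_zero)
  next
    case (Suc k)
    then have b: "bd y \<in> C k" using assms bd_closed by blast
    then show ?thesis using iter_homotopy[OF _ b, of j q] homotopy_closed[OF _ b] bd_bd[OF assms] Suc
      by (simp add: frag_extend_add)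
  qed
  then show "d (frag_of y + homotopy j q (bd y)) = iter j q (bd y)" "homotopy j q (bd y) \<in> C m" by auto
qed

lemma finite_range_diff:
  fixes f h :: "'x \<Rightarrow> 'w::minus"
  assumes "finite (range f)" "finite (range h)"
  shows "finite (range (\<lambda>x. f x - h x))"
proof (rule finite_subset)
  show "range (\<lambda>x. f x - h x) \<subseteq> (\<lambda>(a, b). a - b) ` (range f \<times> range h)" by auto
qed (use assms in simp)

lemma finite_range_add:
  fixes f h :: "'x \<Rightarrow> 'w::plus"
  assumes "finite (range f)" "finite (range h)"
  shows "finite (range (\<lambda>x. f x + h x))"
proof (rule finite_subset)
  show "range (\<lambda>x. f x + h x) \<subseteq> (\<lambda>(a, b). a + b) ` (range f \<times> range h)" by auto
qed (use assms in simp)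

text \<open>Although \<open>q\<close> ranges over all of \<open>M\<close>, the homotopy at a given
  chain takes finitely many values. This passes to \<phi>, to its iterates and to the iterated
  homotopies. It yields uniform displacement bounds and the finite sets of points on which Busemann
  functions are approximated.\<close>

lemma finite_range_\<sigma>_ext:
  assumes k: "k < m" and c: "c \<in> C k"
  shows "finite (range (\<lambda>q. frag_extend (\<sigma> q) c))"
proof -
  have "keys c \<subseteq> Y k" using c by (simp add: chains_def)
  then show ?thesis
    by (induction c rule: frag_induction)
      (auto simp: frag_extend_diff intro: \<sigma>_finite[OF k] finite_range_diff)
qed

lemma finite_range_\<phi>_ext:
  assumes k: "k < m" and c: "c \<in> C k"
  shows "finite (range (\<lambda>q. frag_extend (\<phi> q) c))"
proof -
  have 1: "finite (range (\<lambda>q. d (frag_extend (\<sigma> q) c)))"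
    using finite_imageI[OF finite_range_\<sigma>_ext[OF k c], of d] by (simp add: image_image)
  have 2: "finite (range (\<lambda>q. frag_extend (\<sigma> q) (d c)))"
    using d_chain_less[OF c] finite_range_\<sigma>_ext k by auto
  show ?thesis unfolding \<phi>_ext by (intro finite_range_add 1 2) simp
qed

lemma finite_range_iter:
  assumes k: "k < m" and c: "c \<in> C k"
  shows "finite (range (\<lambda>q. iter j q c))"
proof (induction j)
  case (Suc j)
  have "range (\<lambda>q. iter (Suc j) q c) \<subseteq> (\<Union>x\<in>range (\<lambda>q. iter j q c). range (\<lambda>q. frag_extend (\<phi> q) x))"
    by auto
  moreover have "finite \<dots>"
    using Suc iter_closed[OF k c] by (intro finite_UN_I) (auto intro: finite_range_\<phi>_ext[OF k])
  ultimately show ?case by (rule finite_subset)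
qed simp

lemma finite_range_homotopy:
  assumes k: "k < m" and c: "c \<in> C k"
  shows "finite (range (\<lambda>q. homotopy j q c))"
proof (induction j)
  case (Suc j)
  have "range (\<lambda>q. frag_extend (\<sigma> q) (iter j q c)) \<subseteq>
    (\<Union>x\<in>range (\<lambda>q. iter j q c). range (\<lambda>q. frag_extend (\<sigma> q) x))" by auto
  moreover have "finite \<dots>"
    using finite_range_iter[OF k c, of j] iter_closed[OF k c]
    by (intro finite_UN_I) (auto intro: finite_range_\<sigma>_ext[OF k])
  ultimately have "finite (range (\<lambda>q. frag_extend (\<sigma> q) (iter j q c)))" by (rule finite_subset)
  then show ?case using Suc by (auto intro: finite_range_add)
qed simp

lemma \<sigma>_ext_act:
  assumes k: "k < m" and c: "c \<in> C k" and g: "g \<in> carrier G"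
  shows "frag_extend (\<sigma> (\<rho> g q)) (translate act g c) = translate act g (frag_extend (\<sigma> q) c)"
proof -
  have "frag_extend (\<sigma> (\<rho> g q)) (translate act g c) = frag_extend (\<lambda>y. \<sigma> (\<rho> g q) (act g y)) c"
    by (simp add: translate_def frag_extend_frag_extend)
  also have "\<dots> = frag_extend (\<lambda>y. translate act g (\<sigma> q y)) c"
    by (rule frag_extend_eq_on_chains[OF c]) (rule \<sigma>_act[OF k _ g])
  also have "\<dots> = translate act g (frag_extend (\<sigma> q) c)"
    by (simp add: translate_def frag_extend_frag_extend)
  finally show ?thesis .
qed

lemma \<phi>_ext_act:
  assumes k: "k < m" and c: "c \<in> C k" and g: "g \<in> carrier G"
  shows "frag_extend (\<phi> (\<rho> g q)) (translate act g c) = translate act g (frag_extend (\<phi> q) c)"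
proof -
  have "frag_extend (\<sigma> (\<rho> g q)) (translate act g (d c)) = translate act g (frag_extend (\<sigma> q) (d c))"
    using d_chain_less[OF c] \<sigma>_ext_act[OF _ _ g] k by auto
  then show ?thesis
    using \<sigma>_ext_act[OF k c g] d_translate[OF g c] d_translate[OF g \<sigma>_ext_closed[OF k c]]
    by (simp add: \<phi>_ext)
qed

lemma iter_act:
  assumes k: "k < m" and c: "c \<in> C k" and g: "g \<in> carrier G"
  shows "iter j (\<rho> g q) (translate act g c) = translate act g (iter j q c)"
  by (induction j) (simp_all add: \<phi>_ext_act[OF k iter_closed[OF k c] g])

lemma homotopy_act:
  assumes k: "k < m" and c: "c \<in> C k" and g: "g \<in> carrier G"
  shows "homotopy j (\<rho> g q) (translate act g c) = translate act g (homotopy j q c)"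
  by (induction j) (simp_all add: iter_act[OF k c g] \<sigma>_ext_act[OF k iter_closed[OF k c] g])

text \<open>The values at \<open>act g y\<close>, over all \<open>q\<close>, are the translates of
  the values at \<open>y\<close>: replace \<open>q\<close> by its image under the inverse of
  \<open>g\<close>. Hence \<open>finite_family_displacement\<close> applies to the families over all
  \<open>q\<close>.\<close>

lemma displacement:
  obtains B where "B \<ge> 0" "\<And>k y q. \<lbrakk>k < m; y \<in> Y k\<rbrakk> \<Longrightarrow> near (\<pi> y) B (\<phi> q y)"
    "\<And>k y q. \<lbrakk>k < m; y \<in> Y k\<rbrakk> \<Longrightarrow> near (\<pi> y) B (\<sigma> q y)"
proof -
  have "\<exists>B. \<forall>k\<le>n. k < m \<longrightarrow> (\<forall>y\<in>Y k. \<forall>q. near (\<pi> y) B (\<phi> q y) \<and> near (\<pi> y) B (\<sigma> q y))"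
  proof (rule uniform_bound)
    fix k assume k: "k \<le> n"
    show "\<exists>B. k < m \<longrightarrow> (\<forall>y\<in>Y k. \<forall>q. near (\<pi> y) B (\<phi> q y) \<and> near (\<pi> y) B (\<sigma> q y))"
    proof (cases "k < m")
      case True
      have \<phi>1: "\<phi> q y = frag_extend (\<phi> q) (frag_of y)" for q y by simp
      have "\<exists>D. \<forall>y\<in>Y k. \<forall>c\<in>range (\<lambda>q. \<sigma> q y). near (\<pi> y) D c"
      proof (rule finite_family_displacement[OF k])
        show "range (\<lambda>q. \<sigma> q (act g y)) \<subseteq> translate act g ` range (\<lambda>q. \<sigma> q y)"
          if g: "g \<in> carrier G" and y: "y \<in> Y k" for g y
        proof
          fix c assume "c \<in> range (\<lambda>q. \<sigma> q (act g y))"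
          then obtain q where "c = \<sigma> q (act g y)" by blast
          then have "c = translate act g (\<sigma> (\<rho> (inv g) q) y)"
            using \<sigma>_act[OF True y g, of "\<rho> (inv g) q"] g by (simp add: \<rho>_inv)
          then show "c \<in> translate act g ` range (\<lambda>q. \<sigma> q y)" by blast
        qed
      qed (use \<sigma>_finite[OF True] \<sigma>_closed[OF True] in auto)
      then obtain D1 where D1: "\<And>y q. y \<in> Y k \<Longrightarrow> near (\<pi> y) D1 (\<sigma> q y)" by blast
      have "\<exists>D. \<forall>y\<in>Y k. \<forall>c\<in>range (\<lambda>q. \<phi> q y). near (\<pi> y) D c"
      proof (rule finite_family_displacement[OF k])
        show "range (\<lambda>q. \<phi> q (act g y)) \<subseteq> translate act g ` range (\<lambda>q. \<phi> q y)"
          if g: "g \<in> carrier G" and y: "y \<in> Y k" for g y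
        proof
          fix c assume "c \<in> range (\<lambda>q. \<phi> q (act g y))"
          then obtain q where "c = \<phi> q (act g y)" by blast
          then have "c = translate act g (\<phi> (\<rho> (inv g) q) y)"
            using \<phi>_ext_act[OF True _ g, of "frag_of y" "\<rho> (inv g) q"] g y by (simp add: \<rho>_inv)
          then show "c \<in> translate act g ` range (\<lambda>q. \<phi> q y)" by blast
        qed
        show "finite (range (\<lambda>q. \<phi> q y))" if "y \<in> Y k" for y
          using finite_range_\<phi>_ext[OF True, of "frag_of y"] that by simp
        show "range (\<lambda>q. \<phi> q y) \<subseteq> C k" if "y \<in> Y k" for y
          using \<phi>_ext_closed[OF True, of "frag_of y"] that by auto
      qed
      then obtain D2 where D2: "\<And>y q. y \<in> Y k \<Longrightarrow> near (\<pi> y) D2 (\<phi> q y)" by blast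
      show ?thesis
        by (rule exI[of _ "max D1 D2"]) (auto intro: bounded_by_mono[OF D1] bounded_by_mono[OF D2])
    qed auto
  next
    fix k R R' assume a: "k < m \<longrightarrow> (\<forall>y\<in>Y k. \<forall>q. near (\<pi> y) R (\<phi> q y) \<and> near (\<pi> y) R (\<sigma> q y))"
      and RR: "R \<le> (R' :: real)"
    show "k < m \<longrightarrow> (\<forall>y\<in>Y k. \<forall>q. near (\<pi> y) R' (\<phi> q y) \<and> near (\<pi> y) R' (\<sigma> q y))"
      using a bounded_by_mono[OF _ RR] by auto
  qed
  then obtain B where B: "\<And>k y q. \<lbrakk>k \<le> n; k < m; y \<in> Y k\<rbrakk> \<Longrightarrow> near (\<pi> y) B (\<phi> q y) \<and> near (\<pi> y) B (\<sigma> q y)"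
    by blast
  show ?thesis
  proof (rule that[of "max 0 B"])
    show "near (\<pi> y) (max 0 B) (\<phi> q y)" if "k < m" "y \<in> Y k" for k y q
      by (rule bounded_by_mono[of _ B]) (use B[of k y q] that m_le in auto)
    show "near (\<pi> y) (max 0 B) (\<sigma> q y)" if "k < m" "y \<in> Y k" for k y q
      by (rule bounded_by_mono[of _ B]) (use B[of k y q] that m_le in auto)
  qed simp
qed

section \<open>How far iterated pushes travel\<close>

definition annular :: "'m \<Rightarrow> real \<Rightarrow> real \<Rightarrow> ('y \<Rightarrow>\<^sub>0 int) \<Rightarrow> bool" where
  "annular q a L c \<longleftrightarrow> (\<forall>y\<in>keys c. a \<le> dist q (\<pi> y) \<and> dist q (\<pi> y) \<le> L)"

text \<open>Each push lowers the distance to \<open>q\<close> by at least 1 and by at most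
  \<open>B\<close>. The inner radius is recorded because the push is known to be effective outside
  radius \<open>r\<close>, and \<open>a\<close> leaves room for \<open>j\<close> steps of length
  \<open>B\<close>.\<close>

lemma iter_annular:
  assumes B: "B \<ge> 0" "\<And>k y q. \<lbrakk>k < m; y \<in> Y k\<rbrakk> \<Longrightarrow> near (\<pi> y) B (\<phi> q y)"
    and k: "k < m" and c: "c \<in> C k" "annular q a L c" and a: "r + real j * B \<le> a"
  shows "annular q (a - real j * B) (L - real j) (iter j q c)"
  using a
proof (induction j)
  case 0
  then show ?case using c by simp
next
  case (Suc j)
  have jB: "real (Suc j) * B = real j * B + B" by (simp add: algebra_simps)
  have IH: "annular q (a - real j * B) (L - real j) (iter j q c)"
    using Suc B(1) jB by auto
  show ?case unfolding annular_def
  proof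
    fix y' assume "y' \<in> keys (iter (Suc j) q c)"
    then obtain y where y: "y \<in> keys (iter j q c)" "y' \<in> keys (\<phi> q y)"
      by (auto elim: keys_frag_extend_D)
    have yk: "y \<in> Y k" using iter_closed[OF k c(1)] y by (auto simp: chains_def)
    have b: "a - real j * B \<le> dist q (\<pi> y)" "dist q (\<pi> y) \<le> L - real j"
      using IH y by (auto simp: annular_def)
    have "dist (\<pi> y) (\<pi> y') \<le> B" using B(2)[OF k yk] y by (auto simp: bounded_by_def)
    moreover have "dist q (\<pi> y') \<le> dist q (\<pi> y) - 1"
    proof -
      have "r \<le> dist q (\<pi> y)" using b Suc.prems jB B(1) by auto
      from \<sigma>_push[OF k yk this] show ?thesis using y unfolding \<phi>_def[symmetric] by (simp add: bounded_by_def)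
    qed
    ultimately show "a - real (Suc j) * B \<le> dist q (\<pi> y') \<and> dist q (\<pi> y') \<le> L - real (Suc j)"
      using b dist_triangle[of q "\<pi> y" "\<pi> y'"] jB by (auto simp: dist_commute)
  qed
qed

text \<open>What lies inside radius \<open>r\<close> may move outwards, but not beyond
  \<open>r + B\<close>; everything else moves inwards by at least 1.\<close>

lemma iter_near:
  assumes B: "B \<ge> 0" "\<And>k y q. \<lbrakk>k < m; y \<in> Y k\<rbrakk> \<Longrightarrow> near (\<pi> y) B (\<phi> q y)"
    and k: "k < m" and c: "c \<in> C k" "near q L c"
  shows "near q (max (L - real j) (r + B)) (iter j q c)"
proof (induction j)
  case 0
  show ?case using c by (auto intro: bounded_by_mono)
next
  case (Suc j)
  show ?case unfolding bounded_by_def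
  proof
    fix y' assume "y' \<in> keys (iter (Suc j) q c)"
    then obtain y where y: "y \<in> keys (iter j q c)" "y' \<in> keys (\<phi> q y)"
      by (auto elim: keys_frag_extend_D)
    have yk: "y \<in> Y k" using iter_closed[OF k c(1)] y by (auto simp: chains_def)
    have b: "dist q (\<pi> y) \<le> max (L - real j) (r + B)" using Suc y by (auto simp: bounded_by_def)
    have dB: "dist (\<pi> y) (\<pi> y') \<le> B" using B(2)[OF k yk] y by (auto simp: bounded_by_def)
    show "dist q (\<pi> y') \<le> max (L - real (Suc j)) (r + B)"
    proof (cases "r \<le> dist q (\<pi> y)")
      case True
      have "dist q (\<pi> y') \<le> dist q (\<pi> y) - 1"
        using \<sigma>_push[OF k yk True] y unfolding \<phi>_def[symmetric] by (simp add: bounded_by_def)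
      then show ?thesis using b by auto
    next
      case False
      then show ?thesis using dB dist_triangle[of q "\<pi> y'" "\<pi> y"] by auto
    qed
  qed
qed

text \<open>The bound is independent of the number of iterations, because no iterate leaves the ball
  of radius \<open>max L (r + B)\<close>.\<close>

lemma homotopy_near:
  assumes B: "B \<ge> 0" "\<And>k y q. \<lbrakk>k < m; y \<in> Y k\<rbrakk> \<Longrightarrow> near (\<pi> y) B (\<phi> q y)"
    "\<And>k y q. \<lbrakk>k < m; y \<in> Y k\<rbrakk> \<Longrightarrow> near (\<pi> y) B (\<sigma> q y)"
    and k: "k < m" and c: "c \<in> C k" "near q L c"
  shows "near q (max L (r + B) + B) (homotopy j q c)"
proof (induction j)
  case (Suc j)
  have "near q (max L (r + B)) (iter j q c)"
    by (rule bounded_by_mono[OF iter_near[OF B(1,2) k c]]) auto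
  then have "near q (max L (r + B) + B) (frag_extend (\<sigma> q) (iter j q c))"
    using iter_closed[OF k c(1), of j q]
    by (intro bounded_by_frag_extend near_shift[OF B(3)[OF k]]) (auto simp: chains_def bounded_by_def)
  then show ?case using Suc by (simp add: bounded_by_add)
qed simp

text \<open>With \<open>t = homotopy j q w\<close> the chain \<open>w + d t\<close> equals
  \<open>iter j q w - homotopy j q (d w)\<close>. The number \<open>j\<close> depends on the size of
  \<open>w\<close>, but the bounds do not: the iterate ends up within \<open>r + B\<close>, and the
  homotopy of \<open>d w\<close> is controlled by \<open>R\<close>.\<close>

lemma essentially_acyclic_if_push:
  assumes "m = Suc n"
  shows "\<exists>R'. \<forall>k\<le>n. \<forall>w\<in>C k. near q R (d w) \<longrightarrow> (\<exists>t\<in>C (Suc k). near q R' (w + d t))"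
proof -
  obtain B where B: "B \<ge> 0" "\<And>k y q. \<lbrakk>k < m; y \<in> Y k\<rbrakk> \<Longrightarrow> near (\<pi> y) B (\<phi> q y)"
    "\<And>k y q. \<lbrakk>k < m; y \<in> Y k\<rbrakk> \<Longrightarrow> near (\<pi> y) B (\<sigma> q y)" by (rule displacement) blast
  have "\<exists>t\<in>C (Suc k). near q (max R (r + B) + B) (w + d t)"
    if k: "k \<le> n" and w: "w \<in> C k" and dw: "near q R (d w)" for k w
  proof -
    have km: "k < m" using k assms by simp
    obtain L where L: "near q L w" using bounded_by_ex by blast
    obtain j :: nat where j: "L - (r + B) \<le> real j" using real_arch_simple by blast
    have 1: "near q (max R (r + B) + B) (iter j q w)"
      by (rule bounded_by_mono[OF iter_near[OF B(1,2) km w L]]) (use j B(1) in auto)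
    have 2: "near q (max R (r + B) + B) (homotopy j q (d w))"
      using d_chain[OF w]
    proof
      assume "\<exists>i. k = Suc i \<and> d w \<in> C i"
      then obtain i where i: "k = Suc i" "d w \<in> C i" by blast
      then show ?thesis using homotopy_near[OF B _ i(2) dw] km by simp
    qed simp
    have "w + d (homotopy j q w) = iter j q w - homotopy j q (d w)"
      using iter_homotopy[OF km w, of j q] by simp
    then show ?thesis using 1 2 homotopy_closed[OF km w]
      by (intro bexI[of _ "homotopy j q w"]) (auto intro: bounded_by_diff)
  qed
  then show ?thesis by blast
qed

text \<open>Let \<open>e\<close> be a ray that approximates the direction from \<open>y\<close> to
  \<open>q\<close>. After \<open>N e\<close> pushes the boundary of \<open>y\<close> is so much
  closer to \<open>q\<close> than \<open>y\<close> that it lies in the horoball where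
  \<open>ca\<close> provides a filling along \<open>e\<close>. Finitely many rays and, by the
  finiteness of ranges, finitely many chains occur, hence finitely many fillings. The conclusion
  holds for all large \<open>K\<close>, because pushes beyond \<open>N e\<close> add only terms that
  are already close to \<open>q\<close>; so one \<open>K\<close> can serve all orbit
  representatives.\<close>

lemma push_towards_far_points:
  assumes CAT0: "CAT0 TYPE('m)" and P: "proper_space TYPE('m)" and mn: "m \<le> n" and y: "y \<in> Y m"
    and ca: "\<And>\<gamma> t. geodesic_ray \<gamma> \<Longrightarrow> \<exists>s. \<forall>w\<in>C m. (\<forall>y\<in>keys (d w). s \<le> busemann \<gamma> (\<pi> y)) \<longrightarrow>
      (\<exists>\<tau>\<in>C (Suc m). \<forall>y\<in>keys (w + d \<tau>). t \<le> busemann \<gamma> (\<pi> y))"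
  shows "\<exists>K0. \<forall>K\<ge>K0. \<exists>R \<Lambda>. finite \<Lambda> \<and> \<Lambda> \<subseteq> C (Suc m) \<and> (\<forall>q. R \<le> dist q (\<pi> y) \<longrightarrow>
    (\<exists>\<tau>\<in>\<Lambda>. near q (dist q (\<pi> y) - 1) (frag_of y + homotopy K q (bd y) + d \<tau>)))"
proof -
  obtain B where B: "B \<ge> 0" "\<And>k y q. \<lbrakk>k < m; y \<in> Y k\<rbrakk> \<Longrightarrow> near (\<pi> y) B (\<phi> q y)"
    "\<And>k y q. \<lbrakk>k < m; y \<in> Y k\<rbrakk> \<Longrightarrow> near (\<pi> y) B (\<sigma> q y)" by (rule displacement) blast
  obtain D where D: "D \<ge> 0" "\<And>k y. \<lbrakk>k \<le> n; y \<in> Y k\<rbrakk> \<Longrightarrow> near (\<pi> y) D (bd y)"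
    using bd_displacement by blast
  define p where "p = \<pi> y"
  define W where "W K q = frag_of y + homotopy K q (bd y)" for K q
  have WC: "W K q \<in> C m" for K q using iter_bd(2)[OF y] y by (auto simp: W_def)
  have dW: "d (W K q) = iter K q (bd y)" for K q using iter_bd(1)[OF y] by (simp add: W_def)
  have "bd y = 0 \<or> (\<exists>j<m. bd y \<in> C j)" using d_chain_less[of "frag_of y" m] y by simp
  then have finW: "finite (range (W K))" for K
    unfolding W_def using finite_range_homotopy by (auto intro!: finite_range_add)
  have bdD: "dist p (\<pi> y') \<le> D" if "y' \<in> keys (bd y)" for y'
    using D(2)[OF mn y] that by (auto simp: bounded_by_def p_def)
  have iterD: "annular q 0 (dist q p + D - real j) (iter j q (bd y))"
    if far: "r + real j * B + D \<le> dist q p" and j: "bd y \<noteq> 0" for q j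
  proof -
    obtain i where i: "i < m" "bd y \<in> C i" using \<open>bd y = 0 \<or> _\<close> j by blast
    have "annular q (dist q p - D) (dist q p + D) (bd y)"
      unfolding annular_def using bdD dist_triangle[of q _ p] dist_triangle[of q p] by (smt (verit) dist_commute)
    note bd_annular = this
    have "annular q (dist q p - D - real j * B) (dist q p + D - real j) (iter j q (bd y))"
      by (rule iter_annular[where a = "dist q p - D" and L = "dist q p + D" and B = B])
        (fact B(1) B(2) i bd_annular | use far in simp)+
    then show ?thesis by (auto simp: annular_def)
  qed
  \<comment> \<open>After \<open>j\<close> pushes the boundary is closer to \<open>q\<close> than
    \<open>p\<close> by at least \<open>real j - D\<close>, and \<sigma> moves it back by at most
    \<open>B\<close>.\<close>
  have sigma_near: "near q (dist q p - 1) (frag_extend (\<sigma> q) (iter j q (bd y)))"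
    if far: "r + real j * B + D \<le> dist q p" and j: "real j \<ge> D + B + 1" for q j
  proof (cases "bd y = 0")
    case False
    obtain i where i: "i < m" "bd y \<in> C i" using \<open>bd y = 0 \<or> _\<close> False by blast
    show ?thesis
    proof (rule bounded_by_frag_extend)
      fix y' assume y': "y' \<in> keys (iter j q (bd y))"
      then have "dist q (\<pi> y') \<le> dist q p + D - real j"
        using iterD[OF far False] by (auto simp: annular_def)
      moreover have "y' \<in> Y i" using iter_closed[OF i] y' by (auto simp: chains_def)
      then have "near (\<pi> y') B (\<sigma> q y')" by (rule B(3)[OF i(1)])
      ultimately show "near q (dist q p - 1) (\<sigma> q y')"
        using j by (elim near_shift[where \<delta> = "dist q (\<pi> y')"]) auto
    qed
  qed simp
  define good where "good e s w \<longleftrightarrow> (\<forall>y\<in>keys (d w). s \<le> busemann e (\<pi> y))" for e s w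
  \<comment> \<open>The value 2 is the gain 1 to be achieved plus the error 1 of
    \<open>far_points_busemann\<close>.\<close>
  have "\<exists>s. \<forall>w\<in>C m. good e s w \<longrightarrow> (\<exists>\<tau>\<in>C (Suc m). \<forall>y\<in>keys (w + d \<tau>). 2 \<le> busemann e (\<pi> y))"
    if "geodesic_ray e" for e unfolding good_def using ca[OF that] by blast
  then obtain S where S: "\<And>e w. \<lbrakk>geodesic_ray e; w \<in> C m; good e (S e) w\<rbrakk> \<Longrightarrow>
      \<exists>\<tau>\<in>C (Suc m). \<forall>y\<in>keys (w + d \<tau>). 2 \<le> busemann e (\<pi> y)" by metis
  define T where "T e w = (SOME \<tau>. \<tau> \<in> C (Suc m) \<and> (\<forall>y\<in>keys (w + d \<tau>). 2 \<le> busemann e (\<pi> y)))" for e w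
  have T: "T e w \<in> C (Suc m)" "\<And>y. y \<in> keys (w + d (T e w)) \<Longrightarrow> 2 \<le> busemann e (\<pi> y)"
    if "geodesic_ray e" "w \<in> C m" "good e (S e) w" for e w
  proof -
    have "\<exists>\<tau>. \<tau> \<in> C (Suc m) \<and> (\<forall>y\<in>keys (w + d \<tau>). 2 \<le> busemann e (\<pi> y))" using S[OF that] by blast
    from someI_ex[OF this] show "T e w \<in> C (Suc m)" "\<And>y. y \<in> keys (w + d (T e w)) \<Longrightarrow> 2 \<le> busemann e (\<pi> y)"
      unfolding T_def by blast+
  qed
  \<comment> \<open>\<open>N e\<close> pushes bring the boundary into the horoball at level
    \<open>S e\<close>: \<open>D\<close> is lost because the boundary is displaced from
    \<open>y\<close>, and 1 in the approximation of the Busemann function. The second entry is the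
    hypothesis of \<open>sigma_near\<close> on \<open>j\<close>.\<close>
  define N where "N e = nat \<lceil>max (S e + 1 + D) (D + B + 1)\<rceil>" for e
  have N: "S e + 1 + D \<le> real (N e)" "D + B + 1 \<le> real (N e)" for e
    unfolding N_def by linarith+
  \<comment> \<open>The points at which the Busemann function of \<open>e\<close> will be compared
    with the distance to \<open>q\<close>. The set is the union over all \<open>q\<close>, because
    the finite set of rays has to be found before \<open>q\<close> is given.\<close>
  define Z where "Z e = (\<Union>w\<in>range (W (N e)). \<pi> ` keys (d w) \<union> \<pi> ` keys (w + d (T e w)))" for e
  have finZ: "finite (Z e)" for e unfolding Z_def by (rule finite_UN_I[OF finW]) simp
  obtain E \<rho>0 where E: "finite E" "\<forall>e\<in>E. geodesic_ray e \<and> e 0 = p"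
    "\<forall>q. dist q p \<ge> \<rho>0 \<longrightarrow> (\<exists>e\<in>E. \<forall>x\<in>Z e. \<bar>dist q p - dist q x - busemann e x\<bar> < 1)"
    by (rule far_points_busemann[OF CAT0 P, where p = p and W = Z]) (rule finZ)
  define \<Lambda> where "\<Lambda> = (\<Union>e\<in>E. T e ` {w \<in> range (W (N e)). good e (S e) w})"
  have \<Lambda>: "finite \<Lambda>" "\<Lambda> \<subseteq> C (Suc m)" unfolding \<Lambda>_def using E(1,2) finW T(1) WC by (auto intro: finite_subset[OF _ finW])
  define K0 where "K0 = Max (insert 0 (N ` E))"
  have K0: "N e \<le> K0" if "e \<in> E" for e using that E(1) by (auto simp: K0_def)
  have "\<exists>\<tau>\<in>\<Lambda>. near q (dist q p - 1) (W K q + d \<tau>)"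
    if K: "K0 \<le> K" and q: "max \<rho>0 (r + real K * B + D) \<le> dist q p" for K q
  proof -
    obtain e where e: "e \<in> E" "\<And>x. x \<in> Z e \<Longrightarrow> \<bar>dist q p - dist q x - busemann e x\<bar> < 1"
      using E(3)[rule_format, of q] q by auto
    have ray: "geodesic_ray e" using E(2) e(1) by blast
    \<comment> \<open>The boundary stays outside radius \<open>r\<close> during all \<open>K\<close>
      pushes.\<close>
    have far: "r + real j * B + D \<le> dist q p" if "j \<le> K" for j
    proof -
      have "real j * B \<le> real K * B" using that B(1) by (intro mult_right_mono) auto
      then show ?thesis using q by auto
    qed
    have NK: "N e \<le> K" using K0[OF e(1)] K by simp
    define w where "w = W (N e) q"
    have g: "good e (S e) w"
      unfolding good_def
    proof
      fix y' assume y': "y' \<in> keys (d w)"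
      then have "bd y \<noteq> 0" by (auto simp: w_def dW)
      from iterD[OF far[OF NK] this] y' have "dist q (\<pi> y') \<le> dist q p + D - real (N e)"
        by (auto simp: annular_def w_def dW)
      moreover have "\<bar>dist q p - dist q (\<pi> y') - busemann e (\<pi> y')\<bar> < 1"
        by (rule e(2)) (use y' in \<open>auto simp: Z_def w_def\<close>)
      ultimately show "S e \<le> busemann e (\<pi> y')" using N(1)[of e] by linarith
    qed
    have wC: "w \<in> C m" by (simp add: w_def WC)
    have 1: "near q (dist q p - 1) (w + d (T e w))"
      unfolding bounded_by_def
    proof
      fix y' assume y': "y' \<in> keys (w + d (T e w))"
      have "\<bar>dist q p - dist q (\<pi> y') - busemann e (\<pi> y')\<bar> < 1"
        by (rule e(2)) (use y' in \<open>auto simp: Z_def w_def\<close>)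
      then show "dist q (\<pi> y') \<le> dist q p - 1" using T(2)[OF ray wC g y'] by linarith
    qed
    \<comment> \<open>Passage from \<open>N e\<close> to the common number \<open>K\<close> of
      pushes, with the same filling.\<close>
    have "near q (dist q p - 1) (W K' q + d (T e w))" if "N e \<le> K'" "K' \<le> K" for K'
      using that
    proof (induction K' rule: dec_induct)
      case base
      then show ?case using 1 by (simp add: w_def)
    next
      case (step i)
      have "real i \<ge> D + B + 1" using N(2)[of e] step by linarith
      then have "near q (dist q p - 1) (frag_extend (\<sigma> q) (iter i q (bd y)))"
        using sigma_near[OF far] step by simp
      moreover have "near q (dist q p - 1) (W i q + d (T e w))" using step by auto
      ultimately have "near q (dist q p - 1) ((W i q + d (T e w)) + frag_extend (\<sigma> q) (iter i q (bd y)))"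
        using bounded_by_add by blast
      then show ?case by (simp add: W_def add_ac)
    qed
    then have "near q (dist q p - 1) (W K q + d (T e w))" using NK by simp
    moreover have "T e w \<in> \<Lambda>" using e(1) g by (auto simp: \<Lambda>_def w_def)
    ultimately show ?thesis by blast
  qed
  then show ?thesis using \<Lambda> unfolding W_def p_def by blast
qed

text \<open>Below degree \<open>m\<close> the new homotopy is the \<open>K\<close>-fold one, in
  accordance with the pushed boundaries in degree \<open>m\<close>; in degree \<open>m\<close> its
  values are fillings. Equivariance is arranged twice: finite sets of fillings are chosen
  equivariantly in \<open>y\<close>, and a member of each equivariantly in the pair
  \<open>(q, y)\<close>. These sets keep the range over \<open>q\<close> finite.\<close>

lemma extend_push:
  assumes CAT0: "CAT0 TYPE('m)" and P: "proper_space TYPE('m)" and mn: "m \<le> n"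
    and ca: "\<And>\<gamma> t. geodesic_ray \<gamma> \<Longrightarrow> \<exists>s. \<forall>w\<in>C m. (\<forall>y\<in>keys (d w). s \<le> busemann \<gamma> (\<pi> y)) \<longrightarrow>
      (\<exists>\<tau>\<in>C (Suc m). \<forall>y\<in>keys (w + d \<tau>). t \<le> busemann \<gamma> (\<pi> y))"
  shows "\<exists>\<sigma>' r'. push_system G act Y bd \<rho> \<pi> n \<sigma>' (Suc m) r'"
proof -
  obtain B where B: "B \<ge> 0" "\<And>k y q. \<lbrakk>k < m; y \<in> Y k\<rbrakk> \<Longrightarrow> near (\<pi> y) B (\<phi> q y)"
    "\<And>k y q. \<lbrakk>k < m; y \<in> Y k\<rbrakk> \<Longrightarrow> near (\<pi> y) B (\<sigma> q y)" by (rule displacement) blast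
  obtain X where X: "finite X" "X \<subseteq> Y m" "\<forall>y\<in>Y m. \<exists>g\<in>carrier G. \<exists>x\<in>X. y = act g x"
    by (rule orbit_finiteE[OF orbit_finite_Y[OF mn]])
  define fills where "fills K R y \<Lambda> \<longleftrightarrow> finite \<Lambda> \<and> \<Lambda> \<subseteq> C (Suc m) \<and> (\<forall>q. R \<le> dist q (\<pi> y) \<longrightarrow>
    (\<exists>\<tau>\<in>\<Lambda>. near q (dist q (\<pi> y) - 1) (frag_of y + homotopy K q (bd y) + d \<tau>)))" for K R y \<Lambda>
  have "\<exists>K0. \<forall>K\<ge>K0. \<exists>R \<Lambda>. fills K R y \<Lambda>" if "y \<in> Y m" for y
    unfolding fills_def by (rule push_towards_far_points[OF CAT0 P mn that ca])
  then obtain K0 where K0: "\<And>y K. \<lbrakk>y \<in> Y m; K0 y \<le> K\<rbrakk> \<Longrightarrow> \<exists>R \<Lambda>. fills K R y \<Lambda>" by metis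
  \<comment> \<open>At least one push is made, so that the iterate in lower degrees still lowers
    distances by 1.\<close>
  define K where "K = Max (insert 1 (K0 ` X))"
  have K: "1 \<le> K" "\<And>x. x \<in> X \<Longrightarrow> K0 x \<le> K" using X(1) by (auto simp: K_def)
  have "\<exists>R \<Lambda>. fills K R x \<Lambda>" if "x \<in> X" for x using K0[of x K] K(2)[OF that] that X(2) by blast
  then obtain R0 where R0: "\<And>x. x \<in> X \<Longrightarrow> \<exists>\<Lambda>. fills K (R0 x) x \<Lambda>" by metis
  \<comment> \<open>At distance at least \<open>r + real K * B\<close> from \<open>q\<close>, all
    \<open>K\<close> pushes of a basis element of lower degree start outside radius
    \<open>r\<close>.\<close>
  define R where "R = Max (insert (r + real K * B) (R0 ` X))"
  have R: "r + real K * B \<le> R" "\<And>x. x \<in> X \<Longrightarrow> R0 x \<le> R" using X(1) by (auto simp: R_def)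
  have hom_act: "homotopy K (\<rho> g q) (bd (act g y)) = translate act g (homotopy K q (bd y))"
    if g: "g \<in> carrier G" and y: "y \<in> Y m" for g q y
  proof -
    have "bd y = 0 \<or> (\<exists>j<m. bd y \<in> C j)" using d_chain_less[of "frag_of y" m] y by simp
    then show ?thesis using homotopy_act[OF _ _ g] bd_act[OF g y] by auto
  qed
  have near_act: "near (\<rho> g q) (dist (\<rho> g q) (\<pi> (act g y)) - 1)
      (frag_of (act g y) + homotopy K (\<rho> g q) (bd (act g y)) + d (translate act g \<tau>))"
    if g: "g \<in> carrier G" and y: "y \<in> Y m" and \<tau>: "\<tau> \<in> C (Suc m)"
      and nr: "near q (dist q (\<pi> y) - 1) (frag_of y + homotopy K q (bd y) + d \<tau>)" for g q y \<tau>
  proof -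
    have "frag_of y + homotopy K q (bd y) + d \<tau> \<in> C m"
      using y iter_bd(2)[OF y] d_closed[OF \<tau>] by (intro chains_add) auto
    from near_translate[OF nr this g] show ?thesis
      using g y \<tau> by (simp add: hom_act \<pi>_act \<rho>_dist d_translate)
  qed
  have fills_act: "fills K R (act g y) (translate act g ` \<Lambda>)"
    if g: "g \<in> carrier G" and y: "y \<in> Y m" and f: "fills K R y \<Lambda>" for g y \<Lambda>
    unfolding fills_def
  proof (intro conjI allI impI)
    show "finite (translate act g ` \<Lambda>)" "translate act g ` \<Lambda> \<subseteq> C (Suc m)"
      using f g translate_closed by (auto simp: fills_def)
    fix q assume q: "R \<le> dist q (\<pi> (act g y))"
    define q' where "q' = \<rho> (inv g) q"
    have qq: "q = \<rho> g q'" using g by (simp add: q'_def \<rho>_inv)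
    have "R \<le> dist q' (\<pi> y)" using q g y by (simp add: qq \<pi>_act \<rho>_dist)
    then obtain \<tau> where \<tau>: "\<tau> \<in> \<Lambda>" "near q' (dist q' (\<pi> y) - 1) (frag_of y + homotopy K q' (bd y) + d \<tau>)"
      using f by (auto simp: fills_def)
    have "\<tau> \<in> C (Suc m)" using \<tau>(1) f by (auto simp: fills_def)
    from near_act[OF g y this \<tau>(2)] show "\<exists>\<tau>\<in>translate act g ` \<Lambda>. near q (dist q (\<pi> (act g y)) - 1)
        (frag_of (act g y) + homotopy K q (bd (act g y)) + d \<tau>)"
      using \<tau>(1) unfolding qq by blast
  qed
  have ex_fills: "\<exists>\<Lambda>. fills K R y \<Lambda>" if y: "y \<in> Y m" for y
  proof -
    obtain g x where gx: "g \<in> carrier G" "x \<in> X" "y = act g x" using X(3) y by blast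
    obtain \<Lambda> where "fills K (R0 x) x \<Lambda>" using R0[OF gx(2)] by blast
    then have "fills K R x \<Lambda>" using R(2)[OF gx(2)] unfolding fills_def by (meson order_trans)
    then show ?thesis using fills_act[OF gx(1)] gx X(2) by blast
  qed
  \<comment> \<open>The objects chosen here are whole sets of fillings, on which \<open>G\<close>
    acts by translating all members.\<close>
  obtain \<Lambda> where \<Lambda>: "\<And>y. y \<in> Y m \<Longrightarrow> fills K R y (\<Lambda> y)"
    "\<And>g y. \<lbrakk>g \<in> carrier G; y \<in> Y m\<rbrakk> \<Longrightarrow> \<Lambda> (act g y) = translate act g ` \<Lambda> y"
  proof (rule equivariant_choice[where S = "Y m" and a = act and b = "\<lambda>g. (`) (translate act g)" and Q = "fills K R"])
    show "translate act \<one> ` z = z" if "s \<in> Y m" "fills K R s z" for s z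
    proof -
      have "translate act \<one> c = c" if "c \<in> z" for c
        using \<open>fills K R s z\<close> that translate_one unfolding fills_def by blast
      then show ?thesis by simp
    qed
    show "translate act (g \<otimes> h) ` z = translate act g ` translate act h ` z"
      if "g \<in> carrier G" "h \<in> carrier G" "s \<in> Y m" "fills K R s z" for g h s z
    proof -
      have "translate act (g \<otimes> h) c = translate act g (translate act h c)" if "c \<in> z" for c
        using \<open>fills K R s z\<close> that translate_mult[OF \<open>g \<in> carrier G\<close> \<open>h \<in> carrier G\<close>] unfolding fills_def by blast
      then show ?thesis by (simp add: image_image)
    qed
  qed (use act_closed act_one act_mult act_free ex_fills fills_act in auto)
  \<comment> \<open>Inside radius \<open>R\<close> no push is demanded and 0 is an allowed value.
    The diagonal action on the pairs is free because the action on \<open>Y m\<close> is.\<close>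
  define Q where "Q s \<tau> \<longleftrightarrow> (case s of (q, y) \<Rightarrow> \<tau> \<in> C (Suc m) \<and> \<tau> \<in> insert 0 (\<Lambda> y) \<and>
    (R \<le> dist q (\<pi> y) \<longrightarrow> near q (dist q (\<pi> y) - 1) (frag_of y + homotopy K q (bd y) + d \<tau>)))"
    for s :: "'m \<times> 'y" and \<tau>
  obtain u where u: "\<And>s. s \<in> UNIV \<times> Y m \<Longrightarrow> Q s (u s)"
    "\<And>g s. \<lbrakk>g \<in> carrier G; s \<in> UNIV \<times> Y m\<rbrakk> \<Longrightarrow> u (\<rho> g (fst s), act g (snd s)) = translate act g (u s)"
  proof (rule equivariant_choice[where S = "UNIV \<times> Y m" and Q = Q
        and a = "\<lambda>g s. (\<rho> g (fst s), act g (snd s))" and b = "translate act"])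
    show "\<exists>z. Q s z" if s: "s \<in> UNIV \<times> Y m" for s
    proof -
      obtain q y where qy: "s = (q, y)" "y \<in> Y m" using s by auto
      show ?thesis
      proof (cases "R \<le> dist q (\<pi> y)")
        case True
        then obtain \<tau> where \<tau>: "\<tau> \<in> \<Lambda> y" "near q (dist q (\<pi> y) - 1) (frag_of y + homotopy K q (bd y) + d \<tau>)"
          using \<Lambda>(1)[OF qy(2)] unfolding fills_def by blast
        moreover have "\<tau> \<in> C (Suc m)" using \<tau>(1) \<Lambda>(1)[OF qy(2)] unfolding fills_def by blast
        ultimately show ?thesis unfolding qy(1) Q_def by (intro exI[of _ \<tau>]) simp
      next
        case False
        then show ?thesis unfolding qy(1) Q_def by (intro exI[of _ 0]) auto
      qed
    qed
    show "Q (\<rho> g (fst s), act g (snd s)) (translate act g z)"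
      if g: "g \<in> carrier G" and s: "s \<in> UNIV \<times> Y m" and Q: "Q s z" for g s z
    proof -
      obtain q y where qy: "s = (q, y)" "y \<in> Y m" using s by auto
      then have z: "z \<in> C (Suc m)" "z \<in> insert 0 (\<Lambda> y)"
        "R \<le> dist q (\<pi> y) \<Longrightarrow> near q (dist q (\<pi> y) - 1) (frag_of y + homotopy K q (bd y) + d z)"
        using Q by (auto simp: Q_def)
      have "dist (\<rho> g q) (\<pi> (act g y)) = dist q (\<pi> y)" using g qy(2) by (simp add: \<pi>_act \<rho>_dist)
      then show ?thesis
        using near_act[OF g qy(2) z(1), of q] z translate_closed[OF g z(1)] \<Lambda>(2)[OF g qy(2)]
        unfolding Q_def qy(1) by auto
    qed
  qed (auto simp: act_closed act_one act_mult \<rho>_one \<rho>_mult Q_def translate_one translate_mult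
      intro: act_free)
  have u': "u (q, y) \<in> C (Suc m)" "u (q, y) \<in> insert 0 (\<Lambda> y)"
      "R \<le> dist q (\<pi> y) \<Longrightarrow> near q (dist q (\<pi> y) - 1) (frag_of y + homotopy K q (bd y) + d (u (q, y)))"
      "g \<in> carrier G \<Longrightarrow> u (\<rho> g q, act g y) = translate act g (u (q, y))" if "y \<in> Y m" for q y g
    using u(1)[of "(q, y)"] u(2)[of g "(q, y)"] that by (auto simp: Q_def)
  define \<sigma>' where "\<sigma>' q y = (if y \<in> Y m then u (q, y) else homotopy K q (frag_of y))" for q y
  have top: "\<sigma>' q y = u (q, y)" if "y \<in> Y m" for q y using that by (simp add: \<sigma>'_def)
  have low: "\<sigma>' q y = homotopy K q (frag_of y)" if "y \<in> Y k" "k < m" for q y k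
    using degree_unique[of y k m] that by (auto simp: \<sigma>'_def)
  have ext: "frag_extend (\<sigma>' q) c = homotopy K q c" if c: "c \<in> C k" and k: "k < m" for q c k
  proof -
    have "frag_extend (\<sigma>' q) c = frag_extend (\<lambda>y. homotopy K q (frag_of y)) c"
      by (rule frag_extend_eq_on_chains[OF c]) (rule low[OF _ k])
    then show ?thesis by (simp add: homotopy_ext)
  qed
  have ext_bd: "frag_extend (\<sigma>' q) (bd y) = homotopy K q (bd y)" if "y \<in> Y k" "k \<le> m" for q y k
    using d_chain_less[of "frag_of y" k] that ext by auto
  have "push_system G act Y bd \<rho> \<pi> n \<sigma>' (Suc m) R"
  proof (intro push_system.intro push_system_axioms.intro)
    show "controlled_complex G act Y bd \<rho> \<pi> n" by (rule controlled_complex_axioms)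
    show "Suc m \<le> Suc n" using mn by simp
    show "\<sigma>' q y \<in> C (Suc k)" if "k < Suc m" "y \<in> Y k" for k y q
    proof (cases "k = m")
      case False
      then have "k < m" using that by simp
      then show ?thesis using low[of y k] homotopy_closed[of k "frag_of y"] that by simp
    qed (use that u'(1) top in simp)
    show "finite (range (\<lambda>q. \<sigma>' q y))" if "k < Suc m" "y \<in> Y k" for k y
    proof (cases "k = m")
      case True
      then have y: "y \<in> Y m" using that by simp
      have "range (\<lambda>q. \<sigma>' q y) \<subseteq> insert 0 (\<Lambda> y)" using u'(2)[OF y] top[OF y] by auto
      moreover have "finite (insert 0 (\<Lambda> y))" using \<Lambda>(1)[OF y] by (simp add: fills_def)
      ultimately show ?thesis by (rule finite_subset)
    next
      case False
      then have "k < m" using that by simp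
      then show ?thesis using low[of y k] finite_range_homotopy[of k "frag_of y"] that by simp
    qed
    show "\<sigma>' (\<rho> g q) (act g y) = translate act g (\<sigma>' q y)"
      if "k < Suc m" "y \<in> Y k" "g \<in> carrier G" for k y g q
    proof (cases "k = m")
      case True
      then have y: "y \<in> Y m" using that by simp
      then show ?thesis using u'(4)[OF y that(3)] top[OF y] top[OF act_closed[OF that(3) y]] by simp
    next
      case False
      then have k: "k < m" using that by simp
      show ?thesis
        using low[OF that(2) k] low[OF act_closed[OF that(3,2)] k]
          homotopy_act[OF k _ that(3), of "frag_of y"] that by simp
    qed
    show "near q (dist q (\<pi> y) - 1) (frag_of y + d (\<sigma>' q y) + frag_extend (\<sigma>' q) (bd y))"
      if "k < Suc m" "y \<in> Y k" "R \<le> dist q (\<pi> y)" for k y q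
    proof (cases "k = m")
      case True
      then have y: "y \<in> Y m" using that by simp
      show ?thesis using u'(3)[OF y that(3)] top[OF y] ext_bd[OF y] by (simp add: add_ac)
    next
      case False
      then have k: "k < m" using that by simp
      have "frag_of y + d (\<sigma>' q y) + frag_extend (\<sigma>' q) (bd y) = iter K q (frag_of y)"
        using iter_homotopy[OF k, of "frag_of y" K q] low[OF that(2) k] ext_bd[OF that(2)] k that by simp
      moreover have "annular q (dist q (\<pi> y) - real K * B) (dist q (\<pi> y) - real K) (iter K q (frag_of y))"
        by (rule iter_annular[OF B(1,2) k]) (use that R(1) in \<open>auto simp: annular_def\<close>)
      ultimately show ?thesis using K(1) by (auto simp: annular_def bounded_by_def)
    qed
  qed
  then show ?thesis by blast
qed

end

context controlled_complex
begin

text \<open>The hypothesis asks for no uniformity over the rays; each extension step extracts it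
  from the compactness of the space of rays.\<close>

theorem essentially_acyclic_if_rays_acyclic:
  assumes CAT0: "CAT0 TYPE('m)" and P: "proper_space TYPE('m)"
    and ca: "\<And>m \<gamma> t. \<lbrakk>m \<le> n; geodesic_ray \<gamma>\<rbrakk> \<Longrightarrow> \<exists>s. \<forall>w\<in>C m. (\<forall>y\<in>keys (d w). s \<le> busemann \<gamma> (\<pi> y)) \<longrightarrow>
      (\<exists>\<tau>\<in>C (Suc m). \<forall>y\<in>keys (w + d \<tau>). t \<le> busemann \<gamma> (\<pi> y))"
  shows "\<exists>R'. \<forall>k\<le>n. \<forall>w\<in>C k. near q R (d w) \<longrightarrow> (\<exists>t\<in>C (Suc k). near q R' (w + d t))"
proof -
  have "\<exists>\<sigma> r. push_system G act Y bd \<rho> \<pi> n \<sigma> m r" if "m \<le> Suc n" for m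
    using that
  proof (induction m)
    case 0
    \<comment> \<open>No degree lies below 0, so the zero homotopy starts the induction.\<close>
    have "push_system G act Y bd \<rho> \<pi> n (\<lambda>_ _. 0) 0 0" by unfold_locales auto
    then show ?case by blast
  next
    case (Suc m)
    then obtain \<sigma> r where "push_system G act Y bd \<rho> \<pi> n \<sigma> m r" by auto
    then interpret push_system G act Y bd \<rho> \<pi> n \<sigma> m r .
    show ?case by (rule extend_push[OF CAT0 P]) (use Suc.prems ca in auto)
  qed
  then obtain \<sigma> r where "push_system G act Y bd \<rho> \<pi> n \<sigma> (Suc n) r" by blast
  then interpret push_system G act Y bd \<rho> \<pi> n \<sigma> "Suc n" r .
  show ?thesis by (rule essentially_acyclic_if_push) simp
qed

end

section \<open>Coordinates on based modules and resolutions\<close>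

text \<open>Additive maps from the chains supported in \<open>T\<close> to a module. They are
  determined by their values on \<open>T\<close>, which is how identities between module expressions
  are reduced to basis elements.\<close>

definition frag_additive :: "('r, 'f) module \<Rightarrow> 'y set \<Rightarrow> (('y \<Rightarrow>\<^sub>0 int) \<Rightarrow> 'f) \<Rightarrow> bool" where
  "frag_additive M T \<Phi> \<longleftrightarrow> (\<forall>a. keys a \<subseteq> T \<longrightarrow> \<Phi> a \<in> carrier M) \<and>
    (\<forall>a b. keys a \<subseteq> T \<longrightarrow> keys b \<subseteq> T \<longrightarrow> \<Phi> (a + b) = \<Phi> a \<oplus>\<^bsub>M\<^esub> \<Phi> b)"

lemma frag_additiveD:
  assumes "frag_additive M T \<Phi>" "keys a \<subseteq> T"
  shows "\<Phi> a \<in> carrier M" "keys b \<subseteq> T \<Longrightarrow> \<Phi> (a + b) = \<Phi> a \<oplus>\<^bsub>M\<^esub> \<Phi> b"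
  using assms by (auto simp: frag_additive_def)

lemma keys_add_subset: "\<lbrakk>keys a \<subseteq> T; keys b \<subseteq> T\<rbrakk> \<Longrightarrow> keys (a + b) \<subseteq> T"
  using Poly_Mapping.keys_add[of a b] by blast

lemma keys_diff_subset: "\<lbrakk>keys a \<subseteq> T; keys b \<subseteq> T\<rbrakk> \<Longrightarrow> keys (a - b) \<subseteq> T" for a :: "'a \<Rightarrow>\<^sub>0 int"
  using Poly_Mapping.keys_diff[of a b] by blast

context
  fixes M :: "('r, 'f) module" (structure)
  assumes M: "abelian_group M"
begin

interpretation abelian_group M by (rule M)

lemma frag_additive_0: assumes "frag_additive M T \<Phi>" shows "\<Phi> 0 = \<zero>"
proof -
  have c: "\<Phi> 0 \<in> carrier M" and "\<Phi> (0 + 0) = \<Phi> 0 \<oplus> \<Phi> 0" using frag_additiveD(1)[OF assms, of 0] frag_additiveD(2)[OF assms, of 0 0] by auto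
  then have eq: "\<Phi> 0 \<oplus> \<Phi> 0 = \<Phi> 0" by simp
  have "\<Phi> 0 = (\<Phi> 0 \<oplus> \<Phi> 0) \<oplus> \<ominus> \<Phi> 0" using c by (simp add: a_assoc r_neg)
  then show ?thesis using c eq by (simp add: r_neg)
qed

lemma frag_additive_diff:
  assumes \<Phi>: "frag_additive M T \<Phi>" and k: "keys a \<subseteq> T" "keys b \<subseteq> T"
  shows "\<Phi> (a - b) = \<Phi> a \<ominus> \<Phi> b"
proof -
  have kd: "keys (a - b) \<subseteq> T" using keys_diff_subset k .
  have "\<Phi> a = \<Phi> ((a - b) + b)" by simp
  also have "\<dots> = \<Phi> (a - b) \<oplus> \<Phi> b" using frag_additiveD(2)[OF \<Phi> kd k(2)] .
  finally show ?thesis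
    using frag_additiveD(1)[OF \<Phi>] k kd by (simp add: minus_eq a_assoc r_neg)
qed

lemma frag_additive_eq:
  assumes \<Phi>: "frag_additive M T \<Phi>" and \<Psi>: "frag_additive M T \<Psi>"
    and eq: "\<And>y. y \<in> T \<Longrightarrow> \<Phi> (frag_of y) = \<Psi> (frag_of y)" and c: "keys c \<subseteq> T"
  shows "\<Phi> c = \<Psi> c"
proof -
  have "keys c \<subseteq> T \<and> \<Phi> c = \<Psi> c"
    using c
  proof (induction c rule: frag_induction)
    case zero
    show ?case by (simp add: frag_additive_0[OF \<Phi>] frag_additive_0[OF \<Psi>])
  next
    case (diff a b)
    then show ?case using frag_additive_diff[OF \<Phi>, of a b] frag_additive_diff[OF \<Psi>, of a b]
        keys_diff_subset by metis
  qed (use eq in auto)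
  then show ?thesis by blast
qed

lemma frag_additive_finsum:
  assumes "finite S" "\<And>x. x \<in> S \<Longrightarrow> frag_additive M T (\<Phi> x)"
  shows "frag_additive M T (\<lambda>c. \<Oplus>x\<in>S. \<Phi> x c)"
  unfolding frag_additive_def
proof (intro conjI allI impI)
  fix a :: "_ \<Rightarrow>\<^sub>0 int" assume a: "keys a \<subseteq> T"
  have ca: "\<Phi> x a \<in> carrier M" if "x \<in> S" for x using frag_additiveD(1)[OF assms(2)[OF that] a] .
  then show "(\<Oplus>x\<in>S. \<Phi> x a) \<in> carrier M" by (intro finsum_closed) auto
  fix b :: "_ \<Rightarrow>\<^sub>0 int" assume b: "keys b \<subseteq> T"
  have cb: "\<Phi> x b \<in> carrier M" if "x \<in> S" for x using frag_additiveD(1)[OF assms(2)[OF that] b] .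
  have "(\<Oplus>x\<in>S. \<Phi> x (a + b)) = (\<Oplus>x\<in>S. \<Phi> x a \<oplus> \<Phi> x b)"
    using ca cb by (intro finsum_cong') (auto simp: frag_additiveD(2)[OF assms(2) a b])
  also have "\<dots> = (\<Oplus>x\<in>S. \<Phi> x a) \<oplus> (\<Oplus>x\<in>S. \<Phi> x b)"
    using ca cb by (intro finsum_addf) auto
  finally show "(\<Oplus>x\<in>S. \<Phi> x (a + b)) = (\<Oplus>x\<in>S. \<Phi> x a) \<oplus> (\<Oplus>x\<in>S. \<Phi> x b)" .
qed

lemma frag_additive_sum:
  assumes \<Phi>: "frag_additive M T \<Phi>" and S: "finite S" "\<And>x. x \<in> S \<Longrightarrow> keys (w x) \<subseteq> T"
  shows "\<Phi> (\<Sum>x\<in>S. w x) = (\<Oplus>x\<in>S. \<Phi> (w x)) \<and> keys (\<Sum>x\<in>S. w x) \<subseteq> T"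
  using S
proof (induction S rule: finite_induct)
  case empty
  show ?case by (simp add: frag_additive_0[OF \<Phi>])
next
  case (insert x S)
  then have "\<Phi> (w x + (\<Sum>x\<in>S. w x)) = \<Phi> (w x) \<oplus> (\<Oplus>x\<in>S. \<Phi> (w x))"
    using frag_additiveD(2)[OF \<Phi>] by auto
  moreover have "(\<Oplus>x\<in>insert x S. \<Phi> (w x)) = \<Phi> (w x) \<oplus> (\<Oplus>x\<in>S. \<Phi> (w x))"
    using insert frag_additiveD(1)[OF \<Phi>] by (intro finsum_insert) auto
  ultimately show ?case using insert keys_add_subset[of "w x" T "\<Sum>x\<in>S. w x"] by simp
qed

end

lemma frag_additive_frag_extend:
  assumes "frag_additive M T \<Phi>" "\<And>y. y \<in> T' \<Longrightarrow> keys (v y) \<subseteq> T"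
  shows "frag_additive M T' (\<lambda>c. \<Phi> (frag_extend v c))"
proof -
  have "keys (frag_extend v a) \<subseteq> T" if "keys a \<subseteq> T'" for a
    using keys_frag_extend[of v a] assms(2) that by blast
  then show ?thesis using assms(1) by (auto simp: frag_additive_def frag_extend_add)
qed

lemma frag_additive_hom:
  assumes "frag_additive M T \<Phi>" and f: "f \<in> carrier M \<rightarrow> carrier N"
    "\<And>x y. \<lbrakk>x \<in> carrier M; y \<in> carrier M\<rbrakk> \<Longrightarrow> f (x \<oplus>\<^bsub>M\<^esub> y) = f x \<oplus>\<^bsub>N\<^esub> f y"
  shows "frag_additive N T (\<lambda>c. f (\<Phi> c))"
  using assms by (auto simp: frag_additive_def)

lemma frag_additive_subset: "\<lbrakk>frag_additive M T \<Phi>; T' \<subseteq> T\<rbrakk> \<Longrightarrow> frag_additive M T' \<Phi>"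
  unfolding frag_additive_def by blast

text \<open>The \<int>-linear extension of \<open>u\<close>; for the identity map it is literally
  the sum in the definition of \<open>supp\<close>.\<close>

definition lin_ext :: "('r, 'f) module \<Rightarrow> ('y \<Rightarrow> 'f) \<Rightarrow> ('y \<Rightarrow>\<^sub>0 int) \<Rightarrow> 'f" where
  "lin_ext M u c = (\<Oplus>\<^bsub>M\<^esub>y\<in>keys c. [Poly_Mapping.lookup c y] \<cdot>\<^bsub>M\<^esub> u y)"

context
  fixes M :: "('r, 'f) module" (structure)
  assumes M: "abelian_group M"
begin

interpretation abelian_group M by (rule M)

lemma lin_ext_superset:
  assumes "u \<in> T \<rightarrow> carrier M" "finite S" "keys c \<subseteq> S" "S \<subseteq> T"
  shows "lin_ext M u c = (\<Oplus>y\<in>S. [Poly_Mapping.lookup c y] \<cdot> u y)"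
  unfolding lin_ext_def
proof (rule add.finprod_mono_neutral_cong_left)
  show "[Poly_Mapping.lookup c y] \<cdot> u y = \<zero>" if "y \<in> S - keys c" for y
  proof -
    have "Poly_Mapping.lookup c y = 0" using that by (simp add: in_keys_iff)
    then show ?thesis by (simp add: add_pow_def)
  qed
qed (use assms in auto)

lemma lin_ext_additive:
  assumes u: "u \<in> T \<rightarrow> carrier M"
  shows "frag_additive M T (lin_ext M u)"
  unfolding frag_additive_def
proof (intro conjI allI impI)
  fix a :: "_ \<Rightarrow>\<^sub>0 int" assume a: "keys a \<subseteq> T"
  then show "lin_ext M u a \<in> carrier M" using u by (auto simp: lin_ext_def intro!: finsum_closed)
  fix b :: "_ \<Rightarrow>\<^sub>0 int" assume b: "keys b \<subseteq> T"
  let ?S = "keys a \<union> keys b"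
  have c: "u y \<in> carrier M" if "y \<in> ?S" for y using that a b u by auto
  have "lin_ext M u (a + b) = (\<Oplus>y\<in>?S. [Poly_Mapping.lookup (a + b) y] \<cdot> u y)"
    using a b keys_add_subset[of a "?S" b] by (intro lin_ext_superset[OF u]) auto
  also have "\<dots> = (\<Oplus>y\<in>?S. [Poly_Mapping.lookup a y] \<cdot> u y \<oplus> [Poly_Mapping.lookup b y] \<cdot> u y)"
    using c by (intro finsum_cong') (auto simp: lookup_add add.int_pow_mult)
  also have "\<dots> = (\<Oplus>y\<in>?S. [Poly_Mapping.lookup a y] \<cdot> u y) \<oplus> (\<Oplus>y\<in>?S. [Poly_Mapping.lookup b y] \<cdot> u y)"
    using c by (intro finsum_addf) auto
  also have "(\<Oplus>y\<in>?S. [Poly_Mapping.lookup a y] \<cdot> u y) = lin_ext M u a"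
    using a b by (intro lin_ext_superset[OF u, symmetric]) auto
  also have "(\<Oplus>y\<in>?S. [Poly_Mapping.lookup b y] \<cdot> u y) = lin_ext M u b"
    using a b by (intro lin_ext_superset[OF u, symmetric]) auto
  finally show "lin_ext M u (a + b) = lin_ext M u a \<oplus> lin_ext M u b" .
qed

lemma lin_ext_frag_of: "u y \<in> carrier M \<Longrightarrow> lin_ext M u (frag_of y) = u y"
  by (simp add: lin_ext_def)

end

section \<open>Coordinates of free modules over the group ring\<close>

lemma carrier_group_ring: "carrier (group_ring G) = {a. keys a \<subseteq> carrier G}"
  by (simp add: group_ring_def)

lemma group_ring_simps [simp]:
  "\<zero>\<^bsub>group_ring G\<^esub> = 0" "\<one>\<^bsub>group_ring G\<^esub> = frag_of \<one>\<^bsub>G\<^esub>" "a \<oplus>\<^bsub>group_ring G\<^esub> b = a + b"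
  "frag_of g \<otimes>\<^bsub>group_ring G\<^esub> frag_of h = frag_of (g \<otimes>\<^bsub>G\<^esub> h)"
  by (simp_all add: group_ring_def)

lemma frag_of_in_group_ring [simp]: "frag_of g \<in> carrier (group_ring G) \<longleftrightarrow> g \<in> carrier G"
  by (simp add: carrier_group_ring)

lemma smult_additive_left:
  fixes M :: "('g \<Rightarrow>\<^sub>0 int, 'f) module"
  assumes "left_module (group_ring G) M" "x \<in> carrier M"
  shows "frag_additive M (carrier G) (\<lambda>a. a \<odot>\<^bsub>M\<^esub> x)"
proof -
  interpret left_module "group_ring G" M by fact
  show ?thesis using smult_l_distr assms(2) by (auto simp: frag_additive_def carrier_group_ring)
qed

lemma smult_zero_left:
  fixes M :: "('g \<Rightarrow>\<^sub>0 int, 'f) module"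
  assumes "left_module (group_ring G) M" "x \<in> carrier M"
  shows "0 \<odot>\<^bsub>M\<^esub> x = \<zero>\<^bsub>M\<^esub>"
  using frag_additive_0[OF _ smult_additive_left[OF assms]] assms(1) left_module.axioms(2) by blast

text \<open>The chains on \<open>G \<times> X\<close> form the free \<int>G-module on
  \<open>X\<close>; this is the coordinate that belongs to \<open>x\<close>.\<close>

definition coefficient :: "'x \<Rightarrow> ('g \<times> 'x \<Rightarrow>\<^sub>0 int) \<Rightarrow> ('g \<Rightarrow>\<^sub>0 int)" where
  "coefficient x = frag_extend (\<lambda>(g, z). if z = x then frag_of g else 0)"

lemma coefficient_simps [simp]:
  "coefficient x (frag_of (g, z)) = (if z = x then frag_of g else 0)"
  "coefficient x 0 = 0" "coefficient x (a - b) = coefficient x a - coefficient x b"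
  "coefficient x (a + b) = coefficient x a + coefficient x b"
  by (simp_all add: coefficient_def frag_extend_diff frag_extend_add)

lemma lookup_coefficient: "Poly_Mapping.lookup (coefficient x c) g = Poly_Mapping.lookup c (g, x)"
  using subset_UNIV by (induction c rule: frag_induction) (auto simp: lookup_minus split: if_splits)

lemma keys_coefficient: "keys (coefficient x c) = {g. (g, x) \<in> keys c}"
  by (auto simp: in_keys_iff lookup_coefficient)

definition left_shift :: "('g, 'b) monoid_scheme \<Rightarrow> 'g \<Rightarrow> 'g \<times> 'x \<Rightarrow> 'g \<times> 'x" where
  "left_shift G g y = (g \<otimes>\<^bsub>G\<^esub> fst y, snd y)"

lemma left_shift_simp [simp]: "left_shift G g (u, x) = (g \<otimes>\<^bsub>G\<^esub> u, x)"
  by (simp add: left_shift_def)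

text \<open>A basis \<open>B\<close> of \<open>M\<close>, indexed injectively by \<open>X\<close> via \<open>e\<close>, identifies \<open>M\<close> with the finitely
  supported integer functions on \<open>G \<times> X\<close>.\<close>

locale based_module = group G for G :: "('g, 'b) monoid_scheme" (structure) +
  fixes M :: "('g \<Rightarrow>\<^sub>0 int, 'f) module" and X :: "'x set" and e :: "'x \<Rightarrow> 'f"
  assumes left_module: "left_module (group_ring G) M"
    and basis: "module_basis (group_ring G) M (e ` X)" and inj_e: "inj_on e X"
begin

definition ev :: "('g \<times> 'x \<Rightarrow>\<^sub>0 int) \<Rightarrow> 'f" where
  "ev = lin_ext M (\<lambda>(g, x). frag_of g \<odot>\<^bsub>M\<^esub> e x)"

lemma abelian: "abelian_group M" using left_module by (rule left_module.axioms(2))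

lemma e_closed: "x \<in> X \<Longrightarrow> e x \<in> carrier M"
  using basis by (auto simp: module_basis_def)

lemma smult_closed: "\<lbrakk>keys a \<subseteq> carrier G; m \<in> carrier M\<rbrakk> \<Longrightarrow> a \<odot>\<^bsub>M\<^esub> m \<in> carrier M"
  using left_module.smult_closed[OF left_module] by (simp add: carrier_group_ring)

lemma basis_elt_closed: "\<lbrakk>g \<in> carrier G; x \<in> X\<rbrakk> \<Longrightarrow> frag_of g \<odot>\<^bsub>M\<^esub> e x \<in> carrier M"
  using smult_closed e_closed by simp

lemma ev_additive: "frag_additive M (carrier G \<times> X) ev"
  unfolding ev_def by (rule lin_ext_additive[OF abelian]) (auto intro: basis_elt_closed)

lemma ev_frag_of: "\<lbrakk>g \<in> carrier G; x \<in> X\<rbrakk> \<Longrightarrow> ev (frag_of (g, x)) = frag_of g \<odot>\<^bsub>M\<^esub> e x"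
  unfolding ev_def by (subst lin_ext_frag_of[OF abelian]) (auto intro: basis_elt_closed)

lemma ev_coefficients:
  assumes S: "finite S" "S \<subseteq> X" and c: "keys c \<subseteq> carrier G \<times> S"
  shows "ev c = (\<Oplus>\<^bsub>M\<^esub>x\<in>S. coefficient x c \<odot>\<^bsub>M\<^esub> e x)"
proof (rule frag_additive_eq[OF abelian _ _ _ c])
  interpret abelian_group M by (rule abelian)
  show "frag_additive M (carrier G \<times> S) ev"
    by (rule frag_additive_subset[OF ev_additive]) (use S in auto)
  show "frag_additive M (carrier G \<times> S) (\<lambda>c. \<Oplus>\<^bsub>M\<^esub>x\<in>S. coefficient x c \<odot>\<^bsub>M\<^esub> e x)"
  proof (rule frag_additive_finsum[OF abelian S(1)])
    fix x assume "x \<in> S"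
    then have "e x \<in> carrier M" using S e_closed by auto
    from smult_additive_left[OF left_module this]
    show "frag_additive M (carrier G \<times> S) (\<lambda>c. coefficient x c \<odot>\<^bsub>M\<^esub> e x)"
      unfolding coefficient_def by (rule frag_additive_frag_extend) (auto split: if_splits)
  qed
  fix y assume "y \<in> carrier G \<times> S"
  then obtain g z where y: "y = (g, z)" "g \<in> carrier G" "z \<in> S" by auto
  have zX: "z \<in> X" using y S by auto
  have "(\<Oplus>\<^bsub>M\<^esub>x\<in>S. coefficient x (frag_of y) \<odot>\<^bsub>M\<^esub> e x) = (\<Oplus>\<^bsub>M\<^esub>x\<in>S. if z = x then frag_of g \<odot>\<^bsub>M\<^esub> e x else \<zero>\<^bsub>M\<^esub>)"
    using y S basis_elt_closed e_closed
    by (intro finsum_cong') (auto simp: smult_zero_left[OF left_module] subset_iff)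
  also have "\<dots> = frag_of g \<odot>\<^bsub>M\<^esub> e z"
    by (rule add.finprod_singleton) (use y S basis_elt_closed in auto)
  finally show "ev (frag_of y) = (\<Oplus>\<^bsub>M\<^esub>x\<in>S. coefficient x (frag_of y) \<odot>\<^bsub>M\<^esub> e x)"
    using y zX by (simp add: ev_frag_of)
qed

text \<open>The coefficients of \<open>c\<close> represent zero in the basis, and so do the zero
  coefficients; uniqueness of coordinates identifies the two.\<close>

lemma ev_inj_0:
  assumes c: "keys c \<subseteq> carrier G \<times> X" and 0: "ev c = \<zero>\<^bsub>M\<^esub>"
  shows "c = 0"
proof -
  interpret abelian_group M by (rule abelian)
  define S where "S = snd ` keys c"
  have S: "finite S" "S \<subseteq> X" "keys c \<subseteq> carrier G \<times> S" using c by (force simp: S_def)+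
  define a where "a = (\<lambda>b\<in>e ` X. coefficient (the_inv_into X e b) c)"
  have a_e: "a (e x) = coefficient x c" if "x \<in> X" for x
    using that by (simp add: a_def the_inv_into_f_f[OF inj_e])
  have coeff0: "coefficient x c = 0" if "x \<notin> S" for x
  proof -
    have "keys (coefficient x c) = {}" unfolding keys_coefficient using that by (force simp: S_def)
    then show ?thesis by simp
  qed
  have ck: "keys (coefficient x c) \<subseteq> carrier G" for x using c by (auto simp: keys_coefficient)
  have supp: "{b \<in> e ` X. a b \<noteq> 0} = e ` {x \<in> X. coefficient x c \<noteq> 0}" using a_e by auto
  have sub: "{x \<in> X. coefficient x c \<noteq> 0} \<subseteq> S" using coeff0 by auto
  have fin: "finite {x \<in> X. coefficient x c \<noteq> 0}" by (rule finite_subset[OF sub S(1)])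
  have "(\<Oplus>\<^bsub>M\<^esub>b\<in>{b \<in> e ` X. a b \<noteq> 0}. a b \<odot>\<^bsub>M\<^esub> b) = (\<Oplus>\<^bsub>M\<^esub>x\<in>{x \<in> X. coefficient x c \<noteq> 0}. a (e x) \<odot>\<^bsub>M\<^esub> e x)"
    unfolding supp
  proof (rule finsum_reindex)
    show "(\<lambda>b. a b \<odot>\<^bsub>M\<^esub> b) \<in> e ` {x \<in> X. coefficient x c \<noteq> 0} \<rightarrow> carrier M"
      by (auto simp: a_e intro!: smult_closed[OF ck] e_closed)
    show "inj_on e {x \<in> X. coefficient x c \<noteq> 0}" by (rule inj_on_subset[OF inj_e]) auto
  qed
  also have "\<dots> = (\<Oplus>\<^bsub>M\<^esub>x\<in>S. coefficient x c \<odot>\<^bsub>M\<^esub> e x)"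
  proof (rule add.finprod_mono_neutral_cong_left)
    show "coefficient i c \<odot>\<^bsub>M\<^esub> e i = \<zero>\<^bsub>M\<^esub>" if "i \<in> S - {x \<in> X. coefficient x c \<noteq> 0}" for i
      using that S e_closed by (auto simp: smult_zero_left[OF left_module])
  qed (use S sub e_closed in \<open>auto simp: a_e intro!: smult_closed[OF ck]\<close>)
  also have "\<dots> = \<zero>\<^bsub>M\<^esub>" using ev_coefficients[OF S] 0 by simp
  finally have rep: "\<zero>\<^bsub>M\<^esub> = (\<Oplus>\<^bsub>M\<^esub>b\<in>{b \<in> e ` X. a b \<noteq> 0}. a b \<odot>\<^bsub>M\<^esub> b)" ..
  define a0 where "a0 = (\<lambda>b\<in>e ` X. 0 :: 'g \<Rightarrow>\<^sub>0 int)"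
  have ex1: "\<exists>!a. a \<in> e ` X \<rightarrow>\<^sub>E carrier (group_ring G) \<and> finite {x \<in> e ` X. a x \<noteq> \<zero>\<^bsub>group_ring G\<^esub>} \<and>
      \<zero>\<^bsub>M\<^esub> = (\<Oplus>\<^bsub>M\<^esub>x\<in>{x \<in> e ` X. a x \<noteq> \<zero>\<^bsub>group_ring G\<^esub>}. a x \<odot>\<^bsub>M\<^esub> x)"
    using basis unfolding module_basis_def by blast
  have "a = a0"
  proof (rule trans[OF the1_equality[OF ex1, symmetric] the1_equality[OF ex1]])
    show "a \<in> e ` X \<rightarrow>\<^sub>E carrier (group_ring G) \<and> finite {x \<in> e ` X. a x \<noteq> \<zero>\<^bsub>group_ring G\<^esub>} \<and>
      \<zero>\<^bsub>M\<^esub> = (\<Oplus>\<^bsub>M\<^esub>x\<in>{x \<in> e ` X. a x \<noteq> \<zero>\<^bsub>group_ring G\<^esub>}. a x \<odot>\<^bsub>M\<^esub> x)"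
      using rep fin supp ck unfolding group_ring_simps carrier_group_ring
      by (auto simp: a_def)
    have e0: "{x \<in> e ` X. a0 x \<noteq> 0} = {}" by (auto simp: a0_def)
    show "a0 \<in> e ` X \<rightarrow>\<^sub>E carrier (group_ring G) \<and> finite {x \<in> e ` X. a0 x \<noteq> \<zero>\<^bsub>group_ring G\<^esub>} \<and>
      \<zero>\<^bsub>M\<^esub> = (\<Oplus>\<^bsub>M\<^esub>x\<in>{x \<in> e ` X. a0 x \<noteq> \<zero>\<^bsub>group_ring G\<^esub>}. a0 x \<odot>\<^bsub>M\<^esub> x)"
      unfolding group_ring_simps e0 carrier_group_ring by (auto simp: a0_def)
  qed
  have "coefficient x c = 0" for x
  proof (cases "x \<in> X")
    case True
    then have "a0 (e x) = 0" by (simp add: a0_def)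
    then show ?thesis using a_e[OF True] \<open>a = a0\<close> by simp
  qed (use coeff0 S in blast)
  then have "Poly_Mapping.lookup c (g, x) = 0" for g x by (metis lookup_coefficient lookup_zero)
  then show ?thesis by (intro poly_mapping_eqI) auto
qed

lemma ev_inj: "inj_on ev {c. keys c \<subseteq> carrier G \<times> X}"
proof (rule inj_onI; clarify)
  interpret abelian_group M by (rule abelian)
  fix a b assume ab: "keys a \<subseteq> carrier G \<times> X" "keys b \<subseteq> carrier G \<times> X" "ev a = ev b"
  have "ev (a - b) = \<zero>\<^bsub>M\<^esub>"
    using frag_additive_diff[OF abelian ev_additive ab(1,2)] ab frag_additiveD(1)[OF ev_additive]
    by (simp add: minus_eq r_neg)
  then have "a - b = 0" using ev_inj_0 keys_diff_subset ab by blast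
  then show "a = b" by simp
qed

lemma ev_smult_basis:
  assumes "keys a \<subseteq> carrier G" "x \<in> X"
  shows "ev (frag_extend (\<lambda>g. frag_of (g, x)) a) = a \<odot>\<^bsub>M\<^esub> e x"
proof (rule frag_additive_eq[OF abelian _ _ _ assms(1)])
  show "frag_additive M (carrier G) (\<lambda>a. ev (frag_extend (\<lambda>g. frag_of (g, x)) a))"
    by (rule frag_additive_frag_extend[OF ev_additive]) (use assms in auto)
  show "frag_additive M (carrier G) (\<lambda>a. a \<odot>\<^bsub>M\<^esub> e x)"
    by (rule smult_additive_left[OF left_module e_closed[OF assms(2)]])
qed (use ev_frag_of assms in auto)

lemma ev_surj: "m \<in> carrier M \<Longrightarrow> \<exists>c. keys c \<subseteq> carrier G \<times> X \<and> ev c = m"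
proof -
  interpret abelian_group M by (rule abelian)
  assume "m \<in> carrier M"
  then obtain a where a: "a \<in> e ` X \<rightarrow>\<^sub>E carrier (group_ring G)" "finite {x \<in> e ` X. a x \<noteq> \<zero>\<^bsub>group_ring G\<^esub>}"
      "m = (\<Oplus>\<^bsub>M\<^esub>x\<in>{x \<in> e ` X. a x \<noteq> \<zero>\<^bsub>group_ring G\<^esub>}. a x \<odot>\<^bsub>M\<^esub> x)"
    using basis unfolding module_basis_def by blast
  define S where "S = {x \<in> e ` X. a x \<noteq> \<zero>\<^bsub>group_ring G\<^esub>}"
  define w where "w b = frag_extend (\<lambda>g. frag_of (g, the_inv_into X e b)) (a b)" for b
  have w: "keys (w b) \<subseteq> carrier G \<times> X" "ev (w b) = a b \<odot>\<^bsub>M\<^esub> b" if "b \<in> S" for b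
  proof -
    obtain x where x: "x \<in> X" "b = e x" using \<open>b \<in> S\<close> by (auto simp: S_def)
    have k: "keys (a b) \<subseteq> carrier G" using a(1) x by (auto simp: carrier_group_ring PiE_iff)
    show "keys (w b) \<subseteq> carrier G \<times> X"
      using keys_frag_extend[of "\<lambda>g. frag_of (g, x)" "a b"] k x
      by (auto simp: w_def the_inv_into_f_f[OF inj_e])
    show "ev (w b) = a b \<odot>\<^bsub>M\<^esub> b"
      using ev_smult_basis[OF k x(1)] x by (simp add: w_def the_inv_into_f_f[OF inj_e])
  qed
  have "ev (\<Sum>b\<in>S. w b) = (\<Oplus>\<^bsub>M\<^esub>b\<in>S. ev (w b)) \<and> keys (\<Sum>b\<in>S. w b) \<subseteq> carrier G \<times> X"
    by (rule frag_additive_sum[OF abelian ev_additive]) (use a w in \<open>auto simp: S_def\<close>)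
  moreover have "(\<Oplus>\<^bsub>M\<^esub>b\<in>S. ev (w b)) = m"
    unfolding a(3) S_def[symmetric]
    by (rule finsum_cong') (use w frag_additiveD(1)[OF ev_additive] in \<open>auto simp: w(2)[symmetric]\<close>)
  ultimately show "\<exists>c. keys c \<subseteq> carrier G \<times> X \<and> ev c = m" by blast
qed

lemma ev_translate:
  assumes g: "g \<in> carrier G" and c: "keys c \<subseteq> carrier G \<times> X"
  shows "ev (translate (left_shift G) g c) = frag_of g \<odot>\<^bsub>M\<^esub> ev c"
proof (rule frag_additive_eq[OF abelian _ _ _ c])
  show "frag_additive M (carrier G \<times> X) (\<lambda>c. ev (translate (left_shift G) g c))"
    unfolding translate_def by (rule frag_additive_frag_extend[OF ev_additive]) (use g in auto)
  show "frag_additive M (carrier G \<times> X) (\<lambda>c. frag_of g \<odot>\<^bsub>M\<^esub> ev c)"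
    by (rule frag_additive_hom[OF ev_additive])
      (use g left_module.smult_r_distr[OF left_module] left_module.smult_closed[OF left_module] in auto)
  fix y assume "y \<in> carrier G \<times> X"
  then obtain u x where y: "y = (u, x)" "u \<in> carrier G" "x \<in> X" by auto
  have "frag_of (g \<otimes> u) \<odot>\<^bsub>M\<^esub> e x = frag_of g \<odot>\<^bsub>M\<^esub> (frag_of u \<odot>\<^bsub>M\<^esub> e x)"
    using left_module.smult_assoc[OF left_module, of "frag_of g" "frag_of u" "e x"] g y e_closed by simp
  then show "ev (translate (left_shift G) g (frag_of y)) = frag_of g \<odot>\<^bsub>M\<^esub> ev (frag_of y)"
    using y g by (simp add: ev_frag_of)
qed

text \<open>Finitely many generators involve finitely many basis elements, indexed by
  \<open>Z\<close>. Every basis element is a combination of those, and by uniqueness of coordinates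
  it is one of them.\<close>

lemma finite_index_if_finitely_generated:
  assumes "finitely_generated (group_ring G) M"
  shows "finite X"
proof -
  interpret abelian_group M by (rule abelian)
  obtain S where S: "S \<subseteq> carrier M" "finite S"
    "\<And>m. m \<in> carrier M \<Longrightarrow> \<exists>a\<in>S \<rightarrow> carrier (group_ring G). m = (\<Oplus>\<^bsub>M\<^esub>x\<in>S. a x \<odot>\<^bsub>M\<^esub> x)"
    using assms by (auto simp: finitely_generated_def)
  have "\<forall>s\<in>S. \<exists>c. keys c \<subseteq> carrier G \<times> X \<and> ev c = s" using ev_surj S(1) by blast
  then obtain w where w: "\<And>s. s \<in> S \<Longrightarrow> keys (w s) \<subseteq> carrier G \<times> X" "\<And>s. s \<in> S \<Longrightarrow> ev (w s) = s"
    using bchoice[of S "\<lambda>s c. keys c \<subseteq> carrier G \<times> X \<and> ev c = s"] by blast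
  define Z where "Z = snd ` (\<Union>s\<in>S. keys (w s))"
  have Z: "finite Z" "Z \<subseteq> X" using S(2) w(1) by (force simp: Z_def)+
  have wZ: "keys (w s) \<subseteq> carrier G \<times> Z" if "s \<in> S" for s using w(1)[OF that] that by (force simp: Z_def)
  have smult_ev: "\<exists>c. keys c \<subseteq> carrier G \<times> Z \<and> ev c = a \<odot>\<^bsub>M\<^esub> s" if s: "s \<in> S" and a: "keys a \<subseteq> carrier G" for a s
  proof (intro exI conjI)
    let ?c = "\<lambda>a. frag_extend (\<lambda>g. translate (left_shift G) g (w s)) a"
    have tk: "keys (translate (left_shift G) g (w s)) \<subseteq> carrier G \<times> Z" if "g \<in> carrier G" for g
      using keys_translate[of "left_shift G" g "w s"] wZ[OF s] that by fastforce
    show "keys (?c a) \<subseteq> carrier G \<times> Z"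
      using keys_frag_extend[of "\<lambda>g. translate (left_shift G) g (w s)" a] a tk by blast
    show "ev (?c a) = a \<odot>\<^bsub>M\<^esub> s"
    proof (rule frag_additive_eq[OF abelian _ _ _ a])
      show "frag_additive M (carrier G) (\<lambda>a. ev (?c a))"
        by (rule frag_additive_frag_extend[OF ev_additive]) (use tk Z in auto)
      show "frag_additive M (carrier G) (\<lambda>a. a \<odot>\<^bsub>M\<^esub> s)"
        by (rule smult_additive_left[OF left_module]) (use s S in auto)
      show "ev (?c (frag_of g)) = frag_of g \<odot>\<^bsub>M\<^esub> s" if "g \<in> carrier G" for g
        using ev_translate[OF that w(1)[OF s]] w(2)[OF s] by simp
    qed
  qed
  have "x \<in> Z" if x: "x \<in> X" for x
  proof -
    obtain a where a: "a \<in> S \<rightarrow> carrier (group_ring G)" "e x = (\<Oplus>\<^bsub>M\<^esub>s\<in>S. a s \<odot>\<^bsub>M\<^esub> s)"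
      using S(3)[OF e_closed[OF x]] by blast
    have "\<forall>s\<in>S. \<exists>c. keys c \<subseteq> carrier G \<times> Z \<and> ev c = a s \<odot>\<^bsub>M\<^esub> s"
    proof
      fix s assume "s \<in> S"
      moreover from this have "keys (a s) \<subseteq> carrier G" using a(1) by (auto simp: carrier_group_ring)
      ultimately show "\<exists>c. keys c \<subseteq> carrier G \<times> Z \<and> ev c = a s \<odot>\<^bsub>M\<^esub> s" by (rule smult_ev)
    qed
    then obtain v where v: "\<And>s. s \<in> S \<Longrightarrow> keys (v s) \<subseteq> carrier G \<times> Z" "\<And>s. s \<in> S \<Longrightarrow> ev (v s) = a s \<odot>\<^bsub>M\<^esub> s"
      using bchoice[of S "\<lambda>s c. keys c \<subseteq> carrier G \<times> Z \<and> ev c = a s \<odot>\<^bsub>M\<^esub> s"] by blast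
    have evZ: "frag_additive M (carrier G \<times> Z) ev"
      by (rule frag_additive_subset[OF ev_additive]) (use Z in auto)
    have 1: "ev (\<Sum>s\<in>S. v s) = (\<Oplus>\<^bsub>M\<^esub>s\<in>S. ev (v s)) \<and> keys (\<Sum>s\<in>S. v s) \<subseteq> carrier G \<times> Z"
      by (rule frag_additive_sum[OF abelian evZ S(2)]) (use v in auto)
    have "(\<Oplus>\<^bsub>M\<^esub>s\<in>S. ev (v s)) = e x"
      unfolding a(2) by (rule finsum_cong') (use v frag_additiveD(1)[OF evZ] in \<open>auto simp: v(2)[symmetric]\<close>)
    moreover have "ev (frag_of (\<one>, x)) = e x"
      using ev_frag_of[of \<one> x] x left_module.smult_one[OF left_module e_closed[OF x]] by simp
    ultimately have "(\<Sum>s\<in>S. v s) = frag_of (\<one>, x)"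
      using 1 Z x by (intro inj_onD[OF ev_inj]) auto
    then show "x \<in> Z" using 1 by auto
  qed
  then have "X \<subseteq> Z" by blast
  then show ?thesis using Z(1) by (rule finite_subset)
qed

end

text \<open>The tag \<open>k\<close> separates the degrees: the carriers of the chain modules share
  one type and may overlap.\<close>

definition Y_of :: "('g, 'b) monoid_scheme \<Rightarrow> (nat \<Rightarrow> 's set) \<Rightarrow> nat \<Rightarrow> ('g \<times> (nat \<times> 's)) set" where
  "Y_of G S k = carrier G \<times> ({k} \<times> S k)"

lemma (in group) left_shift_free_action:
  "\<lbrakk>g \<in> carrier G; y \<in> Y_of G S k\<rbrakk> \<Longrightarrow> left_shift G g y \<in> Y_of G S k"
  "y \<in> Y_of G S k \<Longrightarrow> left_shift G \<one> y = y"
  "\<lbrakk>g \<in> carrier G; g' \<in> carrier G; y \<in> Y_of G S k\<rbrakk> \<Longrightarrow> left_shift G (g \<otimes> g') y = left_shift G g (left_shift G g' y)"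
  "\<lbrakk>g \<in> carrier G; y \<in> Y_of G S k; left_shift G g y = y\<rbrakk> \<Longrightarrow> g = \<one>"
  by (auto simp: Y_of_def m_assoc)

section \<open>Resolutions given as records, in coordinates\<close>

locale record_resolution = group G for G :: "('g, 'b) monoid_scheme" (structure) +
  fixes A :: "('g \<Rightarrow>\<^sub>0 int, 'a) module" and F :: "('g, 'f, 'a) based_complex"
  assumes res: "based_free_resolution G A F"
begin

lemma A_module: "left_module (group_ring G) A"
  and chain_module: "left_module (group_ring G) (chain F k)"
  and chain_basis: "module_basis (group_ring G) (chain F k) (gens F k)"
  and bdr_hom: "bdr F k \<in> module_homs (group_ring G) (chain F (Suc k)) (chain F k)"
  and aug_hom: "aug F \<in> module_homs (group_ring G) (chain F 0) A"
  and aug_surj: "aug F ` carrier (chain F 0) = carrier A"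
  and bdr_image: "bdr F k ` carrier (chain F (Suc k)) = cycles A F k"
  using res unfolding based_free_resolution_def by blast+

sublocale bm: based_module G "chain F k" "{k} \<times> gens F k" snd for k
proof (intro based_module.intro based_module_axioms.intro)
  show "module_basis (group_ring G) (chain F k) (snd ` ({k} \<times> gens F k))"
    using chain_basis by simp
qed (auto simp: inj_on_def intro: is_group chain_module)

abbreviation Y where "Y \<equiv> Y_of G (gens F)"
abbreviation ev where "ev \<equiv> bm.ev"

lemma chains_Y: "chains Y k = {c. keys c \<subseteq> carrier G \<times> ({k} \<times> gens F k)}"
  by (simp add: chains_def Y_of_def)

lemma ev_closed: "c \<in> chains Y k \<Longrightarrow> ev k c \<in> carrier (chain F k)"
  using frag_additiveD(1)[OF bm.ev_additive] by (simp add: chains_Y)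

lemma ev_inj: "\<lbrakk>c \<in> chains Y k; c' \<in> chains Y k; ev k c = ev k c'\<rbrakk> \<Longrightarrow> c = c'"
  using bm.ev_inj[of k] by (auto simp: chains_Y dest: inj_onD)

lemma ev_surj: "m \<in> carrier (chain F k) \<Longrightarrow> \<exists>c\<in>chains Y k. ev k c = m"
  using bm.ev_surj[of m k] by (auto simp: chains_Y)

lemma ev_0: "ev k 0 = \<zero>\<^bsub>chain F k\<^esub>"
  by (rule frag_additive_0[OF bm.abelian bm.ev_additive])

lemma ev_eq_0: "c \<in> chains Y k \<Longrightarrow> ev k c = \<zero>\<^bsub>chain F k\<^esub> \<longleftrightarrow> c = 0"
  using ev_inj[of c k 0] ev_0 by auto

lemma ev_translate: "\<lbrakk>g \<in> carrier G; c \<in> chains Y k\<rbrakk> \<Longrightarrow>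
    ev k (translate (left_shift G) g c) = frag_of g \<odot>\<^bsub>chain F k\<^esub> ev k c"
  using bm.ev_translate by (simp add: chains_Y)

lemma bdr_closed: "m \<in> carrier (chain F (Suc k)) \<Longrightarrow> bdr F k m \<in> carrier (chain F k)"
  and bdr_add: "\<lbrakk>m \<in> carrier (chain F (Suc k)); m' \<in> carrier (chain F (Suc k))\<rbrakk> \<Longrightarrow>
    bdr F k (m \<oplus>\<^bsub>chain F (Suc k)\<^esub> m') = bdr F k m \<oplus>\<^bsub>chain F k\<^esub> bdr F k m'"
  and bdr_smult: "\<lbrakk>a \<in> carrier (group_ring G); m \<in> carrier (chain F (Suc k))\<rbrakk> \<Longrightarrow>
    bdr F k (a \<odot>\<^bsub>chain F (Suc k)\<^esub> m) = a \<odot>\<^bsub>chain F k\<^esub> bdr F k m"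
  using bdr_hom[of k] by (auto simp: module_homs_def)

text \<open>The boundary of the record read in coordinates, through the inverse of
  \<open>ev\<close>. It is 0 in degree 0, where the record continues with the augmentation
  instead.\<close>

definition bd :: "'g \<times> (nat \<times> 'f) \<Rightarrow> 'g \<times> (nat \<times> 'f) \<Rightarrow>\<^sub>0 int" where
  "bd y = (case fst (snd y) of 0 \<Rightarrow> 0 | Suc i \<Rightarrow>
    (if y \<in> Y (Suc i) then inv_into (chains Y i) (ev i) (bdr F i (ev (Suc i) (frag_of y))) else 0))"

lemma degree: "y \<in> Y k \<Longrightarrow> fst (snd y) = k"
  by (auto simp: Y_of_def)

lemma bd_Suc:
  assumes "y \<in> Y (Suc i)"
  shows "bd y \<in> chains Y i" "ev i (bd y) = bdr F i (ev (Suc i) (frag_of y))"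
proof -
  have "bdr F i (ev (Suc i) (frag_of y)) \<in> carrier (chain F i)"
    using assms by (intro bdr_closed ev_closed) simp
  then obtain c where "c \<in> chains Y i" "ev i c = bdr F i (ev (Suc i) (frag_of y))" using ev_surj by blast
  then have "bdr F i (ev (Suc i) (frag_of y)) \<in> ev i ` chains Y i" by (metis imageI)
  moreover have "bd y = inv_into (chains Y i) (ev i) (bdr F i (ev (Suc i) (frag_of y)))"
    using assms by (simp add: bd_def degree)
  ultimately show "bd y \<in> chains Y i" "ev i (bd y) = bdr F i (ev (Suc i) (frag_of y))"
    by (simp_all add: inv_into_into f_inv_into_f)
qed

lemma bd_0: "y \<in> Y 0 \<Longrightarrow> bd y = 0"
  by (simp add: bd_def degree)

lemma ext_bd_closed: "c \<in> chains Y (Suc i) \<Longrightarrow> frag_extend bd c \<in> chains Y i"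
  by (erule chains_frag_extend) (rule bd_Suc)

lemma ev_bd:
  assumes c: "c \<in> chains Y (Suc i)"
  shows "ev i (frag_extend bd c) = bdr F i (ev (Suc i) c)"
proof (rule frag_additive_eq[OF bm.abelian])
  show "frag_additive (chain F i) (Y (Suc i)) (\<lambda>c. ev i (frag_extend bd c))"
    by (rule frag_additive_frag_extend[OF bm.ev_additive]) (use bd_Suc(1) in \<open>auto simp: chains_Y\<close>)
  show "frag_additive (chain F i) (Y (Suc i)) (\<lambda>c. bdr F i (ev (Suc i) c))"
    by (rule frag_additive_hom[where M = "chain F (Suc i)"])
      (use bm.ev_additive[of "Suc i"] bdr_closed bdr_add in \<open>auto simp: Y_of_def\<close>)
qed (use c bd_Suc in \<open>auto simp: chains_def\<close>)

lemma bdr_bdr: "m \<in> carrier (chain F (Suc (Suc i))) \<Longrightarrow> bdr F i (bdr F (Suc i) m) = \<zero>\<^bsub>chain F i\<^esub>"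
  using bdr_image[of "Suc i"] by (auto simp: cycles_def)

lemma aug_bdr: "m \<in> carrier (chain F (Suc 0)) \<Longrightarrow> aug F (bdr F 0 m) = \<zero>\<^bsub>A\<^esub>"
  using bdr_image[of 0] by (auto simp: cycles_def)

sublocale cx: free_complex G "left_shift G" Y bd
proof unfold_locales
  show "i = j" if "y \<in> Y i" "y \<in> Y j" for y i j using degree that by metis
  show "frag_extend bd (bd y) = 0" if y: "y \<in> Y k" for y k
  proof (cases k)
    case 0
    then show ?thesis using y by (simp add: bd_0)
  next
    case (Suc i)
    then have b: "bd y \<in> chains Y i" "ev i (bd y) = bdr F i (ev (Suc i) (frag_of y))" using y bd_Suc by auto
    show ?thesis
    proof (cases i)
      case 0
      then show ?thesis using b bd_0 by (auto intro!: frag_extend_eq_0 simp: chains_def)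
    next
      case (Suc j)
      have "ev j (frag_extend bd (bd y)) = \<zero>\<^bsub>chain F j\<^esub>"
        using b y Suc \<open>k = Suc i\<close> ev_bd[of "bd y" j] bdr_bdr[of "ev (Suc (Suc j)) (frag_of y)" j]
          ev_closed[of "frag_of y" "Suc (Suc j)"] by simp
      then show ?thesis using ev_eq_0 ext_bd_closed b Suc by auto
    qed
  qed
  show "bd (left_shift G g y) = translate (left_shift G) g (bd y)" if g: "g \<in> carrier G" and y: "y \<in> Y k" for g y k
  proof (cases k)
    case 0
    then show ?thesis using left_shift_free_action(1)[OF g y] y by (simp add: bd_0)
  next
    case (Suc i)
    have gy: "left_shift G g y \<in> Y (Suc i)" using left_shift_free_action(1)[OF g y] Suc by simp
    have y': "y \<in> Y (Suc i)" using y Suc by simp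
    have tc: "translate (left_shift G) g (bd y) \<in> chains Y i"
      unfolding translate_def using left_shift_free_action(1)[OF g]
      by (intro chains_frag_extend[OF bd_Suc(1)[OF y']]) simp
    have "ev i (bd (left_shift G g y)) = bdr F i (ev (Suc i) (translate (left_shift G) g (frag_of y)))"
      using bd_Suc(2)[OF gy] by simp
    also have "\<dots> = bdr F i (frag_of g \<odot>\<^bsub>chain F (Suc i)\<^esub> ev (Suc i) (frag_of y))"
      using ev_translate[OF g, of "frag_of y" "Suc i"] y' by simp
    also have "\<dots> = frag_of g \<odot>\<^bsub>chain F i\<^esub> bdr F i (ev (Suc i) (frag_of y))"
      using g y' ev_closed by (intro bdr_smult) auto
    also have "\<dots> = ev i (translate (left_shift G) g (bd y))"
      using ev_translate[OF g bd_Suc(1)[OF y']] bd_Suc(2)[OF y'] by simp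
    finally show ?thesis by (rule ev_inj[OF bd_Suc(1)[OF gy] tc])
  qed
  show "\<exists>e\<in>chains Y (Suc (Suc k)). frag_extend bd e = c"
    if c: "c \<in> chains Y (Suc k)" "frag_extend bd c = 0" for c k
  proof -
    have "bdr F k (ev (Suc k) c) = \<zero>\<^bsub>chain F k\<^esub>" using ev_bd[OF c(1)] c(2) ev_0 by simp
    then have "ev (Suc k) c \<in> cycles A F (Suc k)" using ev_closed[OF c(1)] by (simp add: cycles_def)
    then obtain m where m: "m \<in> carrier (chain F (Suc (Suc k)))" "bdr F (Suc k) m = ev (Suc k) c"
      using bdr_image[of "Suc k"] by (metis imageE)
    then obtain w where w: "w \<in> chains Y (Suc (Suc k))" "ev (Suc (Suc k)) w = m" using ev_surj by blast
    then have "ev (Suc k) (frag_extend bd w) = ev (Suc k) c" using ev_bd m by simp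
    then have "frag_extend bd w = c" using ev_inj ext_bd_closed[OF w(1)] c(1) by blast
    then show ?thesis using w(1) by blast
  qed
qed (use left_shift_free_action bd_Suc bd_0 in auto)

definition augm :: "('g \<times> (nat \<times> 'f) \<Rightarrow>\<^sub>0 int) \<Rightarrow> 'a" where
  "augm c = aug F (ev 0 c)"

lemma A_abelian: "abelian_group A"
  using A_module by (rule left_module.axioms(2))

lemma augm_additive: "frag_additive A (Y 0) augm"
  unfolding augm_def
  by (rule frag_additive_hom[where M = "chain F 0"])
    (use bm.ev_additive[of 0] aug_hom in \<open>auto simp: Y_of_def module_homs_def\<close>)

lemma augm_closed: "c \<in> chains Y 0 \<Longrightarrow> augm c \<in> carrier A"
  using frag_additiveD(1)[OF augm_additive] by (simp add: chains_def)

lemma augm_diff: "\<lbrakk>c \<in> chains Y 0; c' \<in> chains Y 0\<rbrakk> \<Longrightarrow> augm (c - c') = augm c \<ominus>\<^bsub>A\<^esub> augm c'"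
  using frag_additive_diff[OF A_abelian augm_additive] by (simp add: chains_def)

lemma augm_translate: "\<lbrakk>g \<in> carrier G; c \<in> chains Y 0\<rbrakk> \<Longrightarrow>
    augm (translate (left_shift G) g c) = frag_of g \<odot>\<^bsub>A\<^esub> augm c"
  using aug_hom ev_translate ev_closed by (auto simp: augm_def module_homs_def)

lemma augm_surj: "a \<in> carrier A \<Longrightarrow> \<exists>c\<in>chains Y 0. augm c = a"
proof -
  assume "a \<in> carrier A"
  then have "a \<in> aug F ` carrier (chain F 0)" using aug_surj by simp
  then obtain m where m: "m \<in> carrier (chain F 0)" "a = aug F m" by (rule imageE)
  then obtain c where "c \<in> chains Y 0" "ev 0 c = m" using ev_surj by blast
  then show "\<exists>c\<in>chains Y 0. augm c = a" using m by (auto simp: augm_def)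
qed

lemma augm_eq_0: "c \<in> chains Y 0 \<Longrightarrow> augm c = \<zero>\<^bsub>A\<^esub> \<longleftrightarrow> (\<exists>e\<in>chains Y (Suc 0). frag_extend bd e = c)"
proof
  assume c: "c \<in> chains Y 0" and "augm c = \<zero>\<^bsub>A\<^esub>"
  then have "ev 0 c \<in> cycles A F 0" using ev_closed[OF c] by (simp add: cycles_def augm_def)
  then have "ev 0 c \<in> bdr F 0 ` carrier (chain F (Suc 0))" using bdr_image by simp
  then obtain m where m: "m \<in> carrier (chain F (Suc 0))" "bdr F 0 m = ev 0 c" by (rule imageE) simp
  then obtain w where w: "w \<in> chains Y (Suc 0)" "ev (Suc 0) w = m" using ev_surj by blast
  then have "ev 0 (frag_extend bd w) = ev 0 c" using ev_bd m by simp
  then have "frag_extend bd w = c" using ev_inj ext_bd_closed[OF w(1)] c by blast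
  then show "\<exists>e\<in>chains Y (Suc 0). frag_extend bd e = c" using w(1) by blast
next
  assume c: "c \<in> chains Y 0" and "\<exists>e\<in>chains Y (Suc 0). frag_extend bd e = c"
  then obtain w where w: "w \<in> chains Y (Suc 0)" "frag_extend bd w = c" by blast
  then show "augm c = \<zero>\<^bsub>A\<^esub>" using ev_bd[OF w(1)] aug_bdr[OF ev_closed[OF w(1)]] by (simp add: augm_def)
qed

text \<open>Two lifts of one element of \<open>A\<close> differ by a boundary. This is how the
  condition in degree -1 becomes a statement about chains of degree 0.\<close>

lemma augm_eq_iff: "\<lbrakk>c \<in> chains Y 0; c' \<in> chains Y 0\<rbrakk> \<Longrightarrow>
    augm c = augm c' \<longleftrightarrow> (\<exists>e\<in>chains Y (Suc 0). frag_extend bd e = c - c')"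
proof -
  interpret abelian_group A by (rule A_abelian)
  assume c: "c \<in> chains Y 0" "c' \<in> chains Y 0"
  have ac: "augm c \<in> carrier A" "augm c' \<in> carrier A" using c augm_closed by auto
  have "(augm c \<ominus>\<^bsub>A\<^esub> augm c') \<oplus>\<^bsub>A\<^esub> augm c' = augm c"
    using ac by (simp add: minus_eq a_assoc l_neg)
  then have "augm c = augm c' \<longleftrightarrow> augm c \<ominus>\<^bsub>A\<^esub> augm c' = \<zero>\<^bsub>A\<^esub>"
    using ac by (auto simp: minus_eq r_neg)
  then show ?thesis using c augm_eq_0[of "c - c'"] by (simp add: augm_diff chains_diff)
qed

lemma finite_gens: "finitely_generated (group_ring G) (chain F k) \<Longrightarrow> finite (gens F k)"
  using bm.finite_index_if_finitely_generated[of k] by (auto simp: finite_cartesian_product_iff)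

end

text \<open>A free action stays free on a subgroup, and exactness does not involve the
  group.\<close>

lemma (in free_complex) restrict_subgroup:
  assumes "subgroup H G"
  shows "free_complex (G\<lparr>carrier := H\<rparr>) act Y bd"
proof -
  interpret H: group "G\<lparr>carrier := H\<rparr>" by (rule subgroup_imp_group[OF assms])
  have "H \<subseteq> carrier G" by (rule subgroup.subset[OF assms])
  then show ?thesis
    by unfold_locales
      (use act_closed act_one act_mult act_free degree_unique bd_closed bd_zero bd_bd bd_act exact in \<open>auto simp: subset_iff\<close>)
qed

section \<open>Control maps and the condition CA in coordinates\<close>

locale record_control = record_resolution G A F
  for G :: "('g, 'b) monoid_scheme" (structure) and A :: "('g \<Rightarrow>\<^sub>0 int, 'a) module"
    and F :: "('g, 'f, 'a) based_complex" +
  fixes \<rho> :: "'g \<Rightarrow> 'm::metric_space \<Rightarrow> 'm" and h :: "nat \<Rightarrow> 'f \<Rightarrow> 'm set" and n :: nat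
  assumes iso: "isometric_action G \<rho>" and fg: "fg_skeleton G n F" and ctrl: "control_map G \<rho> F h"
begin

lemma \<rho>_action: "group_action G UNIV \<rho>"
  and \<rho>_dist: "g \<in> carrier G \<Longrightarrow> dist (\<rho> g x) (\<rho> g y) = dist x y"
  using iso by (auto simp: isometric_action_def)

lemma \<rho>_one: "\<rho> \<one> x = x"
  using group_action.id_eq_one[OF \<rho>_action] by (metis UNIV_I restrict_apply')

lemma \<rho>_mult: "\<lbrakk>g \<in> carrier G; g' \<in> carrier G\<rbrakk> \<Longrightarrow> \<rho> (g \<otimes> g') x = \<rho> g (\<rho> g' x)"
  using group_action.composition_rule[OF \<rho>_action] by blast

definition elt :: "nat \<Rightarrow> 'g \<times> (nat \<times> 'f) \<Rightarrow> 'f" where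
  "elt k y = ev k (frag_of y)"

lemma elt_eq: "\<lbrakk>g \<in> carrier G; x \<in> gens F k\<rbrakk> \<Longrightarrow> elt k (g, (k, x)) = frag_of g \<odot>\<^bsub>chain F k\<^esub> x"
  using bm.ev_frag_of[of g "(k, x)" k] by (simp add: elt_def)

lemma elt_inj: "inj_on (elt k) (Y k)"
proof (rule inj_onI)
  fix y y' assume "y \<in> Y k" "y' \<in> Y k" "elt k y = elt k y'"
  then have "frag_of y = frag_of y'" by (intro ev_inj[of _ k]) (auto simp: elt_def)
  then show "y = y'" by (simp add: frag_of_eq)
qed

lemma Z_basis_eq: "Z_basis G F k = elt k ` Y k"
proof (intro equalityI subsetI)
  fix z assume "z \<in> Z_basis G F k"
  then obtain g x where gx: "g \<in> carrier G" "x \<in> gens F k" "z = frag_of g \<odot>\<^bsub>chain F k\<^esub> x"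
    unfolding Z_basis_def by (elim CollectE exE conjE) simp
  then have "z = elt k (g, (k, x))" "(g, (k, x)) \<in> Y k" by (simp_all add: elt_eq Y_of_def)
  then show "z \<in> elt k ` Y k" by (rule image_eqI)
next
  fix z assume "z \<in> elt k ` Y k"
  then obtain g x where "g \<in> carrier G" "x \<in> gens F k" "z = elt k (g, (k, x))" by (auto simp: Y_of_def)
  then show "z \<in> Z_basis G F k" unfolding Z_basis_def by (intro CollectI exI[of _ g] exI[of _ x]) (simp add: elt_eq)
qed

text \<open>\<open>supp\<close> singles out the unique expansion in the \<int>-basis. The map
  \<open>elt k\<close> is a bijection from \<open>Y k\<close> to that basis, so the expansion is
  \<open>c\<close> with its keys renamed; \<open>push\<close> and \<open>pull\<close> are the two
  renamings.\<close>

lemma supp_ev: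
  assumes c: "c \<in> chains Y k"
  shows "supp G F k (ev k c) = elt k ` keys c"
proof -
  define push where "push = frag_extend (frag_of \<circ> elt k)"
  define iz where "iz = the_inv_into (Y k) (elt k)"
  define pull where "pull = frag_extend (frag_of \<circ> iz)"
  have iz: "iz (elt k y) = y" if "y \<in> Y k" for y
    unfolding iz_def by (rule the_inv_into_f_f[OF elt_inj that])
  have keys_push: "keys (push c) \<subseteq> elt k ` keys c" for c
    using keys_frag_extend[of "frag_of \<circ> elt k" c] by (auto simp: push_def)
  have keys_pull: "keys (pull a) \<subseteq> iz ` keys a" for a
    using keys_frag_extend[of "frag_of \<circ> iz" a] by (auto simp: pull_def)
  have pull_push: "pull (push c) = c" if "c \<in> chains Y k" for c
  proof -
    have "pull (push c) = frag_extend ((frag_of \<circ> iz) \<circ> elt k) c"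
      unfolding pull_def push_def by (rule frag_extend_compose)
    also have "\<dots> = frag_extend frag_of c"
      by (rule frag_extend_eq_on_chains[OF that]) (simp add: iz)
    finally show ?thesis by simp
  qed
  have push_pull: "push (pull a) = a" if "keys a \<subseteq> Z_basis G F k" for a
  proof -
    have "push (pull a) = frag_extend ((frag_of \<circ> elt k) \<circ> iz) a"
      unfolding pull_def push_def by (rule frag_extend_compose)
    also have "\<dots> = frag_extend frag_of a"
      by (rule frag_extend_eq) (use that iz in \<open>auto simp: Z_basis_eq\<close>)
    finally show ?thesis by simp
  qed
  have pull_chain: "pull a \<in> chains Y k" if "keys a \<subseteq> Z_basis G F k" for a
    using keys_pull[of a] that iz by (fastforce simp: chains_def Z_basis_eq)
  have Zc: "Z_basis G F k \<subseteq> carrier (chain F k)"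
    using ev_closed by (auto simp: Z_basis_eq elt_def)
  have ev_pull: "lin_ext (chain F k) (\<lambda>y. y) a = ev k (pull a)" if a: "keys a \<subseteq> Z_basis G F k" for a
  proof (rule frag_additive_eq[OF bm.abelian _ _ _ a])
    show "frag_additive (chain F k) (Z_basis G F k) (lin_ext (chain F k) (\<lambda>y. y))"
      by (rule lin_ext_additive[OF bm.abelian]) (use Zc in auto)
    show "frag_additive (chain F k) (Z_basis G F k) (\<lambda>a. ev k (pull a))"
      unfolding pull_def
      by (rule frag_additive_frag_extend[OF bm.ev_additive]) (use iz in \<open>auto simp: Z_basis_eq Y_of_def\<close>)
    show "lin_ext (chain F k) (\<lambda>y. y) (frag_of y) = ev k (pull (frag_of y))" if "y \<in> Z_basis G F k" for y
      using that Zc iz by (auto simp: lin_ext_frag_of[OF bm.abelian] pull_def Z_basis_eq elt_def)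
  qed
  have kp: "keys (push c) \<subseteq> Z_basis G F k" using keys_push[of c] c by (auto simp: chains_def Z_basis_eq)
  have "(THE a. keys a \<subseteq> Z_basis G F k \<and> ev k c = lin_ext (chain F k) (\<lambda>y. y) a) = push c"
  proof (rule the_equality)
    show "keys (push c) \<subseteq> Z_basis G F k \<and> ev k c = lin_ext (chain F k) (\<lambda>y. y) (push c)"
      using kp ev_pull[OF kp] pull_push[OF c] by simp
    fix a assume a: "keys a \<subseteq> Z_basis G F k \<and> ev k c = lin_ext (chain F k) (\<lambda>y. y) a"
    then have "ev k c = ev k (pull a)" using ev_pull by simp
    then have "c = pull a" using a pull_chain c by (intro ev_inj[of _ k]) auto
    then show "a = push c" using push_pull a by simp
  qed
  then have "supp G F k (ev k c) = keys (push c)" unfolding supp_def lin_ext_def by simp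
  moreover have "elt k ` keys c \<subseteq> keys (push c)"
  proof
    fix z assume "z \<in> elt k ` keys c"
    then obtain y where y: "y \<in> keys c" "z = elt k y" by blast
    then have "y \<in> iz ` keys (push c)" using keys_pull[of "push c"] pull_push[OF c] by auto
    then obtain z' where z': "z' \<in> keys (push c)" "y = iz z'" by blast
    then have "z' \<in> elt k ` Y k" using kp by (auto simp: Z_basis_eq)
    then show "z \<in> keys (push c)" using y z' iz by auto
  qed
  ultimately show ?thesis using keys_push by blast
qed

lemma gens_closed: "x \<in> gens F k \<Longrightarrow> x \<in> carrier (chain F k)"
  using chain_basis[of k] by (auto simp: module_basis_def)

lemma h_finite: "c \<in> carrier (chain F k) \<Longrightarrow> finite (h k c)"
  using ctrl unfolding control_map_def by blast

lemma h_elt: "\<lbrakk>g \<in> carrier G; x \<in> gens F k\<rbrakk> \<Longrightarrow> h k (elt k (g, (k, x))) = \<rho> g ` h k x"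
  using ctrl gens_closed unfolding control_map_def by (simp add: elt_eq)

lemma h_ev:
  assumes "c \<in> chains Y k"
  shows "h k (ev k c) = (\<Union>y\<in>keys c. h k (elt k y))"
proof -
  have "h k (ev k c) = (\<Union>y\<in>supp G F k (ev k c). h k y)"
    using ctrl ev_closed[OF assms] unfolding control_map_def by blast
  then show ?thesis by (simp add: supp_ev[OF assms])
qed

definition base_point :: "nat \<Rightarrow> 'f \<Rightarrow> 'm" where
  "base_point k x = (SOME p. p \<in> h k x)"

lemma base_point: "x \<in> gens F k \<Longrightarrow> base_point k x \<in> h k x"
  using ctrl unfolding control_map_def base_point_def by (meson ex_in_conv someI)

text \<open>One point of each control set, chosen on the generators and transported by
  \<open>G\<close>. Up to degree \<open>n\<close> the control sets lie within a uniform distance of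
  it, so passing to single points changes valuations by a bounded amount.\<close>

definition \<pi> :: "'g \<times> (nat \<times> 'f) \<Rightarrow> 'm" where
  "\<pi> y = \<rho> (fst y) (base_point (fst (snd y)) (snd (snd y)))"

lemma \<pi>_in: "y \<in> Y k \<Longrightarrow> \<pi> y \<in> h k (elt k y)"
  using h_elt base_point by (auto simp: Y_of_def \<pi>_def)

lemma finite_gens_le: "k \<le> n \<Longrightarrow> finite (gens F k)"
  using fg finite_gens by (auto simp: fg_skeleton_def)

sublocale ctl: controlled_complex G "left_shift G" Y bd \<rho> \<pi> n
proof (intro controlled_complex.intro controlled_complex_axioms.intro)
  show "free_complex G (left_shift G) Y bd" by (rule cx.free_complex_axioms)
  show "\<pi> (left_shift G g y) = \<rho> g (\<pi> y)" if "g \<in> carrier G" "y \<in> Y k" for g y k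
    using that by (auto simp: \<pi>_def Y_of_def \<rho>_mult)
  show "orbit_finite G (left_shift G) (Y k)" if "k \<le> n" for k
    unfolding orbit_finite_def
  proof (intro exI conjI ballI)
    show "finite ({\<one>} \<times> ({k} \<times> gens F k))" using finite_gens_le[OF that] by simp
    show "{\<one>} \<times> ({k} \<times> gens F k) \<subseteq> Y k" by (auto simp: Y_of_def)
    fix y assume "y \<in> Y k"
    then obtain g x where y: "y = (g, (k, x))" "g \<in> carrier G" "x \<in> gens F k" by (auto simp: Y_of_def)
    show "\<exists>g\<in>carrier G. \<exists>x\<in>{\<one>} \<times> ({k} \<times> gens F k). y = left_shift G g x"
      by (rule bexI[OF _ y(2)], rule bexI[of _ "(\<one>, (k, x))"]) (use y in auto)
  qed
qed (simp_all add: \<rho>_dist \<rho>_one \<rho>_mult)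

lemma h_diameter:
  obtains \<Delta> where "\<Delta> \<ge> 0" "\<forall>k\<le>n. \<forall>y\<in>Y k. \<forall>p\<in>h k (elt k y). dist (\<pi> y) p \<le> \<Delta>"
proof -
  have "\<exists>\<Delta>. \<forall>k\<le>n. \<forall>x\<in>gens F k. \<forall>p\<in>h k x. dist (base_point k x) p \<le> \<Delta>"
  proof (rule uniform_bound)
    fix k assume k: "k \<le> n"
    define B where "B = (\<Union>x\<in>gens F k. dist (base_point k x) ` h k x)"
    have fB: "finite B" unfolding B_def using finite_gens_le[OF k] h_finite gens_closed by auto
    show "\<exists>\<Delta>. \<forall>x\<in>gens F k. \<forall>p\<in>h k x. dist (base_point k x) p \<le> \<Delta>"
      by (rule exI[of _ "Max (insert 0 B)"]) (use fB in \<open>auto simp: B_def intro!: Max_ge\<close>)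
  qed force
  then obtain \<Delta> where \<Delta>: "\<forall>k\<le>n. \<forall>x\<in>gens F k. \<forall>p\<in>h k x. dist (base_point k x) p \<le> \<Delta>" by blast
  show ?thesis
  proof (rule that[of "max 0 \<Delta>"])
    show "\<forall>k\<le>n. \<forall>y\<in>Y k. \<forall>p\<in>h k (elt k y). dist (\<pi> y) p \<le> max 0 \<Delta>"
    proof (intro allI impI ballI)
      fix k y p assume k: "k \<le> n" and y: "y \<in> Y k" and p: "p \<in> h k (elt k y)"
      obtain g x where gx: "y = (g, (k, x))" "g \<in> carrier G" "x \<in> gens F k" using y by (auto simp: Y_of_def)
      then obtain p' where "p' \<in> h k x" "p = \<rho> g p'" using p h_elt by auto
      then show "dist (\<pi> y) p \<le> max 0 \<Delta>" using \<Delta> k gx by (force simp: \<pi>_def \<rho>_dist)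
    qed
  qed simp
qed

lemma valuation_geD:
  assumes c: "c \<in> chains Y k" and v: "valuation F h \<gamma> k (ev k c) \<ge> ereal s" and y: "y \<in> keys c"
  shows "s \<le> busemann \<gamma> (\<pi> y)"
proof -
  have "c \<noteq> 0" using y by auto
  then have v': "s \<le> Min (busemann \<gamma> ` h k (ev k c))"
    using v ev_eq_0[OF c] by (simp add: valuation_def)
  have "\<pi> y \<in> h k (ev k c)" unfolding h_ev[OF c]
    by (rule UN_I[OF y], rule \<pi>_in) (use y c in \<open>auto simp: chains_def\<close>)
  then have "Min (busemann \<gamma> ` h k (ev k c)) \<le> busemann \<gamma> (\<pi> y)"
    using h_finite[OF ev_closed[OF c]] by (intro Min_le) auto
  then show ?thesis using v' by simp
qed

text \<open>Valuations are minima over control sets, which lie within \<Delta> of the points \<pi>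
  y, and Busemann functions are 1-Lipschitz. The converse passage, \<open>valuation_geD\<close>,
  costs nothing because \<pi> y belongs to the control set.\<close>

lemma valuation_geI:
  assumes \<Delta>: "\<forall>k\<le>n. \<forall>y\<in>Y k. \<forall>p\<in>h k (elt k y). dist (\<pi> y) p \<le> \<Delta>" and k: "k \<le> n"
    and \<gamma>: "geodesic_ray \<gamma>" and c: "c \<in> chains Y k" and s: "\<And>y. y \<in> keys c \<Longrightarrow> s \<le> busemann \<gamma> (\<pi> y)"
  shows "valuation F h \<gamma> k (ev k c) \<ge> ereal (s - \<Delta>)"
proof (cases "c = 0")
  case True
  then show ?thesis by (simp add: valuation_def ev_0)
next
  case False
  then obtain y0 where y0: "y0 \<in> keys c" by (metis ex_in_conv keys_eq_empty)
  have "s - \<Delta> \<le> Min (busemann \<gamma> ` h k (ev k c))"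
  proof (rule Min.boundedI)
    show "finite (busemann \<gamma> ` h k (ev k c))" using h_finite[OF ev_closed[OF c]] by simp
    have "\<pi> y0 \<in> h k (ev k c)" unfolding h_ev[OF c]
    by (rule UN_I[OF y0], rule \<pi>_in) (use y0 c in \<open>auto simp: chains_def\<close>)
    then show "busemann \<gamma> ` h k (ev k c) \<noteq> {}" by blast
    fix v assume "v \<in> busemann \<gamma> ` h k (ev k c)"
    then obtain y p where yp: "y \<in> keys c" "p \<in> h k (elt k y)" "v = busemann \<gamma> p"
      unfolding h_ev[OF c] by blast
    have "dist (\<pi> y) p \<le> \<Delta>" using \<Delta> k yp c by (auto simp: chains_def)
    then show "s - \<Delta> \<le> v" using s[OF yp(1)] busemann_lipschitz[OF \<gamma>, of "\<pi> y" p] yp(3) by linarith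
  qed
  then show ?thesis using False ev_eq_0[OF c] by (simp add: valuation_def)
qed

text \<open>A filling \<open>c'\<close> of the boundary of \<open>w\<close>, or in degree 0 another
  lift, differs from \<open>w\<close> by a boundary, which gives the form
  \<open>w + d \<tau>\<close>. From the lag one number \<open>s\<close> with
  \<open>t \<le> s - lag s\<close> is taken; it exists by the limit condition.\<close>

lemma acyclic_along_ray_if_CA:
  assumes \<gamma>: "geodesic_ray \<gamma>" and ca: "\<And>k. \<lbrakk>-1 \<le> k; k < int n\<rbrakk> \<Longrightarrow> CA_along k A F h \<gamma>" and m: "m \<le> n"
  shows "\<exists>s. \<forall>w\<in>chains Y m. (\<forall>y\<in>keys (frag_extend bd w). s \<le> busemann \<gamma> (\<pi> y)) \<longrightarrow>
      (\<exists>\<tau>\<in>chains Y (Suc m). \<forall>y\<in>keys (w + frag_extend bd \<tau>). t \<le> busemann \<gamma> (\<pi> y))"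
proof -
  obtain \<Delta> where \<Delta>: "\<Delta> \<ge> 0" "\<forall>k\<le>n. \<forall>y\<in>Y k. \<forall>p\<in>h k (elt k y). dist (\<pi> y) p \<le> \<Delta>" by (rule h_diameter)
  show ?thesis
  proof (cases m)
    case 0
    obtain lag where lag: "filterlim (\<lambda>s. s - lag s :: real) at_top at_top"
      "\<And>s z. z \<in> carrier A \<Longrightarrow> \<exists>c\<in>carrier (chain F 0). aug F c = z \<and> valuation F h \<gamma> 0 c \<ge> ereal (s - lag s)"
      using ca[of "-1"] by (auto simp: CA_along_def)
    have "\<forall>\<^sub>F s in at_top. t \<le> s - lag s" using lag(1) by (simp add: filterlim_at_top)
    then have "\<exists>s. t \<le> s - lag s" by (rule eventually_happens'[rotated]) simp
    then obtain s where s: "t \<le> s - lag s" ..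
    have "\<exists>\<tau>\<in>chains Y (Suc 0). \<forall>y\<in>keys (w + frag_extend bd \<tau>). t \<le> busemann \<gamma> (\<pi> y)"
      if w: "w \<in> chains Y 0" for w
    proof -
      obtain c where c: "c \<in> carrier (chain F 0)" "aug F c = augm w" "valuation F h \<gamma> 0 c \<ge> ereal (s - lag s)"
        using lag(2)[OF augm_closed[OF w]] by blast
      obtain c' where c': "c' \<in> chains Y 0" "ev 0 c' = c" using ev_surj[OF c(1)] by blast
      have "augm c' = augm w" using c c' by (simp add: augm_def)
      then obtain \<tau> where \<tau>: "\<tau> \<in> chains Y (Suc 0)" "frag_extend bd \<tau> = c' - w"
        using augm_eq_iff[OF c'(1) w] by blast
      have "t \<le> busemann \<gamma> (\<pi> y)" if "y \<in> keys c'" for y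
        using valuation_geD[OF c'(1) _ that] c(3) c'(2) s by fastforce
      then show ?thesis using \<tau> by (intro bexI[of _ \<tau>]) auto
    qed
    then show ?thesis using 0 by blast
  next
    case (Suc i)
    obtain lag where lag: "filterlim (\<lambda>s. s - lag s :: real) at_top at_top"
      "\<And>s z. \<lbrakk>z \<in> cycles A F i; valuation F h \<gamma> i z \<ge> ereal s\<rbrakk> \<Longrightarrow>
        \<exists>c\<in>carrier (chain F (Suc i)). bdr F i c = z \<and> valuation F h \<gamma> (Suc i) c \<ge> ereal (s - lag s)"
      using ca[of "int i"] Suc m by (auto simp: CA_along_def)
    have "\<forall>\<^sub>F s in at_top. t \<le> s - lag s" using lag(1) by (simp add: filterlim_at_top)
    then have "\<exists>s. t \<le> s - lag s" by (rule eventually_happens'[rotated]) simp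
    then obtain s where s: "t \<le> s - lag s" ..
    have "\<exists>\<tau>\<in>chains Y (Suc m). \<forall>y\<in>keys (w + frag_extend bd \<tau>). t \<le> busemann \<gamma> (\<pi> y)"
      if w: "w \<in> chains Y m" and dw: "\<forall>y\<in>keys (frag_extend bd w). s + \<Delta> \<le> busemann \<gamma> (\<pi> y)" for w
    proof -
      have w': "w \<in> chains Y (Suc i)" using w Suc by simp
      have dC: "frag_extend bd w \<in> chains Y i" by (rule ext_bd_closed[OF w'])
      \<comment> \<open>The threshold is \<open>s + \<Delta>\<close>, because passing from the
        points \<pi> y to the valuation loses \<Delta>.\<close>
      have "valuation F h \<gamma> i (ev i (frag_extend bd w)) \<ge> ereal (s + \<Delta> - \<Delta>)"
        by (rule valuation_geI[OF \<Delta>(2) _ \<gamma> dC]) (use dw m Suc in auto)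
      moreover have "ev i (frag_extend bd w) \<in> cycles A F i"
        using bdr_image[of i] ev_bd[OF w'] ev_closed[OF w'] by auto
      ultimately obtain c where c: "c \<in> carrier (chain F (Suc i))" "bdr F i c = ev i (frag_extend bd w)"
          "valuation F h \<gamma> (Suc i) c \<ge> ereal (s - lag s)"
        using lag(2)[of "ev i (frag_extend bd w)" s] by auto
      obtain c' where c': "c' \<in> chains Y (Suc i)" "ev (Suc i) c' = c" using ev_surj[OF c(1)] by blast
      have "frag_extend bd c' = frag_extend bd w"
        using ev_inj[OF ext_bd_closed[OF c'(1)] dC] ev_bd[OF c'(1)] c c' by simp
      then have "frag_extend bd (c' - w) = 0" by (simp add: frag_extend_diff)
      then obtain \<tau> where \<tau>: "\<tau> \<in> chains Y (Suc (Suc i))" "frag_extend bd \<tau> = c' - w"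
        using cx.exact[of "c' - w" i] chains_diff[OF c'(1) w'] by blast
      have "t \<le> busemann \<gamma> (\<pi> y)" if "y \<in> keys c'" for y
        using valuation_geD[OF c'(1) _ that] c(3) c'(2) s by fastforce
      then show ?thesis using \<tau> Suc by (intro bexI[of _ \<tau>]) auto
    qed
    then show ?thesis by blast
  qed
qed

text \<open>By exactness a cycle is the boundary of some chain \<open>w\<close>, possibly of very
  low valuation; \<open>ac\<close> replaces \<open>w\<close> by \<open>w + d \<tau>\<close> with the
  same boundary and a controlled valuation. The lag is the constant \<Lambda> + \<Delta>.\<close>

lemma CA_if_acyclic_along_ray:
  assumes \<gamma>: "geodesic_ray \<gamma>" and \<Lambda>: "\<Lambda> \<ge> 0"
    and ac: "\<And>s m w. \<lbrakk>m \<le> n; w \<in> chains Y m; \<And>y. y \<in> keys (frag_extend bd w) \<Longrightarrow> s \<le> busemann \<gamma> (\<pi> y)\<rbrakk> \<Longrightarrow>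
      \<exists>\<tau>\<in>chains Y (Suc m). \<forall>y\<in>keys (w + frag_extend bd \<tau>). s - \<Lambda> \<le> busemann \<gamma> (\<pi> y)"
    and k: "k < int n"
  shows "CA_along k A F h \<gamma>"
proof -
  obtain \<Delta> where \<Delta>: "\<Delta> \<ge> 0" "\<forall>k\<le>n. \<forall>y\<in>Y k. \<forall>p\<in>h k (elt k y). dist (\<pi> y) p \<le> \<Delta>" by (rule h_diameter)
  have v: "valuation F h \<gamma> j (ev j c) \<ge> ereal (s - (\<Lambda> + \<Delta>))"
    if "j \<le> n" "c \<in> chains Y j" "\<forall>y\<in>keys c. s - \<Lambda> \<le> busemann \<gamma> (\<pi> y)" for j c s
    using valuation_geI[OF \<Delta>(2) that(1) \<gamma> that(2), of "s - \<Lambda>"] that(3) by (simp add: diff_diff_eq)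
  have 1: "\<exists>c\<in>carrier (chain F 0). aug F c = z \<and> valuation F h \<gamma> 0 c \<ge> ereal (s - (\<Lambda> + \<Delta>))"
    if z: "z \<in> carrier A" for z s
  proof -
    obtain w where w: "w \<in> chains Y 0" "augm w = z" using augm_surj[OF z] by blast
    obtain \<tau> where \<tau>: "\<tau> \<in> chains Y (Suc 0)" "\<forall>y\<in>keys (w + frag_extend bd \<tau>). s - \<Lambda> \<le> busemann \<gamma> (\<pi> y)"
      using ac[of 0 w s] w(1) cx.d_zero[OF w(1)] by auto
    have c: "w + frag_extend bd \<tau> \<in> chains Y 0" using w(1) ext_bd_closed[OF \<tau>(1)] by (rule chains_add)
    have "augm (w + frag_extend bd \<tau>) = augm w"
      using augm_eq_iff[OF c w(1)] \<tau>(1) by auto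
    then show ?thesis using v[OF _ c \<tau>(2)] ev_closed[OF c] w(2)
      by (intro bexI[of _ "ev 0 (w + frag_extend bd \<tau>)"]) (auto simp: augm_def)
  qed
  have 2: "\<exists>c\<in>carrier (chain F (Suc i)). bdr F i c = z \<and> valuation F h \<gamma> (Suc i) c \<ge> ereal (s - (\<Lambda> + \<Delta>))"
    if i: "int i \<le> k" and z: "z \<in> cycles A F i" and vz: "valuation F h \<gamma> i z \<ge> ereal s" for i z s
  proof -
    have "z \<in> bdr F i ` carrier (chain F (Suc i))" using z bdr_image by simp
    then obtain m where m: "m \<in> carrier (chain F (Suc i))" "z = bdr F i m" by (rule imageE)
    obtain w where w: "w \<in> chains Y (Suc i)" "ev (Suc i) w = m" using ev_surj[OF m(1)] by blast
    have zw: "ev i (frag_extend bd w) = z" using ev_bd[OF w(1)] w m by simp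
    have Si: "Suc i \<le> n" using i k by simp
    have "s \<le> busemann \<gamma> (\<pi> y)" if "y \<in> keys (frag_extend bd w)" for y
      using valuation_geD[OF ext_bd_closed[OF w(1)] _ that] vz zw by simp
    then obtain \<tau> where \<tau>: "\<tau> \<in> chains Y (Suc (Suc i))"
        "\<forall>y\<in>keys (w + frag_extend bd \<tau>). s - \<Lambda> \<le> busemann \<gamma> (\<pi> y)"
      using ac[OF Si w(1)] by blast
    have c: "w + frag_extend bd \<tau> \<in> chains Y (Suc i)" using w(1) ext_bd_closed[OF \<tau>(1)] by (rule chains_add)
    have "bdr F i (ev (Suc i) (w + frag_extend bd \<tau>)) = z"
      using ev_bd[OF c] cx.d_d[OF \<tau>(1)] zw by (simp add: frag_extend_add)
    then show ?thesis using v[OF Si c \<tau>(2)] ev_closed[OF c] by blast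
  qed
  have lim: "filterlim (\<lambda>s::real. s - (\<Lambda> + \<Delta>)) at_top at_top"
    unfolding filterlim_at_top
  proof
    fix Z :: real
    show "\<forall>\<^sub>F s in at_top. Z \<le> s - (\<Lambda> + \<Delta>)"
      using eventually_ge_at_top[of "Z + (\<Lambda> + \<Delta>)"] by eventually_elim simp
  qed
  show ?thesis unfolding CA_along_def
    by (rule exI[of _ "\<lambda>_. \<Lambda> + \<Delta>"]) (use 1 2 lim \<Lambda> \<Delta>(1) in auto)
qed

end

section \<open>Building resolutions over a subgroup\<close>

lemma ex_inj_pair_infinite:
  assumes "infinite (UNIV :: 'u set)"
  shows "\<exists>p :: 'u \<times> 'u \<Rightarrow> 'u. inj p"
proof -
  have "(card_of (UNIV \<times> UNIV :: ('u \<times> 'u) set), card_of (UNIV :: 'u set)) \<in> ordIso"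
    using card_of_Times_same_infinite[OF assms] by simp
  then obtain p :: "'u \<times> 'u \<Rightarrow> 'u" where "bij_betw p (UNIV \<times> UNIV) UNIV"
    using card_of_ordIso by blast
  then show ?thesis by (auto simp: bij_betw_def)
qed

text \<open>Nested pairs determine a list only when its length is known, so the length is encoded
  along with them.\<close>

lemma ex_inj_list_infinite:
  assumes "infinite (UNIV :: 'u set)"
  shows "\<exists>f :: 'u list \<Rightarrow> 'u. inj f"
proof -
  obtain p :: "'u \<times> 'u \<Rightarrow> 'u" where p: "inj p" using ex_inj_pair_infinite[OF assms] by blast
  obtain i :: "nat \<Rightarrow> 'u" where i: "inj i" using infinite_countable_subset[OF assms] by blast
  define en where "en xs = foldr (\<lambda>x a. p (x, a)) xs undefined" for xs
  have en: "xs = ys" if "length xs = length ys" "en xs = en ys" for xs ys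
    using that by (induction xs ys rule: list_induct2) (auto simp: en_def dest: injD[OF p])
  have "inj (\<lambda>xs. p (i (length xs), en xs))"
    by (rule injI) (auto dest!: injD[OF p] injD[OF i] intro: en)
  then show ?thesis by blast
qed

text \<open>A chain is encoded by a list of its keys with their coefficients, in any order; the set
  of entries still determines the chain.\<close>

lemma ex_inj_frag_infinite:
  assumes inf: "infinite (UNIV :: 'u set)" and f: "inj (f :: 'x \<Rightarrow> 'u)"
  shows "\<exists>j :: ('x \<Rightarrow>\<^sub>0 int) \<Rightarrow> 'u. inj j"
proof -
  obtain p :: "'u \<times> 'u \<Rightarrow> 'u" where p: "inj p" using ex_inj_pair_infinite[OF inf] by blast
  obtain i :: "nat \<Rightarrow> 'u" where i: "inj i" using infinite_countable_subset[OF inf] by blast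
  obtain l :: "'u list \<Rightarrow> 'u" where l: "inj l" using ex_inj_list_infinite[OF inf] by blast
  define q where "q c x = p (f x, i (to_nat (Poly_Mapping.lookup c x)))" for c :: "'x \<Rightarrow>\<^sub>0 int" and x
  have "\<exists>xs. set xs = q c ` keys c" for c by (rule finite_list) simp
  then obtain L where L: "\<And>c. set (L c) = q c ` keys c" by metis
  have "inj L"
  proof (rule injI)
    fix c c' assume "L c = L c'"
    then have eq: "q c ` keys c = q c' ` keys c'" using L by metis
    have sub: "x \<in> keys b \<and> Poly_Mapping.lookup a x = Poly_Mapping.lookup b x"
      if "q a ` keys a = q b ` keys b" "x \<in> keys a" for a b x
    proof -
      have "q a x \<in> q b ` keys b" using that by auto
      then obtain y where y: "y \<in> keys b" "q a x = q b y" by auto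
      then have "f x = f y" "to_nat (Poly_Mapping.lookup a x) = to_nat (Poly_Mapping.lookup b y)"
        by (auto simp: q_def dest!: injD[OF p] injD[OF i])
      then show ?thesis using y injD[OF f] by auto
    qed
    show "c = c'"
    proof (rule poly_mapping_eqI)
      fix x show "Poly_Mapping.lookup c x = Poly_Mapping.lookup c' x"
      proof (cases "x \<in> keys c")
        case True
        then show ?thesis using sub[OF eq] by blast
      next
        case False
        then have "x \<notin> keys c'" using sub[OF eq[symmetric]] by blast
        then show ?thesis using False unfolding in_keys_iff by simp
      qed
    qed
  qed
  then have "inj (l \<circ> L)" by (rule inj_compose[OF l])
  then show ?thesis by blast
qed

text \<open>Basis elements of the next degree will be named by their boundaries, which are chains
  over the names in use. This injection turns such chains into names of the same type, so that the
  construction can go on in all degrees.\<close>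

lemma ex_inj_tuple_chains:
  "\<exists>j :: ('g \<times> (nat \<times> ('g \<times> nat)) \<Rightarrow>\<^sub>0 int) \<Rightarrow> 'g \<times> nat. inj j"
proof -
  have inf: "infinite (UNIV :: ('g \<times> nat) set)"
    by (simp add: finite_prod)
  obtain p :: "('g \<times> nat) \<times> ('g \<times> nat) \<Rightarrow> 'g \<times> nat" where p: "inj p" using ex_inj_pair_infinite[OF inf] by blast
  define f where "f y = p ((fst y, fst (snd y)), snd (snd y))" for y :: "'g \<times> (nat \<times> ('g \<times> nat))"
  have "inj f" by (rule injI) (auto simp: f_def dest!: injD[OF p])
  then show ?thesis by (rule ex_inj_frag_infinite[OF inf])
qed

lemma smult_zero_right:
  fixes M :: "('r, 'f) module"
  assumes "left_module R M" "a \<in> carrier R"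
  shows "a \<odot>\<^bsub>M\<^esub> \<zero>\<^bsub>M\<^esub> = \<zero>\<^bsub>M\<^esub>"
proof -
  interpret left_module R M by fact
  let ?z = "a \<odot>\<^bsub>M\<^esub> \<zero>\<^bsub>M\<^esub>"
  have z: "?z \<in> carrier M" using assms(2) by simp
  have eq: "?z \<oplus>\<^bsub>M\<^esub> ?z = ?z" using smult_r_distr[OF assms(2), of "\<zero>\<^bsub>M\<^esub>" "\<zero>\<^bsub>M\<^esub>"] by simp
  have "?z = (?z \<oplus>\<^bsub>M\<^esub> ?z) \<oplus>\<^bsub>M\<^esub> \<ominus>\<^bsub>M\<^esub> ?z" using z by (simp add: M.a_assoc M.r_neg)
  then show ?thesis unfolding eq using z by (simp add: M.r_neg)
qed

section \<open>Resolutions prescribed by the boundaries of their basis elements\<close>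

definition tuple_bd ::
    "('g, 'b) monoid_scheme \<Rightarrow> (nat \<Rightarrow> 's \<Rightarrow> ('g \<times> (nat \<times> 's)) \<Rightarrow>\<^sub>0 int) \<Rightarrow>
     ('g \<times> (nat \<times> 's)) \<Rightarrow> ('g \<times> (nat \<times> 's)) \<Rightarrow>\<^sub>0 int" where
  "tuple_bd G e y = translate (left_shift G) (fst y) (e (fst (snd y)) (snd (snd y)))"

definition tuple_aug ::
    "('g \<Rightarrow>\<^sub>0 int, 'a) module \<Rightarrow> ('s \<Rightarrow> 'a) \<Rightarrow> (('g \<times> (nat \<times> 's)) \<Rightarrow>\<^sub>0 int) \<Rightarrow> 'a" where
  "tuple_aug A a0 = lin_ext A (\<lambda>y. frag_of (fst y) \<odot>\<^bsub>A\<^esub> a0 (snd (snd y)))"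

text \<open>When \<open>e 0\<close> is zero, the boundary condition is empty in degree 0, and the
  augmentation takes its place.\<close>

definition tuple_cycles ::
    "('g, 'b) monoid_scheme \<Rightarrow> ('g \<Rightarrow>\<^sub>0 int, 'a) module \<Rightarrow> (nat \<Rightarrow> 's set) \<Rightarrow>
     (nat \<Rightarrow> 's \<Rightarrow> ('g \<times> (nat \<times> 's)) \<Rightarrow>\<^sub>0 int) \<Rightarrow> ('s \<Rightarrow> 'a) \<Rightarrow> nat \<Rightarrow> (('g \<times> (nat \<times> 's)) \<Rightarrow>\<^sub>0 int) set" where
  "tuple_cycles G A S e a0 k = {c \<in> chains (Y_of G S) k.
     frag_extend (tuple_bd G e) c = 0 \<and> (k = 0 \<longrightarrow> tuple_aug A a0 c = \<zero>\<^bsub>A\<^esub>)}"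

text \<open>\<open>e k s\<close> is the boundary of the basis element \<open>s\<close> of degree \<open>k\<close> and \<open>a0 s\<close> its
  augmentation in degree \<open>0\<close>.\<close>

locale tuple_resolution = group G for G :: "('g, 'b) monoid_scheme" (structure) +
  fixes A :: "('g \<Rightarrow>\<^sub>0 int, 'a) module" and S :: "nat \<Rightarrow> 's set"
    and e :: "nat \<Rightarrow> 's \<Rightarrow> ('g \<times> (nat \<times> 's)) \<Rightarrow>\<^sub>0 int" and a0 :: "'s \<Rightarrow> 'a"
  assumes A_module: "left_module (group_ring G) A"
    and a0_closed: "s \<in> S 0 \<Longrightarrow> a0 s \<in> carrier A"
    and a0_nonzero: "s \<in> S 0 \<Longrightarrow> a0 s \<noteq> \<zero>\<^bsub>A\<^esub>"
    and a0_generates: "a \<in> carrier A \<Longrightarrow> \<exists>c\<in>chains (Y_of G S) 0. tuple_aug A a0 c = a"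
    and e_0: "e 0 s = 0"
    and e_cycle: "s \<in> S (Suc k) \<Longrightarrow> e (Suc k) s \<in> tuple_cycles G A S e a0 k"
    and e_nonzero: "s \<in> S (Suc k) \<Longrightarrow> e (Suc k) s \<noteq> 0"
    and cycles_span: "tuple_cycles G A S e a0 k \<subseteq> translate_span G (left_shift G) (e (Suc k) ` S (Suc k))"
begin

abbreviation Y where "Y \<equiv> Y_of G S"
abbreviation bd where "bd \<equiv> tuple_bd G e"
abbreviation augm where "augm \<equiv> tuple_aug A a0"
abbreviation cyc where "cyc \<equiv> tuple_cycles G A S e a0"

lemma e_closed: "s \<in> S (Suc k) \<Longrightarrow> e (Suc k) s \<in> chains Y k"
  using e_cycle by (simp add: tuple_cycles_def)

lemma shift_closed: "\<lbrakk>g \<in> carrier G; c \<in> chains Y k\<rbrakk> \<Longrightarrow> translate (left_shift G) g c \<in> chains Y k"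
  unfolding translate_def by (erule chains_frag_extend) (simp add: left_shift_free_action)

lemma shift_mult: "\<lbrakk>g \<in> carrier G; g' \<in> carrier G; c \<in> chains Y k\<rbrakk> \<Longrightarrow>
    translate (left_shift G) (g \<otimes> g') c = translate (left_shift G) g (translate (left_shift G) g' c)"
  unfolding translate_def frag_extend_frag_extend
  by (erule frag_extend_eq_on_chains) (simp add: left_shift_free_action)

lemma bd_act: "\<lbrakk>g \<in> carrier G; y \<in> Y k\<rbrakk> \<Longrightarrow> bd (left_shift G g y) = translate (left_shift G) g (bd y)"
proof -
  assume g: "g \<in> carrier G" and "y \<in> Y k"
  then obtain u s where y: "y = (u, (k, s))" "u \<in> carrier G" "s \<in> S k" by (auto simp: Y_of_def)
  show ?thesis
  proof (cases k)
    case 0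
    then show ?thesis using y by (simp add: tuple_bd_def e_0)
  next
    case (Suc j)
    then show ?thesis using y g shift_mult[OF g y(2) e_closed, of s j] by (simp add: tuple_bd_def)
  qed
qed

lemma span_boundary: "c \<in> translate_span G (left_shift G) (e (Suc k) ` S (Suc k)) \<Longrightarrow>
    \<exists>w\<in>chains Y (Suc k). frag_extend bd w = c"
proof (induction rule: translate_span.induct)
  case zero
  show ?case by (rule bexI[of _ 0]) auto
next
  case (gen x g)
  then obtain s where s: "s \<in> S (Suc k)" "x = e (Suc k) s" by auto
  show ?case
    by (rule bexI[of _ "frag_of (g, (Suc k, s))"]) (use s gen in \<open>auto simp: tuple_bd_def Y_of_def\<close>)
next
  case (diff a b)
  then obtain w w' where w: "w \<in> chains Y (Suc k)" "frag_extend bd w = a"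
    and w': "w' \<in> chains Y (Suc k)" "frag_extend bd w' = b" by blast
  then show ?case by (intro bexI[of _ "w - w'"]) (auto simp: frag_extend_diff intro: chains_diff)
qed

sublocale cx: free_complex G "left_shift G" Y bd
proof unfold_locales
  have b0: "bd y = 0" if "y \<in> Y 0" for y using that by (auto simp: tuple_bd_def Y_of_def e_0)
  have bS: "\<exists>g\<in>carrier G. \<exists>s\<in>S (Suc k). bd y = translate (left_shift G) g (e (Suc k) s)"
    if "y \<in> Y (Suc k)" for y k
  proof -
    have "fst y \<in> carrier G" "snd (snd y) \<in> S (Suc k)" "fst (snd y) = Suc k"
      using that by (auto simp: Y_of_def)
    then show ?thesis by (auto simp: tuple_bd_def)
  qed
  show "bd y = 0" if "y \<in> Y 0" for y using b0 that .
  show "bd y \<in> chains Y k" if "y \<in> Y (Suc k)" for y k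
    using bS[OF that] shift_closed e_closed by force
  show "frag_extend bd (bd y) = 0" if y: "y \<in> Y k" for y k
  proof (cases k)
    case 0
    then show ?thesis using y b0 by simp
  next
    case (Suc j)
    then obtain g s where gs: "g \<in> carrier G" "s \<in> S (Suc j)" "bd y = translate (left_shift G) g (e (Suc j) s)"
      using bS y by blast
    have "frag_extend bd (bd y) = translate (left_shift G) g (frag_extend bd (e (Suc j) s))"
      unfolding gs(3) by (rule frag_extend_translate[OF e_closed[OF gs(2)]]) (rule bd_act[OF gs(1)])
    then show ?thesis using e_cycle[OF gs(2)] by (simp add: tuple_cycles_def)
  qed
  show "\<exists>e\<in>chains Y (Suc (Suc k)). frag_extend bd e = c"
    if "c \<in> chains Y (Suc k)" "frag_extend bd c = 0" for c k
  proof -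
    have "c \<in> cyc (Suc k)" using that by (simp add: tuple_cycles_def)
    then show ?thesis using cycles_span span_boundary by blast
  qed
  show "i = j" if "y \<in> Y i" "y \<in> Y j" for y i j using that by (auto simp: Y_of_def)
qed (use left_shift_free_action bd_act in auto)

lemma A_abelian: "abelian_group A"
  using A_module by (rule left_module.axioms(2))

lemma augm_additive: "frag_additive A (Y 0) augm"
  unfolding tuple_aug_def
  by (rule lin_ext_additive[OF A_abelian])
    (use left_module.smult_closed[OF A_module] a0_closed in \<open>auto simp: Y_of_def\<close>)

lemma augm_frag_of: "\<lbrakk>g \<in> carrier G; s \<in> S 0\<rbrakk> \<Longrightarrow> augm (frag_of (g, (0, s))) = frag_of g \<odot>\<^bsub>A\<^esub> a0 s"
  using left_module.smult_closed[OF A_module] a0_closed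
  by (simp add: tuple_aug_def lin_ext_frag_of[OF A_abelian])

lemma augm_translate:
  assumes g: "g \<in> carrier G" and c: "c \<in> chains Y 0"
  shows "augm (translate (left_shift G) g c) = frag_of g \<odot>\<^bsub>A\<^esub> augm c"
proof (rule frag_additive_eq[OF A_abelian, where T = "Y 0"])
  show "frag_additive A (Y 0) (\<lambda>c. augm (translate (left_shift G) g c))" unfolding translate_def
    by (rule frag_additive_frag_extend[OF augm_additive]) (use g left_shift_free_action(1) in auto)
  show "frag_additive A (Y 0) (\<lambda>c. frag_of g \<odot>\<^bsub>A\<^esub> augm c)"
    by (rule frag_additive_hom[OF augm_additive])
      (use g left_module.smult_closed[OF A_module] left_module.smult_r_distr[OF A_module] in auto)
  show "keys c \<subseteq> Y 0" using c by (simp add: chains_def)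
  fix z assume "z \<in> Y 0"
  then obtain u t where z: "z = (u, (0, t))" "u \<in> carrier G" "t \<in> S 0" by (auto simp: Y_of_def)
  have "frag_of (g \<otimes> u) \<odot>\<^bsub>A\<^esub> a0 t = frag_of g \<odot>\<^bsub>A\<^esub> (frag_of u \<odot>\<^bsub>A\<^esub> a0 t)"
    using left_module.smult_assoc[OF A_module, of "frag_of g" "frag_of u" "a0 t"] g z a0_closed by simp
  then show "augm (translate (left_shift G) g (frag_of z)) = frag_of g \<odot>\<^bsub>A\<^esub> augm (frag_of z)"
    using g z by (simp add: augm_frag_of)
qed

lemma augm_boundary:
  assumes w: "w \<in> chains Y (Suc 0)"
  shows "augm (frag_extend bd w) = \<zero>\<^bsub>A\<^esub>"
proof -
  interpret abelian_group A by (rule A_abelian)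
  have "augm (frag_extend bd w) = lin_ext A (\<lambda>_. \<zero>\<^bsub>A\<^esub>) w"
  proof (rule frag_additive_eq[OF A_abelian, where T = "Y (Suc 0)"])
    show "frag_additive A (Y (Suc 0)) (\<lambda>w. augm (frag_extend bd w))"
      by (rule frag_additive_frag_extend[OF augm_additive]) (use cx.bd_closed[of _ 0] in \<open>auto simp: chains_def\<close>)
    show "frag_additive A (Y (Suc 0)) (lin_ext A (\<lambda>_. \<zero>\<^bsub>A\<^esub>))"
      by (rule lin_ext_additive[OF A_abelian]) auto
    show "keys w \<subseteq> Y (Suc 0)" using w by (simp add: chains_def)
    fix y assume "y \<in> Y (Suc 0)"
    then obtain g s where y: "y = (g, (Suc 0, s))" "g \<in> carrier G" "s \<in> S (Suc 0)" by (auto simp: Y_of_def)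
    have "augm (translate (left_shift G) g (e (Suc 0) s)) = frag_of g \<odot>\<^bsub>A\<^esub> augm (e (Suc 0) s)"
      by (rule augm_translate[OF y(2) e_closed[OF y(3)]])
    also have "augm (e (Suc 0) s) = \<zero>\<^bsub>A\<^esub>" using e_cycle[OF y(3)] by (simp add: tuple_cycles_def)
    also have "frag_of g \<odot>\<^bsub>A\<^esub> \<zero>\<^bsub>A\<^esub> = \<zero>\<^bsub>A\<^esub>"
      by (rule smult_zero_right[OF A_module]) (use y in simp)
    finally show "augm (frag_extend bd (frag_of y)) = lin_ext A (\<lambda>_. \<zero>\<^bsub>A\<^esub>) (frag_of y)"
      using y by (simp add: tuple_bd_def lin_ext_frag_of[OF A_abelian])
  qed
  also have "\<dots> = \<zero>\<^bsub>A\<^esub>" by (simp add: lin_ext_def)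
  finally show ?thesis .
qed

lemma cycles_eq_boundaries: "cyc k = frag_extend bd ` chains Y (Suc k)"
proof (intro equalityI subsetI)
  fix c assume "c \<in> cyc k"
  then have "c \<in> translate_span G (left_shift G) (e (Suc k) ` S (Suc k))" using cycles_span by blast
  then obtain w where "w \<in> chains Y (Suc k)" "frag_extend bd w = c" using span_boundary by blast
  then show "c \<in> frag_extend bd ` chains Y (Suc k)" by blast
next
  fix c assume "c \<in> frag_extend bd ` chains Y (Suc k)"
  then obtain w where w: "w \<in> chains Y (Suc k)" "c = frag_extend bd w" by blast
  then show "c \<in> cyc k" using cx.d_closed cx.d_d augm_boundary by (auto simp: tuple_cycles_def)
qed

end

text \<open>The type of the chains depends on the type of the names, whereas \<open>FP_type\<close>
  prescribes the type of the carriers. The injection \<iota> moves the chains to a given type, and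
  the operations are transported along it and its inverse \<kappa>.\<close>

locale transported_resolution = tuple_resolution G A S e a0
  for G :: "('g, 'b) monoid_scheme" (structure) and A :: "('g \<Rightarrow>\<^sub>0 int, 'a) module"
    and S :: "nat \<Rightarrow> 's set" and e a0 +
  fixes \<iota> :: "(('g \<times> (nat \<times> 's)) \<Rightarrow>\<^sub>0 int) \<Rightarrow> 'c"
  assumes inj_\<iota>: "inj \<iota>"
begin

definition \<kappa> where "\<kappa> = inv_into UNIV \<iota>"

lemma \<kappa>_\<iota> [simp]: "\<kappa> (\<iota> c) = c"
  by (simp add: \<kappa>_def inv_into_f_f[OF inj_\<iota>])

lemma \<iota>_eq [simp]: "\<iota> c = \<iota> c' \<longleftrightarrow> c = c'"
  using inj_\<iota> by (auto dest: injD)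

definition scale :: "('g \<Rightarrow>\<^sub>0 int) \<Rightarrow> ('g \<times> (nat \<times> 's) \<Rightarrow>\<^sub>0 int) \<Rightarrow> ('g \<times> (nat \<times> 's) \<Rightarrow>\<^sub>0 int)" where
  "scale r c = frag_extend (\<lambda>g. translate (left_shift G) g c) r"

definition chain_mod :: "nat \<Rightarrow> ('g \<Rightarrow>\<^sub>0 int, 'c) module" where
  "chain_mod k = \<lparr>carrier = \<iota> ` chains Y k, mult = (\<lambda>_ _. undefined), one = undefined,
     zero = \<iota> 0, add = (\<lambda>a b. \<iota> (\<kappa> a + \<kappa> b)), smult = (\<lambda>r a. \<iota> (scale r (\<kappa> a)))\<rparr>"

definition gen :: "nat \<Rightarrow> 's \<Rightarrow> 'c" where
  "gen k s = \<iota> (frag_of (\<one>, (k, s)))"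

definition resolution :: "('g, 'c, 'a) based_complex" where
  "resolution = \<lparr>chain = chain_mod, gens = (\<lambda>k. gen k ` S k),
     bdr = (\<lambda>k a. \<iota> (frag_extend bd (\<kappa> a))), aug = (\<lambda>a. augm (\<kappa> a))\<rparr>"

lemma chain_mod_simps [simp]:
  "carrier (chain_mod k) = \<iota> ` chains Y k" "\<zero>\<^bsub>chain_mod k\<^esub> = \<iota> 0"
  "a \<oplus>\<^bsub>chain_mod k\<^esub> b = \<iota> (\<kappa> a + \<kappa> b)" "r \<odot>\<^bsub>chain_mod k\<^esub> a = \<iota> (scale r (\<kappa> a))"
  by (simp_all add: chain_mod_def)

lemma resolution_simps [simp]:
  "chain resolution k = chain_mod k" "gens resolution k = gen k ` S k"
  "bdr resolution k a = \<iota> (frag_extend bd (\<kappa> a))" "aug resolution a = augm (\<kappa> a)"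
  by (simp_all add: resolution_def)

lemma scale_closed: "\<lbrakk>keys r \<subseteq> carrier G; c \<in> chains Y k\<rbrakk> \<Longrightarrow> scale r c \<in> chains Y k"
  unfolding scale_def
  by (rule chains_frag_extend[where Y = "\<lambda>_. carrier G" and k = k]) (auto simp: chains_def[of "\<lambda>_. carrier G"] shift_closed)

lemma scale_add: "scale (r + r') c = scale r c + scale r' c" "scale r (c + c') = scale r c + scale r c'"
  by (simp_all add: scale_def frag_extend_add frag_extend_fn_add)

lemma scale_frag_of: "scale (frag_of g) c = translate (left_shift G) g c"
  by (simp add: scale_def)

lemma scale_mult:
  assumes r: "keys r \<subseteq> carrier G" "keys r' \<subseteq> carrier G" and c: "c \<in> chains Y k"
  shows "scale (r \<otimes>\<^bsub>group_ring G\<^esub> r') c = scale r (scale r' c)"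
proof -
  have "scale (r \<otimes>\<^bsub>group_ring G\<^esub> r') c =
      frag_extend (\<lambda>g. frag_extend (\<lambda>g'. translate (left_shift G) (g \<otimes> g') c) r') r"
    by (simp add: scale_def group_ring_def frag_extend_frag_extend)
  also have "\<dots> = frag_extend (\<lambda>g. frag_extend (\<lambda>g'. translate (left_shift G) g (translate (left_shift G) g' c)) r') r"
    by (intro frag_extend_eq shift_mult[OF _ _ c]) (use r in auto)
  also have "\<dots> = scale r (scale r' c)"
    by (simp add: scale_def translate_def frag_extend_frag_extend)
  finally show ?thesis .
qed

lemma abelian_chain_mod: "abelian_group (chain_mod k)"
proof (rule abelian_groupI)
  fix x assume "x \<in> carrier (chain_mod k)"
  then obtain c where c: "c \<in> chains Y k" "x = \<iota> c" by auto
  then show "\<exists>y\<in>carrier (chain_mod k). y \<oplus>\<^bsub>chain_mod k\<^esub> x = \<zero>\<^bsub>chain_mod k\<^esub>"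
    by (intro bexI[of _ "\<iota> (- c)"]) (auto intro: chains_uminus)
qed (auto simp: add.assoc add.commute intro: chains_add)

lemma left_module_chain_mod: "left_module (group_ring G) (chain_mod k)"
proof (intro left_module.intro left_module_axioms.intro)
  show "ring (group_ring G)" by (rule ring_group_ring[OF is_group])
  show "abelian_group (chain_mod k)" by (rule abelian_chain_mod)
  fix x assume "x \<in> carrier (chain_mod k)"
  then obtain c where c: "c \<in> chains Y k" "x = \<iota> c" by auto
  show "\<one>\<^bsub>group_ring G\<^esub> \<odot>\<^bsub>chain_mod k\<^esub> x = x"
    using c cx.translate_one by (simp add: scale_frag_of)
  fix a assume a: "a \<in> carrier (group_ring G)"
  show "a \<odot>\<^bsub>chain_mod k\<^esub> x \<in> carrier (chain_mod k)"
    using a c scale_closed by (auto simp: carrier_group_ring)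
  fix b assume b: "b \<in> carrier (group_ring G)"
  show "(a \<otimes>\<^bsub>group_ring G\<^esub> b) \<odot>\<^bsub>chain_mod k\<^esub> x = a \<odot>\<^bsub>chain_mod k\<^esub> (b \<odot>\<^bsub>chain_mod k\<^esub> x)"
    using a b c scale_mult by (simp add: carrier_group_ring)
qed (auto simp: scale_add)

lemma finsum_chain_mod:
  assumes "finite T" "\<And>x. x \<in> T \<Longrightarrow> f x \<in> chains Y k"
  shows "(\<Oplus>\<^bsub>chain_mod k\<^esub>x\<in>T. \<iota> (f x)) = \<iota> (\<Sum>x\<in>T. f x)"
  using assms
proof (induction T rule: finite_induct)
  case empty
  interpret abelian_group "chain_mod k" by (rule abelian_chain_mod)
  show ?case by simp
next
  case (insert x T)
  interpret abelian_group "chain_mod k" by (rule abelian_chain_mod)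
  have "(\<Oplus>\<^bsub>chain_mod k\<^esub>x\<in>insert x T. \<iota> (f x)) = \<iota> (f x) \<oplus>\<^bsub>chain_mod k\<^esub> (\<Oplus>\<^bsub>chain_mod k\<^esub>x\<in>T. \<iota> (f x))"
    using insert by (intro finsum_insert) auto
  then show ?case using insert by simp
qed

definition emb :: "(nat \<times> 's) \<Rightarrow> ('g \<Rightarrow>\<^sub>0 int) \<Rightarrow> ('g \<times> (nat \<times> 's) \<Rightarrow>\<^sub>0 int)" where
  "emb z r = frag_extend (\<lambda>g. frag_of (g, z)) r"

lemma lookup_emb: "Poly_Mapping.lookup (emb z r) (g, z') = (if z' = z then Poly_Mapping.lookup r g else 0)"
  unfolding emb_def using subset_UNIV
  by (induction r rule: frag_induction) (auto simp: frag_extend_diff lookup_minus)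

lemma coefficient_emb: "coefficient z (emb z' r) = (if z = z' then r else 0)"
  by (rule poly_mapping_eqI) (simp add: lookup_coefficient lookup_emb)

lemma scale_gen: "keys r \<subseteq> carrier G \<Longrightarrow> scale r (frag_of (\<one>, z)) = emb z r"
  unfolding scale_def emb_def by (rule frag_extend_eq) auto

lemma emb_closed: "\<lbrakk>keys r \<subseteq> carrier G; s \<in> S k\<rbrakk> \<Longrightarrow> emb (k, s) r \<in> chains Y k"
  using scale_closed[of r "frag_of (\<one>, (k, s))" k] by (simp add: scale_gen Y_of_def)

lemma chain_decomposition:
  assumes c: "c \<in> chains Y k" and T: "finite T" "\<And>s. \<lbrakk>s \<in> S k; coefficient (k, s) c \<noteq> 0\<rbrakk> \<Longrightarrow> s \<in> T"
  shows "c = (\<Sum>s\<in>T. emb (k, s) (coefficient (k, s) c))"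
proof (rule poly_mapping_eqI)
  fix y :: "'g \<times> (nat \<times> 's)"
  obtain g j t where y: "y = (g, (j, t))" by (metis surj_pair)
  have "Poly_Mapping.lookup (\<Sum>s\<in>T. emb (k, s) (coefficient (k, s) c)) y =
      (\<Sum>s\<in>T. if (j, t) = (k, s) then Poly_Mapping.lookup c (g, (k, s)) else 0)"
    unfolding lookup_sum y by (intro sum.cong) (auto simp: lookup_emb lookup_coefficient)
  also have "\<dots> = (if j = k \<and> t \<in> T then Poly_Mapping.lookup c y else 0)"
  proof (cases "j = k")
    case True
    then have "(\<Sum>s\<in>T. if (j, t) = (k, s) then Poly_Mapping.lookup c (g, (k, s)) else 0) =
        (\<Sum>s\<in>T. if t = s then Poly_Mapping.lookup c (g, (k, s)) else 0)"
      by (intro sum.cong) auto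
    also have "\<dots> = (if t \<in> T then Poly_Mapping.lookup c (g, (k, t)) else 0)" using T(1) by (rule sum.delta')
    finally show ?thesis using True y by simp
  qed simp
  also have "\<dots> = Poly_Mapping.lookup c y"
  proof (cases "j = k \<and> t \<in> T")
    case False
    have "y \<notin> keys c"
    proof
      assume yc: "y \<in> keys c"
      then have jt: "j = k" "t \<in> S k" using c y by (auto simp: chains_def Y_of_def)
      have "Poly_Mapping.lookup (coefficient (k, t) c) g \<noteq> 0"
        using yc y jt by (simp add: lookup_coefficient in_keys_iff)
      then have "coefficient (k, t) c \<noteq> 0" by auto
      then show False using T(2) jt False by blast
    qed
    then show ?thesis using False by (auto simp: in_keys_iff)
  qed simp
  finally show "Poly_Mapping.lookup c y = Poly_Mapping.lookup (\<Sum>s\<in>T. emb (k, s) (coefficient (k, s) c)) y" ..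
qed

lemma gen_inj: "inj_on (gen k) (S k)"
  by (rule inj_onI) (simp add: gen_def frag_of_eq)

lemma finsum_gens:
  assumes T: "finite T" "T \<subseteq> S k" and a: "\<And>s. s \<in> T \<Longrightarrow> keys (a (gen k s)) \<subseteq> carrier G"
  shows "(\<Oplus>\<^bsub>chain_mod k\<^esub>x\<in>gen k ` T. a x \<odot>\<^bsub>chain_mod k\<^esub> x) = \<iota> (\<Sum>s\<in>T. emb (k, s) (a (gen k s)))"
proof -
  interpret abelian_group "chain_mod k" by (rule abelian_chain_mod)
  have eq: "a (gen k s) \<odot>\<^bsub>chain_mod k\<^esub> gen k s = \<iota> (emb (k, s) (a (gen k s)))" if "s \<in> T" for s
    using scale_gen[OF a[OF that]] by (simp add: gen_def)
  have cl: "emb (k, s) (a (gen k s)) \<in> chains Y k" if "s \<in> T" for s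
    using emb_closed[OF a[OF that]] T(2) that by blast
  have "(\<Oplus>\<^bsub>chain_mod k\<^esub>x\<in>gen k ` T. a x \<odot>\<^bsub>chain_mod k\<^esub> x) =
      (\<Oplus>\<^bsub>chain_mod k\<^esub>s\<in>T. a (gen k s) \<odot>\<^bsub>chain_mod k\<^esub> gen k s)"
  proof (rule finsum_reindex)
    show "(\<lambda>x. a x \<odot>\<^bsub>chain_mod k\<^esub> x) \<in> gen k ` T \<rightarrow> carrier (chain_mod k)"
    proof
      fix x assume "x \<in> gen k ` T"
      then obtain s where s: "s \<in> T" "x = gen k s" by blast
      show "a x \<odot>\<^bsub>chain_mod k\<^esub> x \<in> carrier (chain_mod k)"
        unfolding s(2) eq[OF s(1)] using cl[OF s(1)] by simp
    qed
  qed (rule inj_on_subset[OF gen_inj T(2)])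
  also have "\<dots> = (\<Oplus>\<^bsub>chain_mod k\<^esub>s\<in>T. \<iota> (emb (k, s) (a (gen k s))))"
    by (rule finsum_cong') (use eq cl in auto)
  also have "\<dots> = \<iota> (\<Sum>s\<in>T. emb (k, s) (a (gen k s)))"
    by (rule finsum_chain_mod[OF T(1) cl])
  finally show ?thesis .
qed

lemma keys_coefficient_closed: "c \<in> chains Y k \<Longrightarrow> keys (coefficient z c) \<subseteq> carrier G"
  by (auto simp: keys_coefficient chains_def Y_of_def)

text \<open>Existence of coordinates is \<open>chain_decomposition\<close>. Uniqueness follows by
  applying \<open>coefficient (k, s)\<close> to a representation: on \<open>emb (k, t) r\<close> it
  gives \<open>r\<close> for \<open>s = t\<close> and 0 otherwise.\<close>

lemma basis_chain_mod: "module_basis (group_ring G) (chain_mod k) (gen k ` S k)"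
  unfolding module_basis_def
proof (intro conjI ballI)
  show "gen k ` S k \<subseteq> carrier (chain_mod k)" by (auto simp: gen_def Y_of_def)
  fix m assume "m \<in> carrier (chain_mod k)"
  then obtain c where c: "c \<in> chains Y k" "m = \<iota> c" by auto
  have supp: "{x \<in> gen k ` S k. a x \<noteq> \<zero>\<^bsub>group_ring G\<^esub>} = gen k ` {s \<in> S k. a (gen k s) \<noteq> 0}" for a
    by auto
  define a where "a = (\<lambda>x\<in>gen k ` S k. coefficient (k, the_inv_into (S k) (gen k) x) c)"
  have a: "a (gen k s) = coefficient (k, s) c" if "s \<in> S k" for s
    using that by (simp add: a_def the_inv_into_f_f[OF gen_inj])
  have fin: "finite {s \<in> S k. a (gen k s) \<noteq> 0}"
  proof (rule finite_subset)
    show "{s \<in> S k. a (gen k s) \<noteq> 0} \<subseteq> (\<lambda>y. snd (snd y)) ` keys c"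
    proof
      fix s assume s: "s \<in> {s \<in> S k. a (gen k s) \<noteq> 0}"
      then have "keys (coefficient (k, s) c) \<noteq> {}" using a by auto
      then obtain g where "(g, (k, s)) \<in> keys c" by (auto simp: keys_coefficient)
      then show "s \<in> (\<lambda>y. snd (snd y)) ` keys c" by force
    qed
  qed simp
  show "\<exists>!a. a \<in> gen k ` S k \<rightarrow>\<^sub>E carrier (group_ring G) \<and> finite {x \<in> gen k ` S k. a x \<noteq> \<zero>\<^bsub>group_ring G\<^esub>} \<and>
      m = (\<Oplus>\<^bsub>chain_mod k\<^esub>x\<in>{x \<in> gen k ` S k. a x \<noteq> \<zero>\<^bsub>group_ring G\<^esub>}. a x \<odot>\<^bsub>chain_mod k\<^esub> x)"
  proof (rule ex1I[of _ a], intro conjI)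
    show "a \<in> gen k ` S k \<rightarrow>\<^sub>E carrier (group_ring G)"
      using keys_coefficient_closed[OF c(1)] by (auto simp: a_def carrier_group_ring)
    show "finite {x \<in> gen k ` S k. a x \<noteq> \<zero>\<^bsub>group_ring G\<^esub>}" unfolding supp using fin by simp
    have "(\<Oplus>\<^bsub>chain_mod k\<^esub>x\<in>gen k ` {s \<in> S k. a (gen k s) \<noteq> 0}. a x \<odot>\<^bsub>chain_mod k\<^esub> x) =
        \<iota> (\<Sum>s\<in>{s \<in> S k. a (gen k s) \<noteq> 0}. emb (k, s) (a (gen k s)))"
      by (rule finsum_gens[OF fin]) (use a keys_coefficient_closed[OF c(1)] in auto)
    also have "(\<Sum>s\<in>{s \<in> S k. a (gen k s) \<noteq> 0}. emb (k, s) (a (gen k s))) =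
        (\<Sum>s\<in>{s \<in> S k. a (gen k s) \<noteq> 0}. emb (k, s) (coefficient (k, s) c))"
      by (rule sum.cong) (use a in auto)
    also have "\<dots> = c" by (rule chain_decomposition[OF c(1) fin, symmetric]) (use a in auto)
    finally show "m = (\<Oplus>\<^bsub>chain_mod k\<^esub>x\<in>{x \<in> gen k ` S k. a x \<noteq> \<zero>\<^bsub>group_ring G\<^esub>}. a x \<odot>\<^bsub>chain_mod k\<^esub> x)"
      unfolding supp using c(2) by simp
  next
    fix b assume b: "b \<in> gen k ` S k \<rightarrow>\<^sub>E carrier (group_ring G) \<and> finite {x \<in> gen k ` S k. b x \<noteq> \<zero>\<^bsub>group_ring G\<^esub>} \<and>
      m = (\<Oplus>\<^bsub>chain_mod k\<^esub>x\<in>{x \<in> gen k ` S k. b x \<noteq> \<zero>\<^bsub>group_ring G\<^esub>}. b x \<odot>\<^bsub>chain_mod k\<^esub> x)"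
    define T where "T = {s \<in> S k. b (gen k s) \<noteq> 0}"
    have "finite (gen k ` T)" using b unfolding supp T_def by blast
    then have T: "finite T" "T \<subseteq> S k"
      using inj_on_subset[OF gen_inj] by (auto simp: T_def dest!: finite_imageD)
    have bk: "keys (b (gen k s)) \<subseteq> carrier G" if "s \<in> S k" for s
      using b that by (auto simp: carrier_group_ring PiE_iff)
    have "m = (\<Oplus>\<^bsub>chain_mod k\<^esub>x\<in>gen k ` T. b x \<odot>\<^bsub>chain_mod k\<^esub> x)" using b unfolding supp T_def by blast
    also have "\<dots> = \<iota> (\<Sum>s\<in>T. emb (k, s) (b (gen k s)))"
      by (rule finsum_gens[OF T]) (use bk T in auto)
    finally have cs: "c = (\<Sum>s\<in>T. emb (k, s) (b (gen k s)))" using c(2) by simp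
    have bc: "b (gen k s) = coefficient (k, s) c" if s: "s \<in> S k" for s
    proof -
      have "coefficient (k, s) c = (\<Sum>t\<in>T. coefficient (k, s) (emb (k, t) (b (gen k t))))"
        unfolding cs coefficient_def frag_extend_sum[OF T(1)] by (simp add: comp_def)
      also have "\<dots> = (\<Sum>t\<in>T. if s = t then b (gen k t) else 0)"
        by (intro sum.cong) (auto simp: coefficient_emb)
      also have "\<dots> = (if s \<in> T then b (gen k s) else 0)" using T(1) by (rule sum.delta')
      also have "\<dots> = b (gen k s)" using s by (auto simp: T_def)
      finally show ?thesis ..
    qed
    show "b = a"
    proof
      fix x show "b x = a x"
      proof (cases "x \<in> gen k ` S k")
        case True
        then show ?thesis using bc a by auto
      next
        case False
        then show ?thesis using b by (auto simp: a_def PiE_iff extensional_def)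
      qed
    qed
  qed
qed

lemma finitely_generated_chain_mod:
  assumes "finite (S k)"
  shows "finitely_generated (group_ring G) (chain_mod k)"
  unfolding finitely_generated_def
proof (intro exI[of _ "gen k ` S k"] conjI ballI)
  show "gen k ` S k \<subseteq> carrier (chain_mod k)" by (auto simp: gen_def Y_of_def)
  show "finite (gen k ` S k)" using assms by simp
  fix m assume "m \<in> carrier (chain_mod k)"
  then obtain c where c: "c \<in> chains Y k" "m = \<iota> c" by auto
  define a where "a x = coefficient (k, the_inv_into (S k) (gen k) x) c" for x
  have a: "a (gen k s) = coefficient (k, s) c" if "s \<in> S k" for s
    using that by (simp add: a_def the_inv_into_f_f[OF gen_inj])
  have "(\<Oplus>\<^bsub>chain_mod k\<^esub>x\<in>gen k ` S k. a x \<odot>\<^bsub>chain_mod k\<^esub> x) = \<iota> (\<Sum>s\<in>S k. emb (k, s) (a (gen k s)))"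
    by (rule finsum_gens[OF assms]) (use a keys_coefficient_closed[OF c(1)] in auto)
  also have "(\<Sum>s\<in>S k. emb (k, s) (a (gen k s))) = (\<Sum>s\<in>S k. emb (k, s) (coefficient (k, s) c))"
    by (rule sum.cong) (use a in auto)
  also have "\<dots> = c" by (rule chain_decomposition[OF c(1) assms, symmetric])
  finally have "m = (\<Oplus>\<^bsub>chain_mod k\<^esub>x\<in>gen k ` S k. a x \<odot>\<^bsub>chain_mod k\<^esub> x)" using c(2) by simp
  moreover have "a \<in> gen k ` S k \<rightarrow> carrier (group_ring G)"
    using keys_coefficient_closed[OF c(1)] by (auto simp: a_def carrier_group_ring)
  ultimately show "\<exists>a\<in>gen k ` S k \<rightarrow> carrier (group_ring G).
      m = (\<Oplus>\<^bsub>chain_mod k\<^esub>x\<in>gen k ` S k. a x \<odot>\<^bsub>chain_mod k\<^esub> x)" by blast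
qed

lemma bd_scale:
  assumes "keys r \<subseteq> carrier G" "c \<in> chains Y k"
  shows "frag_extend bd (scale r c) = scale r (frag_extend bd c)"
proof -
  have "frag_extend bd (scale r c) = frag_extend (\<lambda>g. frag_extend bd (translate (left_shift G) g c)) r"
    by (simp add: scale_def frag_extend_frag_extend)
  also have "\<dots> = scale r (frag_extend bd c)" unfolding scale_def
    by (rule frag_extend_eq) (use assms cx.d_translate in blast)
  finally show ?thesis .
qed

lemma augm_scale:
  assumes r: "keys r \<subseteq> carrier G" and c: "c \<in> chains Y 0"
  shows "augm (scale r c) = r \<odot>\<^bsub>A\<^esub> augm c"
proof (rule frag_additive_eq[OF A_abelian _ _ _ r])
  have ac: "augm c \<in> carrier A" using frag_additiveD(1)[OF augm_additive] c by (simp add: chains_def)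
  show "frag_additive A (carrier G) (\<lambda>r. augm (scale r c))" unfolding scale_def
    by (rule frag_additive_frag_extend[OF augm_additive]) (use shift_closed[OF _ c] in \<open>auto simp: chains_def\<close>)
  show "frag_additive A (carrier G) (\<lambda>r. r \<odot>\<^bsub>A\<^esub> augm c)" by (rule smult_additive_left[OF A_module ac])
qed (use augm_translate c in \<open>simp add: scale_frag_of\<close>)

theorem based_free_resolution_resolution: "based_free_resolution G A resolution"
  unfolding based_free_resolution_def
proof (intro conjI allI)
  show "left_module (group_ring G) A" by (rule A_module)
  show "left_module (group_ring G) (chain resolution k)" for k
    by (simp add: left_module_chain_mod)
  show "module_basis (group_ring G) (chain resolution k) (gens resolution k)" for k
    by (simp add: basis_chain_mod)
  show "bdr resolution k \<in> module_homs (group_ring G) (chain resolution (Suc k)) (chain resolution k)" for k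
    by (auto simp: module_homs_def carrier_group_ring frag_extend_add bd_scale intro: cx.d_closed)
  show "aug resolution \<in> module_homs (group_ring G) (chain resolution 0) A"
    using frag_additiveD[OF augm_additive] by (auto simp: module_homs_def carrier_group_ring augm_scale chains_def)
  have "aug resolution ` carrier (chain resolution 0) = augm ` chains Y 0" by (simp add: image_image)
  also have "\<dots> = carrier A"
    using frag_additiveD(1)[OF augm_additive] a0_generates by (force simp: chains_def)
  finally show "aug resolution ` carrier (chain resolution 0) = carrier A" .
  have "bdr resolution k ` carrier (chain resolution (Suc k)) = \<iota> ` cyc k" for k
    by (simp add: image_image cycles_eq_boundaries)
  moreover have "cycles A resolution k = \<iota> ` cyc k" for k
  proof -
    have im: "{z \<in> \<iota> ` X. P (\<kappa> z)} = \<iota> ` {c \<in> X. P c}" for X P by auto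
    show ?thesis
    proof (cases k)
      case 0
      have "cyc 0 = {c \<in> chains Y 0. augm c = \<zero>\<^bsub>A\<^esub>}"
        unfolding tuple_cycles_def by (rule Collect_cong) (use cx.d_zero in blast)
      then show ?thesis using 0 im[of "chains Y 0" "\<lambda>c. augm c = \<zero>\<^bsub>A\<^esub>"] by (simp add: cycles_def)
    next
      case (Suc j)
      have "cyc (Suc j) = {c \<in> chains Y (Suc j). frag_extend bd c = 0}"
        by (simp add: tuple_cycles_def)
      then show ?thesis using Suc im[of "chains Y (Suc j)" "\<lambda>c. frag_extend bd c = 0"]
        by (simp add: cycles_def)
    qed
  qed
  ultimately show "bdr resolution k ` carrier (chain resolution (Suc k)) = cycles A resolution k" for k by simp
qed

lemma admissible_resolution: "admissible A resolution"
proof -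
  have "augm (frag_of (\<one>, (0, s))) \<noteq> \<zero>\<^bsub>A\<^esub>" if "s \<in> S 0" for s
    using augm_frag_of[of \<one> s] left_module.smult_one[OF A_module a0_closed[OF that]] a0_nonzero[OF that] that
    by simp
  moreover have "bd (\<one>, (Suc k, s)) \<noteq> 0" if "s \<in> S (Suc k)" for s k
    using cx.translate_one[OF e_closed[OF that]] e_nonzero[OF that] by (simp add: tuple_bd_def)
  ultimately show ?thesis by (auto simp: admissible_def gen_def)
qed

lemma fg_skeleton_resolution: "(\<And>k. k \<le> n \<Longrightarrow> finite (S k)) \<Longrightarrow> fg_skeleton G n resolution"
  by (simp add: fg_skeleton_def finitely_generated_chain_mod)

end

text \<open>Admissibility forbids basis elements with zero boundary, so 0 is removed from generating
  sets of cycles.\<close>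

lemma translate_span_remove_zero: "translate_span G act X \<subseteq> translate_span G act (X - {0})"
proof
  fix c assume "c \<in> translate_span G act X"
  then show "c \<in> translate_span G act (X - {0})"
  proof (induction rule: translate_span.induct)
    case (gen x g)
    then show ?case
      by (cases "x = 0") (auto intro: translate_span.zero translate_span.gen)
  qed (auto intro: translate_span.zero translate_span.diff)
qed

text \<open>Degree by degree, the basis is a generating set of the cycles of the previous degree, chosen
  finite when there is a finite one. All basis elements fit into \<open>G \<times> \<nat>\<close> because this type is as
  large as that of the chains.\<close>

lemma ex_tuple_resolution:
  fixes G :: "('g, 'b) monoid_scheme" and A :: "('g \<Rightarrow>\<^sub>0 int, 'a) module"
  assumes "group G" and A: "left_module (group_ring G) A"
    and X: "finite X" "X \<subseteq> carrier A"
    and gen: "\<And>a. a \<in> carrier A \<Longrightarrow>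
      \<exists>c. keys c \<subseteq> carrier G \<times> X \<and> lin_ext A (\<lambda>y. frag_of (fst y) \<odot>\<^bsub>A\<^esub> snd y) c = a"
  obtains S :: "nat \<Rightarrow> ('g \<times> nat) set" and e a0 where "tuple_resolution G A S e a0" "finite (S 0)"
    "\<forall>k. (\<exists>X. finite X \<and> X \<subseteq> tuple_cycles G A S e a0 k \<and>
        tuple_cycles G A S e a0 k \<subseteq> translate_span G (left_shift G) X) \<longrightarrow> finite (S (Suc k))"
proof -
  interpret group G by fact
  have ab: "abelian_group A" using A by (rule left_module.axioms(2))
  define X' where "X' = X - {\<zero>\<^bsub>A\<^esub>}"
  have X': "finite X'" "X' \<subseteq> carrier A" using X by (auto simp: X'_def)
  obtain f where f: "bij_betw f {0..<card X'} X'" using ex_bij_betw_nat_finite[OF X'(1)] by blast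
  define S0 where "S0 = {undefined :: 'g} \<times> {0..<card X'}"
  define a0 where "a0 s = f (snd s)" for s :: "'g \<times> nat"
  have a0: "a0 s \<in> X'" if "s \<in> S0" for s
    using that f by (auto simp: S0_def a0_def bij_betw_def)
  have a0_gen: "\<exists>c\<in>chains (Y_of G S) 0. tuple_aug A a0 c = a"
    if S: "S 0 = S0" and a: "a \<in> carrier A" for S a
  proof -
    obtain c where c: "keys c \<subseteq> carrier G \<times> X" "lin_ext A (\<lambda>y. frag_of (fst y) \<odot>\<^bsub>A\<^esub> snd y) c = a"
      using gen[OF a] by blast
    \<comment> \<open>The generator 0 of \<open>A\<close>, if present, gets no basis element, for
      admissibility; its multiples are sent to the zero chain.\<close>
    define v where "v y = (if snd y = \<zero>\<^bsub>A\<^esub> then 0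
      else frag_of (fst y, (0::nat, (undefined :: 'g, the_inv_into {0..<card X'} f (snd y)))))" for y :: "'g \<times> 'a"
    have idx: "the_inv_into {0..<card X'} f x \<in> {0..<card X'}" "f (the_inv_into {0..<card X'} f x) = x" if "x \<in> X'" for x
    proof -
      have inj: "inj_on f {0..<card X'}" and im: "x \<in> f ` {0..<card X'}" using f that by (auto simp: bij_betw_def)
      show "the_inv_into {0..<card X'} f x \<in> {0..<card X'}" by (rule the_inv_into_into[OF inj im]) simp
      show "f (the_inv_into {0..<card X'} f x) = x" by (rule f_the_inv_into_f[OF inj im])
    qed
    have vk: "keys (v y) \<subseteq> Y_of G S 0" if "y \<in> carrier G \<times> X" for y
      using idx(1)[of "snd y"] that S by (auto simp: v_def Y_of_def S0_def X'_def)
    have smc: "frag_of g \<odot>\<^bsub>A\<^esub> x \<in> carrier A" if "g \<in> carrier G" "x \<in> carrier A" for g x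
      using left_module.smult_closed[OF A] that by simp
    have aug: "frag_additive A (Y_of G S 0) (tuple_aug A a0)"
      unfolding tuple_aug_def
    proof (rule lin_ext_additive[OF ab], rule Pi_I)
      fix y assume "y \<in> Y_of G S 0"
      then have y: "fst y \<in> carrier G" "snd (snd y) \<in> S0" using S by (auto simp: Y_of_def)
      then have "a0 (snd (snd y)) \<in> carrier A" using a0 X' by blast
      then show "frag_of (fst y) \<odot>\<^bsub>A\<^esub> a0 (snd (snd y)) \<in> carrier A" by (rule smc[OF y(1)])
    qed
    have "tuple_aug A a0 (frag_extend v c) = lin_ext A (\<lambda>y. frag_of (fst y) \<odot>\<^bsub>A\<^esub> snd y) c"
    proof (rule frag_additive_eq[OF ab _ _ _ c(1)])
      show "frag_additive A (carrier G \<times> X) (\<lambda>c. tuple_aug A a0 (frag_extend v c))"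
        by (rule frag_additive_frag_extend[OF aug vk])
      show "frag_additive A (carrier G \<times> X) (lin_ext A (\<lambda>y. frag_of (fst y) \<odot>\<^bsub>A\<^esub> snd y))"
        by (rule lin_ext_additive[OF ab]) (use smc X in auto)
      fix y assume "y \<in> carrier G \<times> X"
      then obtain g x where y: "y = (g, x)" "g \<in> carrier G" "x \<in> X" by auto
      show "tuple_aug A a0 (frag_extend v (frag_of y)) = lin_ext A (\<lambda>y. frag_of (fst y) \<odot>\<^bsub>A\<^esub> snd y) (frag_of y)"
      proof (cases "x = \<zero>\<^bsub>A\<^esub>")
        case True
        then show ?thesis using y frag_additive_0[OF ab aug] smult_zero_right[OF A, of "frag_of g"] smc[OF y(2), of x] X
          by (auto simp: v_def lin_ext_frag_of[OF ab])
      next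
        case False
        then have "x \<in> X'" using y by (simp add: X'_def)
        then show ?thesis using y False idx(2)[of x] smc[OF y(2), of x] X
          by (auto simp: v_def lin_ext_frag_of[OF ab] tuple_aug_def a0_def)
      qed
    qed
    moreover have "frag_extend v c \<in> chains (Y_of G S) 0"
      using keys_frag_extend[of v c] vk c(1) unfolding chains_def by blast
    ultimately show ?thesis using c(2) by blast
  qed
  obtain j :: "('g \<times> (nat \<times> ('g \<times> nat)) \<Rightarrow>\<^sub>0 int) \<Rightarrow> 'g \<times> nat" where j: "inj j"
    using ex_inj_tuple_chains by blast
  \<comment> \<open>The cycles of degree \<open>k\<close>, expressed by the names and boundaries of
    this degree alone. The recursion carries this pair as its state while the full sequences
    \<open>S\<close> and \<open>e\<close> do not exist yet; \<open>cyc\<close> below identifies the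
    two descriptions.\<close>
  define Z where "Z k st = {c. keys c \<subseteq> carrier G \<times> ({k} \<times> fst st) \<and>
      frag_extend (\<lambda>y. translate (left_shift G) (fst y) (snd st (snd (snd y)))) c = 0 \<and>
      (k = 0 \<longrightarrow> tuple_aug A a0 c = \<zero>\<^bsub>A\<^esub>)}"
    for k :: nat and st :: "('g \<times> nat) set \<times> (('g \<times> nat) \<Rightarrow> ('g \<times> (nat \<times> ('g \<times> nat)) \<Rightarrow>\<^sub>0 int))"
  define Q where "Q k st st' \<longleftrightarrow> (\<forall>s\<in>fst st'. snd st' s \<in> Z k st \<and> snd st' s \<noteq> 0) \<and>
      Z k st \<subseteq> translate_span G (left_shift G) (snd st' ` fst st') \<and>
      ((\<exists>X. finite X \<and> X \<subseteq> Z k st \<and> Z k st \<subseteq> translate_span G (left_shift G) X) \<longrightarrow> finite (fst st'))"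
    for k st and st' :: "('g \<times> nat) set \<times> (('g \<times> nat) \<Rightarrow> ('g \<times> (nat \<times> ('g \<times> nat)) \<Rightarrow>\<^sub>0 int))"
  have "\<exists>st. \<forall>k. (k = 0 \<longrightarrow> st k = (S0, \<lambda>_. 0)) \<and> Q k (st k) (st (Suc k))"
  proof (rule dependent_nat_choice)
    fix st k
    have "\<exists>T. T \<subseteq> Z k st \<and> 0 \<notin> T \<and> Z k st \<subseteq> translate_span G (left_shift G) T \<and>
      ((\<exists>X. finite X \<and> X \<subseteq> Z k st \<and> Z k st \<subseteq> translate_span G (left_shift G) X) \<longrightarrow> finite T)"
    proof (cases "\<exists>X. finite X \<and> X \<subseteq> Z k st \<and> Z k st \<subseteq> translate_span G (left_shift G) X")
      case True
      then obtain W where W: "finite W" "W \<subseteq> Z k st" "Z k st \<subseteq> translate_span G (left_shift G) W" by blast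
      then have "Z k st \<subseteq> translate_span G (left_shift G) (W - {0})" using translate_span_remove_zero by blast
      then show ?thesis using W by (intro exI[of _ "W - {0}"]) auto
    next
      case False
      have "c \<in> translate_span G (left_shift G) (Z k st)" if "c \<in> Z k st" for c
      proof -
        have "translate (left_shift G) \<one>\<^bsub>G\<^esub> c = frag_extend frag_of c"
          unfolding translate_def by (rule frag_extend_eq) (use that in \<open>auto simp: Z_def\<close>)
        then show ?thesis using translate_span.gen[OF that, of "\<one>\<^bsub>G\<^esub>" G "left_shift G"] by simp
      qed
      then have "Z k st \<subseteq> translate_span G (left_shift G) (Z k st - {0})" using translate_span_remove_zero by blast
      then show ?thesis using False by (intro exI[of _ "Z k st - {0}"]) auto
    qed
    then obtain T where T: "T \<subseteq> Z k st" "0 \<notin> T" "Z k st \<subseteq> translate_span G (left_shift G) T"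
      "(\<exists>X. finite X \<and> X \<subseteq> Z k st \<and> Z k st \<subseteq> translate_span G (left_shift G) X) \<longrightarrow> finite T" by blast
    have "inv_into UNIV j ` j ` T = T" by (simp add: image_image inv_into_f_f[OF j])
    \<comment> \<open>The name of a basis element is the code \<open>j c\<close> of its boundary
      \<open>c\<close>, and decoding the name returns the boundary.\<close>
    then have "Q k st (j ` T, inv_into UNIV j)"
      using T by (auto simp: Q_def inv_into_f_f[OF j])
    then show "\<exists>st'. (Suc k = 0 \<longrightarrow> st' = (S0, \<lambda>_. 0)) \<and> Q k st st'" by blast
  qed simp
  then obtain st where "\<forall>k. (k = 0 \<longrightarrow> st k = (S0, \<lambda>_. 0)) \<and> Q k (st k) (st (Suc k))" ..
  then have st0: "st 0 = (S0, \<lambda>_. 0)" and stQ: "Q k (st k) (st (Suc k))" for k by auto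
  define S where "S k = fst (st k)" for k
  define e where "e k = snd (st k)" for k
  have S0: "S 0 = S0" by (simp add: S_def st0)
  have cyc: "tuple_cycles G A S e a0 k = Z k (st k)" for k
  proof -
    have "frag_extend (tuple_bd G e) c = frag_extend (\<lambda>y. translate (left_shift G) (fst y) (snd (st k) (snd (snd y)))) c"
      if "keys c \<subseteq> carrier G \<times> ({k} \<times> S k)" for c
      by (rule frag_extend_eq) (use that in \<open>auto simp: tuple_bd_def e_def\<close>)
    then show ?thesis unfolding tuple_cycles_def Z_def chains_def Y_of_def S_def by auto
  qed
  have "tuple_resolution G A S e a0"
  proof (intro tuple_resolution.intro tuple_resolution_axioms.intro)
    show "\<exists>c\<in>chains (Y_of G S) 0. tuple_aug A a0 c = a" if "a \<in> carrier A" for a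
      using a0_gen[where S = S] S0 that by blast
    show "tuple_cycles G A S e a0 k \<subseteq> translate_span G (left_shift G) (e (Suc k) ` S (Suc k))" for k
      using stQ[of k] unfolding cyc Q_def S_def e_def by blast
    show "e (Suc k) s \<in> tuple_cycles G A S e a0 k" "e (Suc k) s \<noteq> 0" if "s \<in> S (Suc k)" for s k
      using stQ[of k] that unfolding cyc Q_def S_def e_def by blast+
    show "e 0 s = 0" for s by (simp add: e_def st0)
  qed (use a0 X' S0 A in \<open>auto simp: X'_def is_group\<close>)
  moreover have "finite (S 0)" by (simp add: S0 S0_def)
  moreover have "\<forall>k. (\<exists>X. finite X \<and> X \<subseteq> tuple_cycles G A S e a0 k \<and>
        tuple_cycles G A S e a0 k \<subseteq> translate_span G (left_shift G) X) \<longrightarrow> finite (S (Suc k))"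
    using stQ unfolding cyc Q_def S_def by blast
  ultimately show ?thesis using that by blast
qed

section \<open>Augmentations and the resolved module\<close>

definition augmentation ::
    "('g, 'b) monoid_scheme \<Rightarrow> ('g \<Rightarrow>\<^sub>0 int, 'a) module \<Rightarrow> ('g \<Rightarrow> 'y \<Rightarrow> 'y) \<Rightarrow> (nat \<Rightarrow> 'y set) \<Rightarrow>
     ('y \<Rightarrow> 'y \<Rightarrow>\<^sub>0 int) \<Rightarrow> (('y \<Rightarrow>\<^sub>0 int) \<Rightarrow> 'a) \<Rightarrow> bool" where
  "augmentation G A act Y bd \<alpha> \<longleftrightarrow> frag_additive A (Y 0) \<alpha> \<and>
     (\<forall>g\<in>carrier G. \<forall>c\<in>chains Y 0. \<alpha> (translate act g c) = frag_of g \<odot>\<^bsub>A\<^esub> \<alpha> c) \<and>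
     \<alpha> ` chains Y 0 = carrier A \<and>
     (\<forall>c\<in>chains Y 0. \<alpha> c = \<zero>\<^bsub>A\<^esub> \<longleftrightarrow> (\<exists>w\<in>chains Y (Suc 0). frag_extend bd w = c))"

lemma augmentationD:
  assumes "augmentation G A act Y bd \<alpha>"
  shows "frag_additive A (Y 0) \<alpha>"
    "\<lbrakk>g \<in> carrier G; c \<in> chains Y 0\<rbrakk> \<Longrightarrow> \<alpha> (translate act g c) = frag_of g \<odot>\<^bsub>A\<^esub> \<alpha> c"
    "\<alpha> ` chains Y 0 = carrier A"
    "c \<in> chains Y 0 \<Longrightarrow> \<alpha> c = \<zero>\<^bsub>A\<^esub> \<longleftrightarrow> (\<exists>w\<in>chains Y (Suc 0). frag_extend bd w = c)"
  using assms unfolding augmentation_def by blast+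

text \<open>Having the same augmentation is the relation: surjectivity onto the common module gives
  partners on both sides, and the kernels give the two conditions on boundaries.\<close>

lemma resolution_pair_if_augmented:
  assumes F: "free_complex G act Y bd" "augmentation G A act Y bd \<alpha>"
    and P: "free_complex G act' Y' bd'" "augmentation G A act' Y' bd' \<beta>" and A: "abelian_group A"
  shows "resolution_pair G act Y bd act' Y' bd' (\<lambda>c p. \<alpha> c = \<beta> p)"
proof -
  note \<alpha> = augmentationD[OF F(2)] and \<beta> = augmentationD[OF P(2)]
  note z = frag_additive_0[OF A \<alpha>(1)] frag_additive_0[OF A \<beta>(1)]
  show ?thesis
  proof (intro resolution_pair.intro resolution_pair_axioms.intro)
    show "\<alpha> (c - c') = \<beta> (p - p')"
      if "c \<in> chains Y 0" "c' \<in> chains Y 0" "p \<in> chains Y' 0" "p' \<in> chains Y' 0" "\<alpha> c = \<beta> p" "\<alpha> c' = \<beta> p'" for c c' p p'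
      using that frag_additive_diff[OF A \<alpha>(1)] frag_additive_diff[OF A \<beta>(1)] by (simp add: chains_def)
    show "\<exists>p\<in>chains Y' 0. \<alpha> c = \<beta> p" if "c \<in> chains Y 0" for c
    proof -
      have "\<alpha> c \<in> \<beta> ` chains Y' 0" using that \<alpha>(3) \<beta>(3) by blast
      then show ?thesis by blast
    qed
    show "\<exists>c\<in>chains Y 0. \<alpha> c = \<beta> p" if "p \<in> chains Y' 0" for p
    proof -
      have "\<beta> p \<in> \<alpha> ` chains Y 0" using that \<alpha>(3) \<beta>(3) by blast
      then obtain c where "c \<in> chains Y 0" "\<beta> p = \<alpha> c" by blast
      then show ?thesis by auto
    qed
    show "(\<alpha> c = \<beta> 0) = (\<exists>e\<in>chains Y (Suc 0). frag_extend bd e = c)" if "c \<in> chains Y 0" for c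
      using \<alpha>(4)[OF that] z by simp
    show "(\<alpha> 0 = \<beta> p) = (\<exists>e\<in>chains Y' (Suc 0). frag_extend bd' e = p)" if "p \<in> chains Y' 0" for p
      using \<beta>(4)[OF that] z by auto
  qed (use F(1) P(1) \<alpha>(2) \<beta>(2) z in auto)
qed

lemma (in record_resolution) augmentation_augm:
  assumes "H \<subseteq> carrier G"
  shows "augmentation (G\<lparr>carrier := H\<rparr>) A (left_shift G) Y bd augm"
  unfolding augmentation_def
proof (intro conjI ballI)
  show "frag_additive A (Y 0) augm" by (rule augm_additive)
  show "augm (translate (left_shift G) g c) = frag_of g \<odot>\<^bsub>A\<^esub> augm c"
    if "g \<in> carrier (G\<lparr>carrier := H\<rparr>)" "c \<in> chains Y 0" for g c
    using that assms augm_translate by auto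
  show "augm ` chains Y 0 = carrier A"
  proof (intro equalityI subsetI)
    fix a assume "a \<in> carrier A"
    then obtain c where "c \<in> chains Y 0" "augm c = a" using augm_surj by blast
    then show "a \<in> augm ` chains Y 0" by blast
  qed (use augm_closed in blast)
qed (use augm_eq_0 in blast)

lemma (in tuple_resolution) augmentation_augm: "augmentation G A (left_shift G) Y bd augm"
  unfolding augmentation_def
proof (intro conjI ballI)
  show "frag_additive A (Y 0) augm" by (rule augm_additive)
  show "augm (translate (left_shift G) g c) = frag_of g \<odot>\<^bsub>A\<^esub> augm c"
    if "g \<in> carrier G" "c \<in> chains Y 0" for g c using augm_translate that .
  show "augm ` chains Y 0 = carrier A"
  proof (intro equalityI subsetI)
    fix a assume "a \<in> carrier A"
    then obtain c where "c \<in> chains Y 0" "augm c = a" using a0_generates by blast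
    then show "a \<in> augm ` chains Y 0" by blast
  qed (use frag_additiveD(1)[OF augm_additive] in \<open>auto simp: chains_def\<close>)
  show "augm c = \<zero>\<^bsub>A\<^esub> \<longleftrightarrow> (\<exists>w\<in>chains Y (Suc 0). frag_extend bd w = c)" if c: "c \<in> chains Y 0" for c
  proof -
    have "augm c = \<zero>\<^bsub>A\<^esub> \<longleftrightarrow> c \<in> cyc 0" using c cx.d_zero[OF c] by (simp add: tuple_cycles_def)
    then show ?thesis unfolding cycles_eq_boundaries by blast
  qed
qed

section \<open>The theorem\<close>

lemma left_shift_subgroup [simp]: "left_shift (G\<lparr>carrier := H\<rparr>) = left_shift G"
  by (simp add: fun_eq_iff left_shift_def)

section \<open>The stabilizer of \<open>b\<close> and the filtration by balls\<close>

locale record_control_stabilizer = record_control G A F \<rho> h n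
  for G :: "('g, 'b) monoid_scheme" (structure) and A :: "('g \<Rightarrow>\<^sub>0 int, 'a) module"
    and F :: "('g, 'f, 'a) based_complex" and \<rho> :: "'g \<Rightarrow> 'm::metric_space \<Rightarrow> 'm"
    and h :: "nat \<Rightarrow> 'f \<Rightarrow> 'm set" and n +
  fixes b :: 'm
  assumes proper: "proper_space TYPE('m)" and discrete_orbit: "discrete (orbit G \<rho> b)"
begin

definition H where "H = stabilizer G \<rho> b"

abbreviation GH where "GH \<equiv> G\<lparr>carrier := H\<rparr>"
abbreviation \<nu> where "\<nu> \<equiv> \<lambda>y. dist b (\<pi> y)"

lemma H_subgroup: "subgroup H G"
  unfolding H_def by (rule group_action.stabilizer_subgroup[OF \<rho>_action]) simp

lemma H_subset: "H \<subseteq> carrier G"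
  by (rule subgroup.subset[OF H_subgroup])

lemma H_iff: "g \<in> H \<longleftrightarrow> g \<in> carrier G \<and> \<rho> g b = b"
  by (auto simp: H_def stabilizer_def)

lemma A_module_H: "left_module (group_ring GH) A"
  by (rule left_module_group_ring_subgroup[OF is_group A_module H_subgroup])

lemma group_GH: "group GH"
  by (rule subgroup_imp_group[OF H_subgroup])

text \<open>By homogeneity one isolation radius at \<open>b\<close> separates all points of its
  orbit. A uniformly separated set has no limit points, so it meets the compact ball in a finite
  set.\<close>

lemma finite_orbit_ball: "finite (cball b r \<inter> orbit G \<rho> b)"
proof (rule finite_not_islimpt_in_compact)
  show "compact (cball b r)" using proper by (simp add: proper_space_def)
  have "b \<in> orbit G \<rho> b" unfolding orbit_def using \<rho>_one by (auto intro!: exI[of _ \<one>])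
  then have "b isolated_in orbit G \<rho> b" using discrete_orbit by (simp add: discrete_def)
  then obtain \<epsilon> where \<epsilon>: "\<epsilon> > 0" "\<forall>y\<in>orbit G \<rho> b. dist b y < \<epsilon> \<longrightarrow> y = b"
    by (auto simp: isolated_in_dist_Ex_iff)
  have sep: "y = x" if x: "x \<in> orbit G \<rho> b" and y: "y \<in> orbit G \<rho> b" and d: "dist y x < \<epsilon>" for x y
  proof -
    obtain g g' where g: "g \<in> carrier G" "x = \<rho> g b" "g' \<in> carrier G" "y = \<rho> g' b"
      using x y by (auto simp: orbit_def)
    have y': "\<rho> g (\<rho> (inv g \<otimes> g') b) = y" using g by (simp add: \<rho>_mult ctl.\<rho>_inv)
    have "dist b (\<rho> (inv g \<otimes> g') b) = dist x y"
      using \<rho>_dist[OF g(1), of b "\<rho> (inv g \<otimes> g') b"] y' g(2) by simp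
    moreover have "\<rho> (inv g \<otimes> g') b \<in> orbit G \<rho> b" using g by (auto simp: orbit_def)
    ultimately have "\<rho> (inv g \<otimes> g') b = b" using \<epsilon>(2) d by (simp add: dist_commute)
    then show ?thesis using y' g by simp
  qed
  show "\<not> z islimpt orbit G \<rho> b" for z
    by (rule discrete_imp_not_islimpt[OF \<epsilon>(1)]) (use sep in blast)
qed

text \<open>Basis elements with the same generator and group parts \<open>g\<close> and
  \<open>g'\<close> lie in one \<open>H\<close>-orbit as soon as the inverses of \<open>g\<close>
  and \<open>g'\<close> carry \<open>b\<close> to the same point, and \<Phi> records that point. For
  a basis element within \<open>R\<close> of \<open>b\<close> the point lies within
  \<open>R + M\<close> of \<open>b\<close>, which leaves finitely many values.\<close>

lemma orbit_finite_sublevel: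
  assumes k: "k \<le> n"
  shows "orbit_finite GH (left_shift G) {y \<in> Y k. \<nu> y \<le> R}" (is "orbit_finite _ _ ?T")
proof -
  define \<Phi> where "\<Phi> y = (\<rho> (inv (fst y)) b, snd (snd y))" for y :: "'g \<times> (nat \<times> 'f)"
  define M where "M = Max (insert 0 ((\<lambda>x. dist (base_point k x) b) ` gens F k))"
  have M: "dist (base_point k x) b \<le> M" if "x \<in> gens F k" for x
    unfolding M_def using finite_gens_le[OF k] that by (intro Max_ge) auto
  have "\<Phi> ` ?T \<subseteq> (cball b (R + M) \<inter> orbit G \<rho> b) \<times> gens F k"
  proof
    fix z assume "z \<in> \<Phi> ` ?T"
    then obtain y where y: "y \<in> Y k" "\<nu> y \<le> R" "z = \<Phi> y" by blast
    obtain g x where gx: "y = (g, (k, x))" "g \<in> carrier G" "x \<in> gens F k" using y(1) by (auto simp: Y_of_def)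
    have gi: "inv g \<in> carrier G" using gx by simp
    have "dist b (\<rho> (inv g) b) = dist (\<rho> g b) b"
      using \<rho>_dist[OF gx(2), of b "\<rho> (inv g) b"] gx(2) by (simp add: ctl.\<rho>_inv)
    also have "\<dots> \<le> dist (\<rho> g b) (\<pi> y) + dist (\<pi> y) b" by (rule dist_triangle)
    also have "dist (\<rho> g b) (\<pi> y) = dist (base_point k x) b"
      using gx by (simp add: \<pi>_def \<rho>_dist dist_commute)
    finally have "dist b (\<rho> (inv g) b) \<le> R + M" using M[OF gx(3)] y(2) by (simp add: dist_commute)
    then show "z \<in> (cball b (R + M) \<inter> orbit G \<rho> b) \<times> gens F k"
      using y(3) gx gi by (auto simp: \<Phi>_def orbit_def)
  qed
  then have "finite (\<Phi> ` ?T)"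
    by (rule finite_subset) (intro finite_cartesian_product finite_orbit_ball finite_gens_le[OF k])
  then obtain X where X: "X \<subseteq> ?T" "finite X" "\<Phi> ` ?T = \<Phi> ` X"
    using finite_subset_image[of "\<Phi> ` ?T" \<Phi> ?T] by auto
  have "\<exists>g\<in>carrier GH. \<exists>x\<in>X. y = left_shift G g x" if y: "y \<in> ?T" for y
  proof -
    have "\<Phi> y \<in> \<Phi> ` X" using X(3) y by blast
    then obtain z where z: "z \<in> X" "\<Phi> y = \<Phi> z" by blast
    have "y \<in> Y k" "z \<in> Y k" using y z(1) X(1) by auto
    then obtain g g' x where gg: "y = (g, (k, x))" "z = (g', (k, x))" "g \<in> carrier G" "g' \<in> carrier G"
      using z(2) by (auto simp: Y_of_def \<Phi>_def)
    have gi: "inv g' \<in> carrier G" using gg by simp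
    have "\<rho> (g \<otimes> inv g') b = \<rho> g (\<rho> (inv g) b)"
      using z(2) gg by (simp add: \<rho>_mult \<Phi>_def)
    then have "g \<otimes> inv g' \<in> H" using gg by (simp add: H_iff ctl.\<rho>_inv)
    moreover have "y = left_shift G (g \<otimes> inv g') z" using gg by (simp add: m_assoc)
    ultimately show ?thesis using z(1) by auto
  qed
  then show ?thesis using X(1,2) unfolding orbit_finite_def by blast
qed

lemma \<nu>_invariant: "\<lbrakk>g \<in> carrier GH; y \<in> Y k\<rbrakk> \<Longrightarrow> \<nu> (left_shift G g y) = \<nu> y"
proof -
  assume g: "g \<in> carrier GH" and y: "y \<in> Y k"
  then have gG: "g \<in> carrier G" "\<rho> g b = b" by (auto simp: H_iff)
  have "dist b (\<rho> g (\<pi> y)) = dist (\<rho> g b) (\<rho> g (\<pi> y))" using gG by simp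
  then show ?thesis using ctl.\<pi>_act[OF gG(1) y] \<rho>_dist[OF gG(1)] by simp
qed

lemma free_complex_H: "free_complex GH (left_shift G) Y bd"
  by (rule cx.restrict_subgroup[OF H_subgroup])

text \<open>The given resolution, restricted to \<open>H\<close>, is compared with one that is
  finite over \<open>H\<close>; its own sublevels are finite modulo \<open>H\<close> by
  \<open>orbit_finite_sublevel\<close>.\<close>

lemma essentially_acyclic_if_FP:
  assumes "FP_type n GH A"
  shows "\<exists>R'. \<forall>k\<le>n. \<forall>w\<in>chains Y k. bounded_by \<nu> R (frag_extend bd w) \<longrightarrow>
    (\<exists>t\<in>chains Y (Suc k). bounded_by \<nu> R' (w + frag_extend bd t))"
proof -
  obtain P :: "('g, ('g \<times> nat) \<Rightarrow>\<^sub>0 ('g \<Rightarrow>\<^sub>0 int), 'a) based_complex"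
    where P: "based_free_resolution GH A P" "fg_skeleton GH n P"
    using assms by (auto simp: FP_type_def)
  interpret P: record_resolution GH A P
    by (intro record_resolution.intro record_resolution_axioms.intro group_GH P(1))
  interpret pair: resolution_pair GH "left_shift G" Y bd "left_shift GH" P.Y P.bd "\<lambda>c p. augm c = P.augm p"
    by (rule resolution_pair_if_augmented[OF free_complex_H augmentation_augm[OF H_subset] P.cx.free_complex_axioms _ A_abelian])
      (use P.augmentation_augm[of H] in simp)
  show ?thesis
  proof (rule pair.essentially_acyclic_if_finite)
    show "orbit_finite GH (left_shift GH) (P.Y k)" if "k \<le> n" for k
      unfolding orbit_finite_def
    proof (intro exI conjI ballI)
      show "finite ({\<one>} \<times> ({k} \<times> gens P k))"
        using P.finite_gens P(2) that by (simp add: fg_skeleton_def)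
      show "{\<one>} \<times> ({k} \<times> gens P k) \<subseteq> P.Y k" using P.one_closed by (auto simp: Y_of_def)
      fix y assume "y \<in> P.Y k"
      then obtain g x where y: "y = (g, (k, x))" "g \<in> H" "x \<in> gens P k" by (auto simp: Y_of_def)
      then show "\<exists>g\<in>carrier GH. \<exists>x\<in>{\<one>} \<times> ({k} \<times> gens P k). y = left_shift GH g x"
        using H_subset by (intro bexI[of _ g] bexI[of _ "(\<one>, (k, x))"]) auto
    qed
  qed (use \<nu>_invariant orbit_finite_sublevel in auto)
qed

text \<open>Finite generation of \<open>A\<close> over \<open>H\<close> holds because chains of
  degree 0 can be moved into one ball modulo boundaries. The resolution over \<open>H\<close> uses
  generators of the cycles, finitely many whenever that is possible, and the comparison with the
  restricted resolution shows by induction that it is possible up to degree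
  \<open>n\<close>.\<close>

lemma FP_if_essentially_acyclic:
  assumes ess: "\<And>R. \<exists>R'. \<forall>k\<le>n. \<forall>w\<in>chains Y k. bounded_by \<nu> R (frag_extend bd w) \<longrightarrow>
    (\<exists>t\<in>chains Y (Suc k). bounded_by \<nu> R' (w + frag_extend bd t))"
  shows "FP_type n GH A"
proof -
  \<comment> \<open>In degree 0 the boundary vanishes, so the hypothesis for radius 0 applies to
    every chain.\<close>
  obtain R' where R': "\<And>w. w \<in> chains Y 0 \<Longrightarrow> \<exists>t\<in>chains Y (Suc 0). bounded_by \<nu> R' (w + frag_extend bd t)"
  proof -
    obtain R' where "\<forall>k\<le>n. \<forall>w\<in>chains Y k. bounded_by \<nu> 0 (frag_extend bd w) \<longrightarrow>
      (\<exists>t\<in>chains Y (Suc k). bounded_by \<nu> R' (w + frag_extend bd t))" using ess by blast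
    then show thesis using that[of R'] cx.d_zero by auto
  qed
  obtain X where X: "finite X" "X \<subseteq> {y \<in> Y 0. \<nu> y \<le> R'}"
    "\<forall>y\<in>{y \<in> Y 0. \<nu> y \<le> R'}. \<exists>g\<in>carrier GH. \<exists>x\<in>X. y = left_shift G g x"
    by (rule orbit_finiteE[OF orbit_finite_sublevel[of 0 R']]) auto
  define XA where "XA = (\<lambda>x. augm (frag_of x)) ` X"
  have XA: "finite XA" "XA \<subseteq> carrier A" using X(1,2) augm_closed by (auto simp: XA_def)
  have smc: "frag_of g \<odot>\<^bsub>A\<^esub> x \<in> carrier A" if "g \<in> H" "x \<in> carrier A" for g x
    using left_module.smult_closed[OF A_module_H] that by simp
  have gen: "\<exists>c. keys c \<subseteq> carrier GH \<times> XA \<and> lin_ext A (\<lambda>y. frag_of (fst y) \<odot>\<^bsub>A\<^esub> snd y) c = a"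
    if a: "a \<in> carrier A" for a
  proof -
    obtain w where w: "w \<in> chains Y 0" "augm w = a" using augm_surj[OF a] by blast
    obtain t where t: "t \<in> chains Y (Suc 0)" "bounded_by \<nu> R' (w + frag_extend bd t)" using R'[OF w(1)] by blast
    define w' where "w' = w + frag_extend bd t"
    have w'C: "w' \<in> chains Y 0" using w(1) ext_bd_closed[OF t(1)] unfolding w'_def by (rule chains_add)
    have w'a: "augm w' = a" using augm_eq_iff[OF w'C w(1)] t(1) w(2) by (auto simp: w'_def)
    have kw: "keys w' \<subseteq> {y \<in> Y 0. \<nu> y \<le> R'}"
      using w'C t(2) by (auto simp: chains_def bounded_by_def w'_def)
    define \<eta>r where "\<eta>r y = (SOME z. fst z \<in> H \<and> snd z \<in> X \<and> y = left_shift G (fst z) (snd z))" for y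
    define \<eta> where "\<eta> y = fst (\<eta>r y)" for y
    define r where "r y = snd (\<eta>r y)" for y
    have \<eta>: "\<eta> y \<in> H \<and> r y \<in> X \<and> y = left_shift G (\<eta> y) (r y)" if y: "y \<in> {y \<in> Y 0. \<nu> y \<le> R'}" for y
    proof -
      obtain g x where "g \<in> carrier GH" "x \<in> X" "y = left_shift G g x" using bspec[OF X(3) y] by blast
      then have "\<exists>z. fst z \<in> H \<and> snd z \<in> X \<and> y = left_shift G (fst z) (snd z)"
        by (intro exI[of _ "(g, x)"]) simp
      then have "fst (\<eta>r y) \<in> H \<and> snd (\<eta>r y) \<in> X \<and> y = left_shift G (fst (\<eta>r y)) (snd (\<eta>r y))"
        unfolding \<eta>r_def by (rule someI_ex)
      then show ?thesis unfolding \<eta>_def r_def .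
    qed
    define v where "v y = frag_of (\<eta> y, augm (frag_of (r y)))" for y
    have "lin_ext A (\<lambda>y. frag_of (fst y) \<odot>\<^bsub>A\<^esub> snd y) (frag_extend v w') = augm w'"
    proof (rule frag_additive_eq[OF A_abelian _ _ _ kw])
      have "frag_additive A (H \<times> XA) (lin_ext A (\<lambda>y. frag_of (fst y) \<odot>\<^bsub>A\<^esub> snd y))"
        by (rule lin_ext_additive[OF A_abelian]) (use smc XA in auto)
      then show "frag_additive A {y \<in> Y 0. \<nu> y \<le> R'} (\<lambda>c. lin_ext A (\<lambda>y. frag_of (fst y) \<odot>\<^bsub>A\<^esub> snd y) (frag_extend v c))"
        by (rule frag_additive_frag_extend) (use \<eta> in \<open>auto simp: v_def XA_def\<close>)
      show "frag_additive A {y \<in> Y 0. \<nu> y \<le> R'} augm"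
        by (rule frag_additive_subset[OF augm_additive]) auto
      fix y assume y: "y \<in> {y \<in> Y 0. \<nu> y \<le> R'}"
      have rX: "r y \<in> Y 0" "\<eta> y \<in> carrier G" using \<eta>[OF y] X(2) H_subset by auto
      have "augm (frag_of y) = augm (translate (left_shift G) (\<eta> y) (frag_of (r y)))"
        using \<eta>[OF y] by simp
      also have "\<dots> = frag_of (\<eta> y) \<odot>\<^bsub>A\<^esub> augm (frag_of (r y))"
        by (rule augm_translate) (use rX in auto)
      finally show "lin_ext A (\<lambda>y. frag_of (fst y) \<odot>\<^bsub>A\<^esub> snd y) (frag_extend v (frag_of y)) = augm (frag_of y)"
        using smc[of "\<eta> y" "augm (frag_of (r y))"] \<eta>[OF y] augm_closed[of "frag_of (r y)"] rX(1)
        by (simp add: v_def lin_ext_frag_of[OF A_abelian])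
    qed
    moreover have "keys (frag_extend v w') \<subseteq> carrier GH \<times> XA"
    proof
      fix z assume "z \<in> keys (frag_extend v w')"
      then obtain y where y: "y \<in> keys w'" "z \<in> keys (v y)" by (rule keys_frag_extend_D)
      then have "y \<in> {y \<in> Y 0. \<nu> y \<le> R'}" using kw by blast
      from \<eta>[OF this] show "z \<in> carrier GH \<times> XA" using y(2) by (simp add: v_def XA_def)
    qed
    ultimately show ?thesis using w'a by blast
  qed
  obtain S :: "nat \<Rightarrow> ('g \<times> nat) set" and e a0 where S: "tuple_resolution GH A S e a0" "finite (S 0)"
    "\<forall>k. (\<exists>X. finite X \<and> X \<subseteq> tuple_cycles GH A S e a0 k \<and>
        tuple_cycles GH A S e a0 k \<subseteq> translate_span GH (left_shift GH) X) \<longrightarrow> finite (S (Suc k))"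
    by (rule ex_tuple_resolution[OF group_GH A_module_H XA gen])
  interpret P: tuple_resolution GH A S e a0 by (rule S(1))
  interpret pair: resolution_pair GH "left_shift G" Y bd "left_shift GH" P.Y P.bd "\<lambda>c p. augm c = P.augm p"
    by (rule resolution_pair_if_augmented[OF free_complex_H augmentation_augm[OF H_subset] P.cx.free_complex_axioms
          P.augmentation_augm A_abelian])
  have finS: "finite (S k)" if "k \<le> n" for k
    using that
  proof (induction k)
    case 0
    show ?case by (rule S(2))
  next
    case (Suc k)
    have orb: "orbit_finite GH (left_shift GH) (P.Y k)"
      unfolding orbit_finite_def
    proof (intro exI conjI ballI)
      show "finite ({\<one>} \<times> ({k} \<times> S k))" using Suc by simp
      show "{\<one>} \<times> ({k} \<times> S k) \<subseteq> P.Y k" using P.one_closed by (auto simp: Y_of_def)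
      fix y assume "y \<in> P.Y k"
      then obtain g x where y: "y = (g, (k, x))" "g \<in> H" "x \<in> S k" by (auto simp: Y_of_def)
      then show "\<exists>g\<in>carrier GH. \<exists>x\<in>{\<one>} \<times> ({k} \<times> S k). y = left_shift GH g x"
        using H_subset by (intro bexI[of _ g] bexI[of _ "(\<one>, (k, x))"]) auto
    qed
    obtain X where "finite X" "X \<subseteq> P.cx.d ` P.cx.C (Suc k)" "P.cx.d ` P.cx.C (Suc k) \<subseteq> translate_span GH (left_shift GH) X"
    proof (rule pair.boundaries_finitely_generated[of \<nu> k])
      show "\<exists>R'. \<forall>w\<in>chains Y (Suc k). bounded_by \<nu> R (frag_extend bd w) \<longrightarrow>
          (\<exists>t\<in>chains Y (Suc (Suc k)). bounded_by \<nu> R' (w + frag_extend bd t))" for R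
        using ess[of R] Suc.prems by blast
      show "orbit_finite GH (left_shift G) {y \<in> Y (Suc k). \<nu> y \<le> R}" for R
        by (rule orbit_finite_sublevel[OF Suc.prems])
    qed (use orb \<nu>_invariant in auto)
    then show ?case using S(3) unfolding P.cycles_eq_boundaries by blast
  qed
  obtain j :: "('g \<times> (nat \<times> ('g \<times> nat)) \<Rightarrow>\<^sub>0 int) \<Rightarrow> 'g \<times> nat" where j: "inj j"
    using ex_inj_tuple_chains by blast
  \<comment> \<open>The carrier type of \<open>FP_type\<close> consists of functions with values in
    the group ring. A chain \<open>c\<close> is stored as a function with the single key
    \<open>j c\<close>, at which the value is nonzero, so that the key can be recovered.\<close>
  define \<iota> where "\<iota> c = Poly_Mapping.single (j c) (frag_of (undefined :: 'g))" for c
  have "inj \<iota>"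
  proof (rule injI)
    fix c c' assume "\<iota> c = \<iota> c'"
    then have "keys (\<iota> c) = keys (\<iota> c')" by simp
    then have "j c = j c'" by (simp add: \<iota>_def)
    then show "c = c'" using j by (simp add: inj_eq)
  qed
  then interpret T: transported_resolution GH A S e a0 \<iota>
    by unfold_locales
  show ?thesis unfolding FP_type_def
    using T.based_free_resolution_resolution T.admissible_resolution T.fg_skeleton_resolution[of n] finS by blast
qed

end

theorem theorem1p2:
  fixes n :: nat
    and G :: "('g, 'b) monoid_scheme"
    and \<rho> :: "'g \<Rightarrow> 'm::metric_space \<Rightarrow> 'm"
    and A :: "('g \<Rightarrow>\<^sub>0 int, 'a) module"
    and F :: "('g, 'f, 'a) based_complex"
    and h :: "nat \<Rightarrow> 'f \<Rightarrow> 'm set"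
    and b :: 'm
  assumes "CAT0 TYPE('m)" and "proper_space TYPE('m)" and "\<not> compact (UNIV :: 'm set)"
    and "group G" and "isometric_action G \<rho>"
    and "cocompact_action G \<rho>" and "\<And>x. discrete (orbit G \<rho> x)"
    and "left_module (group_ring G) A" and "FP_type n G A"
    and "based_free_resolution G A F" and "admissible A F" and "fg_skeleton G n F"
    and "control_map G \<rho> F h"
  shows "Sigma_inv n A F h = bdry_at_infinity \<longleftrightarrow>
         FP_type n (G\<lparr>carrier := stabilizer G \<rho> b\<rparr>) A"
proof -
  interpret record_control_stabilizer G A F \<rho> h n b
    by (intro record_control_stabilizer.intro record_control_stabilizer_axioms.intro record_control.intro
        record_control_axioms.intro record_resolution.intro record_resolution_axioms.intro assms)
  have bdry: "bdry_at_infinity = {ray_end \<gamma> | \<gamma> :: real \<Rightarrow> 'm. geodesic_ray \<gamma>}"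
    by (auto simp: bdry_at_infinity_def quotient_def ray_end_def)
  show ?thesis unfolding H_def[symmetric]
  proof
    assume \<Sigma>: "Sigma_inv n A F h = (bdry_at_infinity :: (real \<Rightarrow> 'm) set set)"
    have ca: "\<exists>s. \<forall>w\<in>chains Y m. (\<forall>y\<in>keys (frag_extend bd w). s \<le> busemann \<gamma> (\<pi> y)) \<longrightarrow>
      (\<exists>\<tau>\<in>chains Y (Suc m). \<forall>y\<in>keys (w + frag_extend bd \<tau>). t \<le> busemann \<gamma> (\<pi> y))"
      if m: "m \<le> n" and \<gamma>: "geodesic_ray \<gamma>" for m \<gamma> t
    proof -
      \<comment> \<open>\<open>Sigma_inv\<close> consists of asymptoty classes, so \<open>CA\<close>
        is known for some ray \<gamma>' asymptotic to \<gamma>. The two Busemann functions differ by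
        at most \<open>K\<close>, and both thresholds are shifted by \<open>K\<close>.\<close>
      have "ray_end \<gamma> \<in> Sigma_inv n A F h" using \<Sigma> bdry \<gamma> by blast
      then obtain \<gamma>' where \<gamma>': "ray_end \<gamma> = ray_end \<gamma>'" "geodesic_ray \<gamma>'"
        "\<And>k. \<lbrakk>-1 \<le> k; k < int n\<rbrakk> \<Longrightarrow> CA_along k A F h \<gamma>'" unfolding Sigma_inv_def by blast
      have "(\<gamma>, \<gamma>) \<in> asymptotic" using \<gamma> by (auto simp: asymptotic_def)
      then have "(\<gamma>', \<gamma>) \<in> asymptotic" using \<gamma>'(1) by (auto simp: ray_end_def)
      then obtain K where K: "\<And>x. \<bar>busemann \<gamma>' x - busemann \<gamma> x\<bar> \<le> K" by (rule busemann_asymptotic) blast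
      obtain s where s: "\<forall>w\<in>chains Y m. (\<forall>y\<in>keys (frag_extend bd w). s \<le> busemann \<gamma>' (\<pi> y)) \<longrightarrow>
        (\<exists>\<tau>\<in>chains Y (Suc m). \<forall>y\<in>keys (w + frag_extend bd \<tau>). t + K \<le> busemann \<gamma>' (\<pi> y))"
        using acyclic_along_ray_if_CA[OF \<gamma>'(2,3) m] by blast
      show ?thesis
      proof (intro exI[of _ "s + K"] ballI impI)
        fix w assume w: "w \<in> chains Y m" and dw: "\<forall>y\<in>keys (frag_extend bd w). s + K \<le> busemann \<gamma> (\<pi> y)"
        have "s \<le> busemann \<gamma>' (\<pi> y)" if "y \<in> keys (frag_extend bd w)" for y
          using bspec[OF dw that] K[of "\<pi> y"] by linarith
        then obtain \<tau> where \<tau>: "\<tau> \<in> chains Y (Suc m)" "\<forall>y\<in>keys (w + frag_extend bd \<tau>). t + K \<le> busemann \<gamma>' (\<pi> y)"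
          using s w by blast
        have "t \<le> busemann \<gamma> (\<pi> y)" if "y \<in> keys (w + frag_extend bd \<tau>)" for y
          using bspec[OF \<tau>(2) that] K[of "\<pi> y"] by linarith
        then show "\<exists>\<tau>\<in>chains Y (Suc m). \<forall>y\<in>keys (w + frag_extend bd \<tau>). t \<le> busemann \<gamma> (\<pi> y)"
          using \<tau>(1) by blast
      qed
    qed
    show "FP_type n GH A"
      by (rule FP_if_essentially_acyclic, rule ctl.essentially_acyclic_if_rays_acyclic[OF assms(1,2) ca])
  next
    assume FP: "FP_type n GH A"
    obtain K where K: "compact K" "(\<Union>g\<in>carrier G. \<rho> g ` K) = UNIV"
      using assms(6) by (auto simp: cocompact_action_def)
    \<comment> \<open>The compact set whose translates cover \<open>M\<close> lies in a ball around
      \<open>b\<close>, so every point is within \<open>D0\<close> of the orbit of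
      \<open>b\<close>.\<close>
    obtain D0 where D0: "\<And>x. x \<in> K \<Longrightarrow> dist b x \<le> D0"
      using compact_imp_bounded[OF K(1)] unfolding bounded_any_center[where a = b] by blast
    have coc: "\<exists>g\<in>carrier G. dist p (\<rho> g b) \<le> D0" for p
    proof -
      have "p \<in> (\<Union>g\<in>carrier G. \<rho> g ` K)" using K(2) by simp
      then obtain g x where gx: "g \<in> carrier G" "x \<in> K" "p = \<rho> g x" by blast
      then show ?thesis using D0[of x] by (intro bexI[of _ g]) (auto simp: \<rho>_dist dist_commute)
    qed
    have all: "\<exists>R'. \<forall>p. \<forall>k\<le>n. \<forall>w\<in>chains Y k. ctl.near p R (frag_extend bd w) \<longrightarrow>
        (\<exists>t\<in>chains Y (Suc k). ctl.near p R' (w + frag_extend bd t))" for R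
    proof -
      obtain R' where "\<And>p k w. \<lbrakk>k \<le> n; w \<in> chains Y k; ctl.near p R (frag_extend bd w)\<rbrakk> \<Longrightarrow>
          \<exists>t\<in>chains Y (Suc k). ctl.near p R' (w + frag_extend bd t)"
        using ctl.essentially_acyclic_all_points[OF essentially_acyclic_if_FP[OF FP] coc] by blast
      then show ?thesis by blast
    qed
    obtain \<Lambda> where \<Lambda>: "\<Lambda> \<ge> 0" "\<And>q r k w. \<lbrakk>r \<ge> 0; k \<le> n; w \<in> chains Y k; ctl.near q r (frag_extend bd w)\<rbrakk> \<Longrightarrow>
        \<exists>t\<in>chains Y (Suc k). ctl.near q (r + \<Lambda>) (w + frag_extend bd t)"
      using ctl.ball_acyclic[OF assms(1) all] by blast
    have "CA_along k A F h \<gamma>" if \<gamma>: "geodesic_ray \<gamma>" and k: "k < int n" for \<gamma> k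
    proof (rule CA_if_acyclic_along_ray[OF \<gamma> _ _ k])
      \<comment> \<open>The 1 is the loss in \<open>ray_acyclic\<close> caused by replacing a
        horoball by a ball.\<close>
      show "0 \<le> \<Lambda> + 1" using \<Lambda>(1) by simp
      show "\<exists>\<tau>\<in>chains Y (Suc m). \<forall>y\<in>keys (w + frag_extend bd \<tau>). s - (\<Lambda> + 1) \<le> busemann \<gamma> (\<pi> y)"
        if "m \<le> n" "w \<in> chains Y m" "\<And>y. y \<in> keys (frag_extend bd w) \<Longrightarrow> s \<le> busemann \<gamma> (\<pi> y)" for s m w
        by (rule ctl.ray_acyclic[where s = s, OF \<Lambda> \<gamma> that]) blast+
    qed
    then show "Sigma_inv n A F h = bdry_at_infinity"
      unfolding bdry Sigma_inv_def by blast
  qed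
qed

end
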